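(* Let $\{\Phi(R_j)\}_{j\ge 1}$ be the enumeration of the edge curves of the harmonic Sierpinski gasket $K_H$, let $\ell_j = L(\Phi(R_j))$ be their lengths, and let $\mathfrak d_H$ be the spectral dimension of $K_H$ induced by the spectral triple $S(K_H)$ (all defined in the context). Then the sum $\sum_{j\ge 1}\ell_j^{s}$ converges for every $s>\frac{\log 3}{\log 5-\log 3}$. In particular, $$1\le \mathfrak d_H\le \frac{\log 3}{\log 5-\log 3}.$$
   Context: **Sierpinski gasket.** Let $p_1=(0,0)$, $p_2=(\frac12,\frac{\sqrt3}{2})$, $p_3=(1,0)$, let $T$ be the equilateral triangle (union of three closed edges) with these vertices, and let $f_j(x)=\frac12(x-p_j)+p_j$ on $\mathbb R^2$, $j=1,2,3$. For a word $w=w_1\cdots w_n\in\{1,2,3\}^n$ put $f_w=f_{w_n}\circ\cdots\circ f_{w_1}$ ($f_\emptyset=\mathrm{id}$). $SG$ is the unique nonempty compact set with $SG=\bigcup_{j=1}^3 f_j(SG)$; $SG_n=\bigcup_{w\in\{1,2,3\}^n}f_w(T)$; $V_0=\{p_1,p_2,p_3\}$, $V_n=\bigcup_{w\in\{1,2,3\}^n}f_w(V_0)$, $V^*=\bigcup_n V_n$. **Harmonic functions.** For $f:V_n\to\mathbb R$ let $E_n(f)=\sum_{x\sim_n y}(f(x)-f(y))^2$, where $x\sim_n y$ means that $x\ne y$ both lie in $f_w(V_0)$ for some $w\in\{1,2,3\}^n$, each unordered pair being counted once. A function on $V^*$ is harmonic if for each $k\ge1$ its restriction to $V_k$ minimizes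 $E_k$ given its values on $V_0$. Harmonic functions on $V^*$ are uniformly continuous and so extend uniquely to continuous functions on $SG$. Let $h_j:SG\to\mathbb R$ be the harmonic function with $h_j(p_k)=\delta_{jk}$. **Harmonic gasket.** $\Phi:SG\to\mathbb R^3$, $\Phi(x)=\frac1{\sqrt2}\big((h_1(x),h_2(x),h_3(x))-\frac13(1,1,1)\big)$, and $K_H=\Phi(SG)$. **Edge curves.** Let $R_1,R_2,\dots$ enumerate, over all $n\ge0$, the $3^{n+1}$ edges of the triangles $f_w(T)$, $w\in\{1,2,3\}^n$ (each edge of level $n$ is a segment of length $2^{-n}$). $\Phi(R_j)$ is the image curve in $K_H$, which is rectifiable; $\ell_j=L(\Phi(R_j))$ is its Euclidean length, and it is parametrized by arclength on $[0,\ell_j]$. **Spectral triple of a curve.** For a compact Hausdorff space $X$, $\ell>0$ and a continuous injective $R:[0,\ell]\to X$: the algebra is $C(X)$, the Hilbert space is $\mathscr H_\ell=L^2([-\ell,\ell],(2\ell)^{-1}dm)$ ($m$ = Lebesgue measure) with representation $(\pi_\ell(f)h)(x)=f(R(|x|))h(x)$, and $D_\ell=D+\frac{\pi}{2\ell}I$, where $D$ is the closure of $-i\frac{d}{dx}$ on $\mathrm{span}\{e^{i\pi kx/\ell}:k\in\mathbb Z\}$. Thus $D_\ell$ has orthonormal eigenbasis $e^{i\pi kx/\ell}$ with eigenvalues $\frac{(2k+1)\pi}{2\ell}$, $k\in\mathbb Z$. **Spectral triple of $K_H$.** $S(K_H)=\big(C(K_H),\bigoplus_{j\ge1}\mathscr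 H_{\ell_j},D_{K_H}=\bigoplus_{j\ge1}D_{\ell_j}\big)$ with representation $\pi_H=\bigoplus_j\pi_{\ell_j}$, the $j$-th summand being the triple of the curve $\Phi(R_j)$. Its spectral dimension is $\mathfrak d_H=\inf\{p>0:\mathrm{tr}((I+D_{K_H}^2)^{-p/2})<\infty\}$. *)

theory Defs
  imports "HOL-Analysis.Analysis"
begin

section \<open>The Sierpinski gasket\<close>

text \<open>The indices $1,2,3$ are the elements of the three-element type \<^typ>\<open>3\<close>; words are lists over it.\<close>

definition sg_vertex :: "3 \<Rightarrow> real^2" where
  "sg_vertex j = (if j = 1 then vector [0, 0]
                  else if j = 2 then vector [1/2, sqrt 3 / 2]
                  else vector [1, 0])"

definition sg_map :: "3 \<Rightarrow> real^2 \<Rightarrow> real^2" where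
  "sg_map j x = (1/2) *\<^sub>R (x - sg_vertex j) + sg_vertex j"

text \<open>\<^const>\<open>fold\<close> applies the map of the first letter first.\<close>

definition sg_word :: "3 list \<Rightarrow> real^2 \<Rightarrow> real^2" where
  "sg_word w = fold sg_map w"

definition SG :: "(real^2) set" where
  "SG = (THE K. K \<noteq> {} \<and> compact K \<and> K = (\<Union>j. sg_map j ` K))"

definition sg_V :: "nat \<Rightarrow> (real^2) set" where
  "sg_V n = (\<Union>w\<in>{w. length w = n}. sg_word w ` range sg_vertex)"

text \<open>All edges of the triangles $f_w(T)$, for all words $w$ of all lengths.\<close>

definition sg_edges :: "(real^2) set set" where
  "sg_edges = {sg_word w ` closed_segment (sg_vertex i) (sg_vertex j) | w i j. i \<noteq> j}"

section \<open>Harmonic functions\<close>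

definition sg_adj :: "nat \<Rightarrow> real^2 \<Rightarrow> real^2 \<Rightarrow> bool" where
  "sg_adj n x y \<longleftrightarrow> x \<noteq> y \<and>
     (\<exists>w. length w = n \<and> x \<in> sg_word w ` range sg_vertex \<and> y \<in> sg_word w ` range sg_vertex)"

text \<open>The sum runs over ordered pairs, hence the factor $1/2$.\<close>

definition sg_energy :: "nat \<Rightarrow> (real^2 \<Rightarrow> real) \<Rightarrow> real" where
  "sg_energy n u = (\<Sum>(x, y)\<in>{(x, y). sg_adj n x y}. (u x - u y)\<^sup>2) / 2"

text \<open>Only the values of \<open>u\<close> on the union of the sets \<^term>\<open>sg_V k\<close> matter.\<close>

definition harmonic :: "(real^2 \<Rightarrow> real) \<Rightarrow> bool" where
  "harmonic u \<longleftrightarrow>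
     (\<forall>k\<ge>1. \<forall>v. (\<forall>x\<in>sg_V 0. v x = u x) \<longrightarrow> sg_energy k u \<le> sg_energy k v)"

text \<open>The continuous extension to \<^const>\<open>SG\<close>; \<^const>\<open>extensional\<close> only pins down the
  irrelevant values outside \<^const>\<open>SG\<close>.\<close>

definition sg_h :: "3 \<Rightarrow> real^2 \<Rightarrow> real" where
  "sg_h j = (THE u. u \<in> extensional SG \<and> continuous_on SG u \<and> harmonic u \<and>
                    (\<forall>k. u (sg_vertex k) = (if k = j then 1 else 0)))"

section \<open>The harmonic gasket and its edge curves\<close>

definition Phi :: "real^2 \<Rightarrow> real^3" where
  "Phi x = (1 / sqrt 2) *\<^sub>R ((\<chi> j. sg_h j x) - (1/3) *\<^sub>R vector [1, 1, 1])"

definition K_H :: "(real^3) set" where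
  "K_H = Phi ` SG"

definition curve_length :: "(real \<Rightarrow> 'a::metric_space) \<Rightarrow> real \<Rightarrow> real \<Rightarrow> real" where
  "curve_length c a b =
     Sup {(\<Sum>i<n. dist (c (t i)) (c (t (Suc i)))) | (t :: nat \<Rightarrow> real) n.
            t 0 = a \<and> t n = b \<and> (\<forall>i<n. t i \<le> t (Suc i))}"

definition arclength_param :: "(real \<Rightarrow> 'a::metric_space) \<Rightarrow> real \<Rightarrow> 'a" where
  "arclength_param c s = c (SOME u. u \<in> {0..1} \<and> curve_length c 0 u = s)"

text \<open>An edge is a set; the choice of a linear parametrization is only a choice of orientation.\<close>

definition edge_curve :: "(real^2) set \<Rightarrow> real \<Rightarrow> real^3" where
  "edge_curve R = Phi \<circ> (SOME c. \<exists>a b. R = closed_segment a b \<and> c = linepath a b)"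

definition edge_length :: "(real^2) set \<Rightarrow> real" where
  "edge_length R = curve_length (edge_curve R) 0 1"

section \<open>Spectral triples\<close>

text \<open>
  A Hilbert space is given by a set of complex-valued functions with a semi-inner product (linear in
  the first argument); two functions at seminorm distance $0$ (for $L^2$: equal almost everywhere)
  represent the same vector. Every notion below respects this identification. An unbounded
  operator is given by its graph. Algebra elements are functions of which only the values on the
  underlying compact space matter.\<close>

record ('x, 'i) spectral_triple =
  st_algebra :: "('x \<Rightarrow> complex) set"
  st_space :: "('i \<Rightarrow> complex) set"
  st_inner :: "('i \<Rightarrow> complex) \<Rightarrow> ('i \<Rightarrow> complex) \<Rightarrow> complex"
  st_rep :: "('x \<Rightarrow> complex) \<Rightarrow> ('i \<Rightarrow> complex) \<Rightarrow> ('i \<Rightarrow> complex)"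
  st_dirac :: "(('i \<Rightarrow> complex) \<times> ('i \<Rightarrow> complex)) set"

definition st_norm :: "('x, 'i) spectral_triple \<Rightarrow> ('i \<Rightarrow> complex) \<Rightarrow> real" where
  "st_norm S h = sqrt (Re (st_inner S h h))"

definition st_eq :: "('x, 'i) spectral_triple \<Rightarrow> ('i \<Rightarrow> complex) \<Rightarrow> ('i \<Rightarrow> complex) \<Rightarrow> bool" where
  "st_eq S g h \<longleftrightarrow> st_norm S (\<lambda>x. g x - h x) = 0"

definition st_onb :: "('x, 'i) spectral_triple \<Rightarrow> (nat \<Rightarrow> 'i \<Rightarrow> complex) \<Rightarrow> bool" where
  "st_onb S e \<longleftrightarrow>
     (\<forall>n. e n \<in> st_space S) \<and>
     (\<forall>m n. st_inner S (e m) (e n) = (if m = n then 1 else 0)) \<and>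
     (\<forall>h\<in>st_space S.
        (\<lambda>N. st_norm S (\<lambda>x. h x - (\<Sum>n<N. st_inner S h (e n) * e n x))) \<longlonglongrightarrow> 0)"

definition st_bounded_linear ::
    "('x, 'i) spectral_triple \<Rightarrow> (('i \<Rightarrow> complex) \<Rightarrow> ('i \<Rightarrow> complex)) \<Rightarrow> bool" where
  "st_bounded_linear S T \<longleftrightarrow>
     (\<forall>h\<in>st_space S. T h \<in> st_space S) \<and>
     (\<forall>g\<in>st_space S. \<forall>h\<in>st_space S. st_eq S (T (\<lambda>x. g x + h x)) (\<lambda>x. T g x + T h x)) \<and>
     (\<forall>h\<in>st_space S. \<forall>c. st_eq S (T (\<lambda>x. c * h x)) (\<lambda>x. c * T h x)) \<and>
     (\<exists>C. \<forall>h\<in>st_space S. st_norm S (T h) \<le> C * st_norm S h)"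

text \<open>The graph of $I + D^2$ on its natural domain.\<close>

definition st_one_plus_dirac_sq ::
    "('x, 'i) spectral_triple \<Rightarrow> (('i \<Rightarrow> complex) \<times> ('i \<Rightarrow> complex)) set" where
  "st_one_plus_dirac_sq S =
     {(h, \<lambda>x. h x + k x) | h g k. (h, g) \<in> st_dirac S \<and> (g, k) \<in> st_dirac S}"

text \<open>Functional calculus for an operator \<open>A\<close> that has an orthonormal basis of eigenvectors with real
  eigenvalues: \<open>T\<close> is the bounded operator $\varphi(A)$.\<close>

definition st_fun_calc ::
    "('x, 'i) spectral_triple \<Rightarrow> (real \<Rightarrow> real) \<Rightarrow> (('i \<Rightarrow> complex) \<times> ('i \<Rightarrow> complex)) set
      \<Rightarrow> (('i \<Rightarrow> complex) \<Rightarrow> ('i \<Rightarrow> complex)) \<Rightarrow> bool" where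
  "st_fun_calc S \<phi> A T \<longleftrightarrow>
     st_bounded_linear S T \<and>
     (\<exists>e (lam :: nat \<Rightarrow> real). st_onb S e \<and>
        (\<forall>n. (e n, \<lambda>x. of_real (lam n) * e n x) \<in> A \<and>
             st_eq S (T (e n)) (\<lambda>x. of_real (\<phi> (lam n)) * e n x)))"

text \<open>The trace, in $[0,\infty]$, of a positive bounded operator; it does not depend on the basis.\<close>

definition st_trace ::
    "('x, 'i) spectral_triple \<Rightarrow> (('i \<Rightarrow> complex) \<Rightarrow> ('i \<Rightarrow> complex)) \<Rightarrow> ennreal" where
  "st_trace S T = (let e = (SOME e. st_onb S e)
                   in (\<Sum>n. ennreal (Re (st_inner S (T (e n)) (e n)))))"

text \<open>The infimum is taken in the extended reals, so that it is $\infty$ for the empty set.\<close>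

definition spectral_dimension :: "('x, 'i) spectral_triple \<Rightarrow> ereal" where
  "spectral_dimension S =
     Inf (ereal ` {p. p > 0 \<and>
       (\<exists>T. st_fun_calc S (\<lambda>t. t powr (- p / 2)) (st_one_plus_dirac_sq S) T \<and>
            st_trace S T < \<infinity>)})"

subsection \<open>The triple of a curve\<close>

definition L2_measure :: "real \<Rightarrow> real measure" where
  "L2_measure l = density (lebesgue_on {-l..l}) (\<lambda>_. ennreal (1 / (2 * l)))"

definition L2_space :: "real \<Rightarrow> (real \<Rightarrow> complex) set" where
  "L2_space l = {h \<in> borel_measurable (L2_measure l).
                   integrable (L2_measure l) (\<lambda>x. (cmod (h x))\<^sup>2)}"

definition L2_inner :: "real \<Rightarrow> (real \<Rightarrow> complex) \<Rightarrow> (real \<Rightarrow> complex) \<Rightarrow> complex" where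
  "L2_inner l g h = (LINT x|L2_measure l. g x * cnj (h x))"

definition L2_norm :: "real \<Rightarrow> (real \<Rightarrow> complex) \<Rightarrow> real" where
  "L2_norm l h = sqrt (Re (L2_inner l h h))"

definition trig_polys :: "real \<Rightarrow> (real \<Rightarrow> complex) set" where
  "trig_polys l = {(\<lambda>x. \<Sum>k\<in>K. c k * exp (\<i> * of_real (pi * of_int k * x / l))) |
                     (c :: int \<Rightarrow> complex) K. finite K}"

text \<open>The graph of the closure $D$ of $-i\,d/dx$ on the trigonometric polynomials, and the graph of
  $D + \frac{\pi}{2\ell} I$.\<close>

definition D_closure :: "real \<Rightarrow> ((real \<Rightarrow> complex) \<times> (real \<Rightarrow> complex)) set" where
  "D_closure l = {(h, g). h \<in> L2_space l \<and> g \<in> L2_space l \<and>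
     (\<exists>u. (\<forall>n. u n \<in> trig_polys l) \<and>
        (\<lambda>n. L2_norm l (\<lambda>x. u n x - h x)) \<longlonglongrightarrow> 0 \<and>
        (\<lambda>n. L2_norm l (\<lambda>x. - \<i> * vector_derivative (u n) (at x) - g x)) \<longlonglongrightarrow> 0)}"

definition D_curve :: "real \<Rightarrow> ((real \<Rightarrow> complex) \<times> (real \<Rightarrow> complex)) set" where
  "D_curve l = {(h, \<lambda>x. g x + of_real (pi / (2 * l)) * h x) | h g. (h, g) \<in> D_closure l}"

definition curve_triple ::
    "'x::topological_space set \<Rightarrow> real \<Rightarrow> (real \<Rightarrow> 'x) \<Rightarrow> ('x, real) spectral_triple" where
  "curve_triple X l R =
     \<lparr> st_algebra = {f. continuous_on X f},
       st_space = L2_space l,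
       st_inner = L2_inner l,
       st_rep = (\<lambda>f h x. f (R \<bar>x\<bar>) * h x),
       st_dirac = D_curve l \<rparr>"

subsection \<open>Direct sums and the triple of the harmonic gasket\<close>

text \<open>A family $(h_j)_j$ is a function of pairs \<open>(j, x)\<close>; \<open>summand j\<close> extracts its \<open>j\<close>-th member.\<close>

definition summand :: "nat \<Rightarrow> (nat \<times> 'i \<Rightarrow> complex) \<Rightarrow> 'i \<Rightarrow> complex" where
  "summand j h = (\<lambda>x. h (j, x))"

definition sum_space ::
    "(nat \<Rightarrow> ('x, 'i) spectral_triple) \<Rightarrow> (nat \<times> 'i \<Rightarrow> complex) set" where
  "sum_space S = {h. (\<forall>j. summand j h \<in> st_space (S j)) \<and>
                     summable (\<lambda>j. (st_norm (S j) (summand j h))\<^sup>2)}"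

definition sum_triple ::
    "('x \<Rightarrow> complex) set \<Rightarrow> (nat \<Rightarrow> ('x, 'i) spectral_triple) \<Rightarrow> ('x, nat \<times> 'i) spectral_triple"
where
  "sum_triple A S =
     \<lparr> st_algebra = A,
       st_space = sum_space S,
       st_inner = (\<lambda>g h. \<Sum>j. st_inner (S j) (summand j g) (summand j h)),
       st_rep = (\<lambda>f h (j, x). st_rep (S j) f (summand j h) x),
       st_dirac = {(h, g). h \<in> sum_space S \<and> g \<in> sum_space S \<and>
                     (\<forall>j. (summand j h, summand j g) \<in> st_dirac (S j))} \<rparr>"

definition S_KH :: "(nat \<Rightarrow> (real^2) set) \<Rightarrow> (real^3, nat \<times> real) spectral_triple" where
  "S_KH R = sum_triple {f. continuous_on K_H f}
     (\<lambda>j. curve_triple K_H (edge_length (R j)) (arclength_param (edge_curve (R j))))"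

end

theory Submission
  imports Defs
begin

text \<open>
  A harmonic function with corner values \<open>a\<close> restricts to the cell \<open>j\<close> as the harmonic function with
  corner values \<open>cell_data j a\<close> (the $\frac25$-$\frac25$-$\frac15$ rule), and the oscillation of the
  corner values shrinks by the factor $\frac35$. On an edge, the two harmonic functions equal to $1$
  at one of its end points are monotone, and together with the constants they span all harmonic
  functions; hence the image of an edge of level $n$ has length at most a constant times
  $(\frac35)^n$, while there are $3^{n+1}$ such edges, so that $\sum_j \ell_j^s$ is dominated by a
  geometric series of ratio $3\,(\frac35)^s$.

  The operator $I + D^2$ is diagonalised by the exponentials of all edges, with the eigenvalues
  $1 + ((2k+1)\pi/2\ell_j)^2$. The trace of $(I + D^2)^{-p/2}$ is the sum of the powers of the
  eigenvalues, whatever orthonormal bases are used. It is bounded by a constant times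
  $\sum_j \ell_j^p$ if $p > 1$, and already the part belonging to a single edge diverges if
  $p \le 1$.\<close>

section \<open>The Sierpinski gasket as the closure of its vertices\<close>

text \<open>\<open>SG\<close> and \<open>sg_h\<close> are definite descriptions,
  \<open>st_trace\<close> uses a chosen basis, and \<open>spectral_dimension\<close> quantifies over
  an unspecified operator with an unspecified eigenbasis. Existence, uniqueness and independence of
  these choices therefore have to be proved before any estimate can be applied. The critical
  exponent is the root of \<open>3 * (3/5) powr s = 1\<close>. Since 5 < 9 it exceeds 1, so every
  larger exponent also makes the eigenvalue series of each single curve converge. The upper bound at
  the critical exponent itself is obtained as the limit of the bounds for larger exponents. The
  lengths must also be shown to be positive, because each of them is the half-width of an interval
  whose measure is normalised to 1. This rests on the invertibility of the 2/5-2/5-1/5 rule: the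
  restrictions of harmonic functions to a cell have arbitrary corner values there, hence the corners
  of a cell have different images.\<close>

definition bary :: "3 \<Rightarrow> real^2 \<Rightarrow> real" where
  "bary i x = (if i = 1 then 1 - x$1 - x$2 / sqrt 3
               else if i = 2 then 2 * x$2 / sqrt 3
               else x$1 - x$2 / sqrt 3)"

lemma three_distinct: "(1::3) \<noteq> 2" "(2::3) \<noteq> 1" "(1::3) \<noteq> 3" "(3::3) \<noteq> 1" "(2::3) \<noteq> 3" "(3::3) \<noteq> 2"
  by auto

lemma sum_bary: "(\<Sum>i\<in>UNIV. bary i x) = 1"
  by (simp add: bary_def sum_3)

lemma bary_vertex: "bary i (sg_vertex j) = (if i = j then 1 else 0)"
  using exhaust_3[of i] exhaust_3[of j] by (auto simp: bary_def sg_vertex_def)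

text \<open>The form in which the geometry is used: whether a point can lie in two cells at once
  becomes a comparison of barycentric coordinates with 1/2.\<close>

lemma bary_map: "bary i (sg_map j x) = (bary i x + (if i = j then 1 else 0)) / 2"
  using exhaust_3[of i] exhaust_3[of j]
  by (auto simp: bary_def sg_vertex_def sg_map_def field_simps)

lemma bary_inject:
  assumes "\<And>i. bary i x = bary i y"
  shows "x = y"
proof -
  have "x$2 = y$2" using assms[of 2] by (simp add: bary_def)
  moreover have "x$1 = y$1" using assms[of 3] calculation by (simp add: bary_def)
  ultimately show ?thesis by (simp add: vec_eq_iff forall_2)
qed

lemma continuous_on_bary: "continuous_on S (bary i)"
  unfolding bary_def by (cases "i = 1"; cases "i = 2") (auto intro!: continuous_intros)

definition sg_unmap :: "3 \<Rightarrow> real^2 \<Rightarrow> real^2" where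
  "sg_unmap j x = 2 *\<^sub>R (x - sg_vertex j) + sg_vertex j"

lemma sg_unmap_map [simp]: "sg_unmap j (sg_map j x) = x"
  by (simp add: sg_unmap_def sg_map_def)

lemma sg_map_eq_iff [simp]: "sg_map j x = sg_map j y \<longleftrightarrow> x = y"
  by (metis sg_unmap_map)

lemma sg_map_vertex_self [simp]: "sg_map j (sg_vertex j) = sg_vertex j"
  by (simp add: sg_map_def)

lemma dist_sg_map: "dist (sg_map j x) (sg_map j y) = dist x y / 2"
proof -
  have "sg_map j x - sg_map j y = (1/2) *\<^sub>R (x - y)"
    by (simp add: sg_map_def algebra_simps)
  then show ?thesis by (simp add: dist_norm)
qed

lemma continuous_on_sg_map: "continuous_on S (sg_map j)"
  unfolding sg_map_def by (intro continuous_intros)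

lemma continuous_on_sg_unmap: "continuous_on S (sg_unmap j)"
  unfolding sg_unmap_def by (intro continuous_intros)

text \<open>Both sides are the midpoint of the edge between the two vertices, the point at which the
  cells i and j touch.\<close>

lemma sg_map_vertex_commute: "sg_map i (sg_vertex j) = sg_map j (sg_vertex i)"
  by (simp add: sg_map_def vec_eq_iff field_simps)

text \<open>The first letter is the innermost map, the last letter the outermost. Inductions that
  strip the outermost map run over reversed lists; those that subdivide a given cell run over
  \<open>Cons\<close>.\<close>

lemma sg_word_Nil [simp]: "sg_word [] x = x"
  and sg_word_Cons: "sg_word (j # w) x = sg_word w (sg_map j x)"
  and sg_word_snoc: "sg_word (w @ [j]) x = sg_map j (sg_word w x)"
  by (simp_all add: sg_word_def)

lemma sg_word_eq_iff [simp]: "sg_word w x = sg_word w y \<longleftrightarrow> x = y"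
  by (induction w rule: rev_induct) (simp_all add: sg_word_snoc)

lemma dist_sg_word: "dist (sg_word w x) (sg_word w y) = dist x y / 2 ^ length w"
  by (induction w rule: rev_induct) (simp_all add: sg_word_snoc dist_sg_map)

lemma sg_V_0: "sg_V 0 = range sg_vertex"
  by (auto simp: sg_V_def)

lemma sg_V_Suc: "sg_V (Suc n) = (\<Union>j. sg_map j ` sg_V n)"
proof
  show "sg_V (Suc n) \<subseteq> (\<Union>j. sg_map j ` sg_V n)"
  proof
    fix x assume "x \<in> sg_V (Suc n)"
    then obtain w i where w: "length w = Suc n" "x = sg_word w (sg_vertex i)"
      by (auto simp: sg_V_def)
    then obtain v j where v: "w = v @ [j]" "length v = n"
      by (metis append_butlast_last_id diff_Suc_1 length_butlast length_0_conv nat.distinct(1))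
    then show "x \<in> (\<Union>j. sg_map j ` sg_V n)"
      using w by (fastforce simp: sg_V_def sg_word_snoc)
  qed
  show "(\<Union>j. sg_map j ` sg_V n) \<subseteq> sg_V (Suc n)"
  proof
    fix x assume "x \<in> (\<Union>j. sg_map j ` sg_V n)"
    then obtain j v i where v: "length v = n" "x = sg_map j (sg_word v (sg_vertex i))"
      by (auto simp: sg_V_def)
    then have "x = sg_word (v @ [j]) (sg_vertex i)" "length (v @ [j]) = Suc n"
      by (simp_all add: sg_word_snoc)
    then show "x \<in> sg_V (Suc n)" unfolding sg_V_def by blast
  qed
qed

lemma sg_V_le_Suc: "sg_V n \<subseteq> sg_V (Suc n)"
proof (induction n)
  case 0
  show ?case unfolding sg_V_Suc sg_V_0
    using sg_map_vertex_self by (metis (no_types, lifting) UN_I UNIV_I imageE image_eqI rangeI subsetI)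
next
  case (Suc n)
  then show ?case unfolding sg_V_Suc[of "Suc n"] by (subst sg_V_Suc) blast
qed

abbreviation sg_Vstar :: "(real^2) set" where
  "sg_Vstar \<equiv> \<Union>n. sg_V n"

lemma sg_Vstar_invariant: "sg_Vstar = (\<Union>j. sg_map j ` sg_Vstar)"
proof -
  have "(\<Union>j. sg_map j ` sg_Vstar) = (\<Union>n. sg_V (Suc n))"
    unfolding sg_V_Suc by blast
  also have "\<dots> = sg_Vstar" using sg_V_le_Suc by blast
  finally show ?thesis by simp
qed

lemma bary_sg_word:
  assumes "\<And>i. bary i x \<ge> 0"
  shows "bary i (sg_word w x) \<ge> 0"
  using assms by (induction w arbitrary: x) (auto simp: sg_word_Cons bary_map)

lemma bary_sg_Vstar: "x \<in> sg_Vstar \<Longrightarrow> bary i x \<ge> 0"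
  by (auto simp: sg_V_def bary_vertex intro!: bary_sg_word)

lemma bounded_bary_nonneg: "bounded {x. \<forall>i. bary i x \<ge> 0}"
proof -
  have "norm x \<le> 1 + sqrt 3" if "\<forall>i. bary i x \<ge> 0" for x
  proof -
    from that[rule_format, of 1] that[rule_format, of 2] that[rule_format, of 3]
    have b: "x$1 + x$2 / sqrt 3 \<le> 1" "0 \<le> x$2" "x$2 / sqrt 3 \<le> x$1"
      by (simp_all add: bary_def field_simps zero_le_mult_iff)
    have "0 \<le> x$2 / sqrt 3" using b by simp
    then have c: "0 \<le> x$1" "x$1 \<le> 1" "x$2 / sqrt 3 \<le> 1" using b by linarith+
    have "x$2 \<le> sqrt 3" using c(3) by (simp add: field_simps)
    moreover have "norm x \<le> (\<Sum>i\<in>UNIV. \<bar>x$i\<bar>)" by (rule norm_le_l1_cart)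
    ultimately show ?thesis using b c by (simp add: sum_2)
  qed
  then show ?thesis by (auto simp: bounded_iff)
qed

lemma sg_map_closure: "sg_map j ` closure A = closure (sg_map j ` A)"
proof -
  have *: "sg_map j = (\<lambda>x. (1/2) *\<^sub>R sg_vertex j + (1/2) *\<^sub>R x)"
    by (rule ext) (simp add: sg_map_def algebra_simps scaleR_half_double flip: scaleR_add_left)
  have "(\<lambda>x. sg_map j x) ` B = (+) ((1/2) *\<^sub>R sg_vertex j) ` ((*\<^sub>R) (1/2) ` B)" for B
    unfolding * by (simp add: image_image)
  then show ?thesis by (simp add: closure_translation closure_scaleR)
qed

section \<open>Uniqueness of the invariant compact set\<close>

lemma invariant_approx:
  assumes "K \<subseteq> (\<Union>j. sg_map j ` K)" "x \<in> K"
  shows "\<exists>w y. length w = n \<and> y \<in> K \<and> x = sg_word w y"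
proof (induction n)
  case 0
  then show ?case using assms(2) by auto
next
  case (Suc n)
  then obtain w y where w: "length w = n" "y \<in> K" "x = sg_word w y" by blast
  then obtain j z where z: "z \<in> K" "y = sg_map j z" using assms(1) by blast
  have "x = sg_word (j # w) z" "length (j # w) = Suc n" using w z by (simp_all add: sg_word_Cons)
  then show ?case using z by blast
qed

text \<open>A point of K is \<open>sg_word w y\<close> with w as long as desired, hence within
  \<open>B / 2 ^ n\<close> of the vertex \<open>sg_word w (sg_vertex 1)\<close>. The assumption is
  an inclusion and not an equation so that the lemma also applies to a single edge, which is covered
  by its two halves.\<close>

lemma invariant_subset_closure:
  assumes "K \<subseteq> (\<Union>j. sg_map j ` K)" "bounded K"
  shows "K \<subseteq> closure sg_Vstar"
proof
  fix x assume x: "x \<in> K"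
  obtain B where B: "\<And>y. y \<in> K \<Longrightarrow> dist (sg_vertex 1) y \<le> B"
    using assms(2) by (auto simp: bounded_any_center[where a = "sg_vertex 1"])
  show "x \<in> closure sg_Vstar"
    unfolding closure_approachable
  proof (intro allI impI)
    fix e :: real assume e: "e > 0"
    obtain n where "(1/2) ^ n < e / (\<bar>B\<bar> + 1)"
      using real_arch_pow_inv[of "e / (\<bar>B\<bar> + 1)" "1/2"] e by auto
    then have "(\<bar>B\<bar> + 1) / 2 ^ n < e" by (simp add: power_one_over field_simps)
    moreover have "B / 2 ^ n \<le> (\<bar>B\<bar> + 1) / 2 ^ n" by (intro divide_right_mono) auto
    ultimately have n: "B / 2 ^ n < e" by linarith
    obtain w y where w: "length w = n" "y \<in> K" "x = sg_word w y"
      using invariant_approx[OF assms(1) x] by blast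
    have "dist (sg_word w (sg_vertex 1)) x = dist (sg_vertex 1) y / 2 ^ n"
      using w by (simp add: dist_sg_word)
    also have "\<dots> \<le> B / 2 ^ n" using B[OF w(2)] by (simp add: divide_right_mono)
    finally have "dist (sg_word w (sg_vertex 1)) x < e" using n by linarith
    moreover have "sg_word w (sg_vertex 1) \<in> sg_Vstar" using w by (auto simp: sg_V_def)
    ultimately show "\<exists>y\<in>sg_Vstar. dist y x < e" by blast
  qed
qed

text \<open>Iterating the contraction \<open>sg_map j\<close> on any point of K converges to its
  fixed point \<open>sg_vertex j\<close>; K is closed, so it contains the vertices and then all
  their images.\<close>

lemma closure_Vstar_subset_invariant:
  assumes "K \<noteq> {}" "compact K" "K = (\<Union>j. sg_map j ` K)"
  shows "closure sg_Vstar \<subseteq> K"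
proof -
  have mem: "sg_word w x \<in> K" if "x \<in> K" for w x
    using that by (induction w rule: rev_induct) (simp, subst assms(3), auto simp: sg_word_snoc)
  obtain y where y: "y \<in> K" using assms(1) by blast
  have "sg_vertex j \<in> K" for j
  proof -
    have "(\<lambda>n. dist (sg_word (replicate n j) y) (sg_vertex j)) \<longlonglongrightarrow> 0"
    proof -
      have fix_j: "sg_word (replicate n j) (sg_vertex j) = sg_vertex j" for n
        by (induction n) (simp_all add: sg_word_Cons)
      have eq: "dist (sg_word (replicate n j) y) (sg_vertex j) = dist y (sg_vertex j) * (1/2) ^ n" for n
        using dist_sg_word[of "replicate n j" y "sg_vertex j"]
        by (simp add: fix_j power_divide)
      moreover have "(\<lambda>n. dist y (sg_vertex j) * (1/2) ^ n) \<longlonglongrightarrow> 0"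
        by (intro tendsto_mult_right_zero LIMSEQ_power_zero) simp
      ultimately show ?thesis by (simp only: eq)
    qed
    then have "(\<lambda>n. sg_word (replicate n j) y) \<longlonglongrightarrow> sg_vertex j" by (subst tendsto_dist_iff)
    moreover have "closed K" using assms(2) by (rule compact_imp_closed)
    ultimately show ?thesis using mem[OF y] by (meson closed_sequentially)
  qed
  then have "sg_Vstar \<subseteq> K" using mem by (auto simp: sg_V_def)
  then show ?thesis using assms(2) by (simp add: closure_minimal compact_imp_closed)
qed

lemma closure_Vstar_invariant: "closure sg_Vstar = (\<Union>j. sg_map j ` closure sg_Vstar)"
proof -
  have "closure sg_Vstar = closure (\<Union>j. sg_map j ` sg_Vstar)"
    using sg_Vstar_invariant by (rule arg_cong)
  also have "\<dots> = (\<Union>j. closure (sg_map j ` sg_Vstar))"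
    by (simp add: closure_Un UNIV_3 Un_assoc)
  finally show ?thesis unfolding sg_map_closure .
qed

text \<open>The two inclusions above hold for every competitor, which makes the definite description
  meaningful and replaces \<open>SG\<close> by a concrete set from here on.\<close>

lemma SG_eq: "SG = closure sg_Vstar"
  unfolding SG_def
proof (rule the_equality)
  have "bounded sg_Vstar"
    using bounded_subset[OF bounded_bary_nonneg] bary_sg_Vstar by blast
  then have "compact (closure sg_Vstar)" by (simp add: compact_closure)
  moreover have "closure sg_Vstar \<noteq> {}" by (auto simp: sg_V_def intro: exI[of _ "[]"])
  ultimately show "closure sg_Vstar \<noteq> {} \<and> compact (closure sg_Vstar) \<and>
      closure sg_Vstar = (\<Union>j. sg_map j ` closure sg_Vstar)"
    using closure_Vstar_invariant by blast
next
  fix K assume K: "K \<noteq> {} \<and> compact K \<and> K = (\<Union>j. sg_map j ` K)"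
  then show "K = closure sg_Vstar"
    using invariant_subset_closure[of K] closure_Vstar_subset_invariant[of K]
    by (simp add: compact_imp_bounded subset_antisym)
qed

section \<open>Harmonic extension\<close>

lemma sg_vertex_eq_iff [simp]: "sg_vertex i = sg_vertex j \<longleftrightarrow> i = j"
  using bary_vertex[of i i] bary_vertex[of i j] by (auto split: if_splits)

lemma SG_invariant: "SG = (\<Union>j. sg_map j ` SG)"
  unfolding SG_eq by (rule closure_Vstar_invariant)

lemma compact_SG: "compact SG"
proof -
  have "bounded sg_Vstar"
    using bary_sg_Vstar by (intro bounded_subset[OF bounded_bary_nonneg]) blast
  then show ?thesis unfolding SG_eq by (simp add: compact_closure)
qed

lemma sg_V_subset_SG: "sg_V n \<subseteq> SG"
  unfolding SG_eq by (rule order_trans[OF UN_upper[OF UNIV_I] closure_subset])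

lemma sg_vertex_in_SG [simp]: "sg_vertex j \<in> SG"
  using sg_V_subset_SG[of 0] by (auto simp: sg_V_0)

lemma sg_map_in_SG: "x \<in> SG \<Longrightarrow> sg_map j x \<in> SG"
  by (rule subsetD[OF equalityD2[OF SG_invariant]]) blast

lemma SG_cases:
  assumes "x \<in> SG"
  obtains j y where "y \<in> SG" "x = sg_map j y"
  using subsetD[OF equalityD1[OF SG_invariant] assms] by blast

lemma sg_word_in_SG: "x \<in> SG \<Longrightarrow> sg_word w x \<in> SG"
  by (induction w arbitrary: x) (simp_all add: sg_word_Cons sg_map_in_SG)

lemma bary_SG_nonneg:
  assumes "x \<in> SG"
  shows "0 \<le> bary i x"
proof -
  have "closed {x. 0 \<le> bary i x}"
    by (intro closed_Collect_le continuous_on_const continuous_on_bary)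
  then have "closure sg_Vstar \<subseteq> {x. 0 \<le> bary i x}"
    by (intro closure_minimal subsetI CollectI bary_sg_Vstar)
  then show ?thesis using assms by (auto simp: SG_eq)
qed

text \<open>The coordinates are non-negative with sum 1, so a coordinate equal to at least 1 forces
  the others to vanish.\<close>

lemma sg_vertex_if_bary:
  assumes "\<And>k. 0 \<le> bary k x" "1 \<le> bary i x"
  shows "x = sg_vertex i"
proof (rule bary_inject)
  fix k
  show "bary k x = bary k (sg_vertex i)"
    using sum_bary[of x] assms(1)[of 1] assms(1)[of 2] assms(1)[of 3] assms(2)
      exhaust_3[of i] exhaust_3[of k]
    by (auto simp: bary_vertex sum_3)
qed

text \<open>Two cells meet in one point only: comparing the i-th coordinates gives
  \<open>bary i y = bary i x + 1\<close>, which is at least 1, and symmetrically for j.\<close>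

lemma sg_map_junction:
  assumes "x \<in> SG" "y \<in> SG" "i \<noteq> j" "sg_map i x = sg_map j y"
  shows "x = sg_vertex j" "y = sg_vertex i"
proof -
  have "bary i x + 1 = bary i y"
    using arg_cong[OF assms(4), of "bary i"] assms(3) by (simp add: bary_map)
  then show "y = sg_vertex i"
    using bary_SG_nonneg[OF assms(1), of i] by (intro sg_vertex_if_bary bary_SG_nonneg assms(2)) simp
  have "bary j x = bary j y + 1"
    using arg_cong[OF assms(4), of "bary j"] assms(3) by (simp add: bary_map)
  then show "x = sg_vertex j"
    using bary_SG_nonneg[OF assms(2), of j] by (intro sg_vertex_if_bary bary_SG_nonneg assms(1)) simp
qed

text \<open>The $\frac25$-$\frac25$-$\frac15$ rule: for a harmonic function with values \<open>a\<close> on $V_0$, these are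
  its values on the corners of the cell \<open>j\<close>.\<close>

definition cell_data :: "3 \<Rightarrow> (3 \<Rightarrow> real) \<Rightarrow> 3 \<Rightarrow> real" where
  "cell_data j a i = (if i = j then a j else (a i + a j + (\<Sum>k\<in>UNIV. a k)) / 5)"

lemma cell_data_self [simp]: "cell_data j a j = a j"
  by (simp add: cell_data_def)

lemma cell_data_commute: "cell_data i a j = cell_data j a i"
  by (auto simp: cell_data_def add_ac)

lemma cell_data_bounds:
  assumes "\<And>i. lo \<le> a i" "\<And>i. a i \<le> hi"
  shows "lo \<le> cell_data j a i" "cell_data j a i \<le> hi"
  using assms(1)[of 1] assms(1)[of 2] assms(1)[of 3] assms(2)[of 1] assms(2)[of 2] assms(2)[of 3]
    exhaust_3[of i] exhaust_3[of j]
  by (auto simp: cell_data_def sum_3)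

text \<open>The extreme case is a corner j against a midpoint:
  \<open>a j - (2 * a j + 2 * a i + a k) / 5\<close> is
  \<open>(2 * (a j - a i) + (a j - a k)) / 5\<close>, at most 3/5 of the oscillation. Two midpoints
  differ by only 1/5 of a difference.\<close>

lemma cell_data_osc:
  assumes "\<And>i k. a i - a k \<le> d"
  shows "cell_data j a i - cell_data j a k \<le> 3/5 * d"
  using assms[of 1 1] assms[of 1 2] assms[of 1 3] assms[of 2 1] assms[of 2 3] assms[of 3 1] assms[of 3 2]
    exhaust_3[of i] exhaust_3[of j] exhaust_3[of k]
  by (auto simp: cell_data_def sum_3 field_simps)

lemma cell_data_linear:
  "cell_data j (\<lambda>i. s * a i + t * b i) = (\<lambda>i. s * cell_data j a i + t * cell_data j b i)"
  by (auto simp: cell_data_def fun_eq_iff sum_3 field_simps)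

section \<open>Harmonic extension as a uniform limit of piecewise affine interpolations\<close>

lemma osc_bounds:
  fixes a :: "3 \<Rightarrow> real"
  assumes "\<And>i k. a i - a k \<le> d"
  obtains lo where "\<And>i. lo \<le> a i" "\<And>i. a i \<le> lo + d"
proof -
  have "Min (range a) \<in> range a" by (rule Min_in) auto
  then obtain k where k: "a k = Min (range a)" by (metis rangeE)
  show thesis
  proof (rule that[of "a k"])
    show "a k \<le> a i" for i unfolding k by simp
    show "a i \<le> a k + d" for i using assms[of i k] by simp
  qed
qed

text \<open>At a midpoint two cells qualify and the choice is arbitrary;
  \<open>harm_approx_map\<close> shows that the choice does not affect the values built from
  it.\<close>

definition digit :: "real^2 \<Rightarrow> 3" where
  "digit x = (SOME j. x \<in> sg_map j ` SG)"

text \<open>Follows the address of x for n levels, transforming the corner values by the rule, and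
  interpolates affinely in the remaining cell.\<close>

primrec harm_approx :: "nat \<Rightarrow> (3 \<Rightarrow> real) \<Rightarrow> real^2 \<Rightarrow> real" where
  "harm_approx 0 a x = (\<Sum>i\<in>UNIV. a i * bary i x)"
| "harm_approx (Suc n) a x =
     harm_approx n (cell_data (digit x) a) (sg_unmap (digit x) x)"

lemma digit_mem: "x \<in> SG \<Longrightarrow> x \<in> sg_map (digit x) ` SG"
  unfolding digit_def by (rule someI_ex) (blast elim: SG_cases)

lemma digit_vertex: "digit (sg_vertex j) = j"
proof (rule ccontr)
  assume ne: "digit (sg_vertex j) \<noteq> j"
  obtain y where y: "y \<in> SG" "sg_vertex j = sg_map (digit (sg_vertex j)) y"
    using digit_mem[OF sg_vertex_in_SG[of j]] by blast
  then have "sg_vertex j = sg_vertex (digit (sg_vertex j))"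
    using sg_map_junction(1)[of "sg_vertex j" y j "digit (sg_vertex j)"] ne by simp
  then show False using ne by simp
qed

lemma harm_approx_vertex: "harm_approx n a (sg_vertex j) = a j"
proof (induction n arbitrary: a)
  case 0
  then show ?case by (simp add: bary_vertex if_distrib cong: if_cong)
next
  case (Suc n)
  have "sg_unmap j (sg_vertex j) = sg_vertex j" by (simp add: sg_unmap_def)
  then show ?case using Suc by (simp add: digit_vertex)
qed

text \<open>If the chosen cell i differs from j, the point is the common midpoint, where the two
  cells prescribe \<open>cell_data i a j\<close> and \<open>cell_data j a i\<close>; these agree by
  symmetry of the rule.\<close>

lemma harm_approx_map:
  assumes "x \<in> SG"
  shows "harm_approx (Suc n) a (sg_map j x) = harm_approx n (cell_data j a) x"
proof -
  define i where "i = digit (sg_map j x)"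
  obtain y where y: "y \<in> SG" "sg_map j x = sg_map i y"
    using digit_mem[OF sg_map_in_SG[OF assms]] unfolding i_def by blast
  have *: "harm_approx (Suc n) a (sg_map j x) = harm_approx n (cell_data i a) y"
    by (simp add: i_def[symmetric]) (simp add: y(2))
  show ?thesis
  proof (cases "i = j")
    case True
    then show ?thesis using * y(2) by simp
  next
    case False
    then have "x = sg_vertex i" "y = sg_vertex j"
      using sg_map_junction[OF assms y(1) _ y(2)] by auto
    then show ?thesis unfolding * by (simp add: harm_approx_vertex cell_data_commute)
  qed
qed

text \<open>The maximum principle: every step of the construction takes convex combinations of the
  corner values.\<close>

lemma harm_approx_bounds:
  assumes "x \<in> SG" "\<And>i. lo \<le> a i" "\<And>i. a i \<le> hi"
  shows "lo \<le> harm_approx n a x \<and> harm_approx n a x \<le> hi"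
  using assms
proof (induction n arbitrary: a x)
  case 0
  have b: "0 \<le> bary i x" for i using 0(1) by (rule bary_SG_nonneg)
  have "(\<Sum>i\<in>UNIV. lo * bary i x) \<le> (\<Sum>i\<in>UNIV. a i * bary i x)"
    "(\<Sum>i\<in>UNIV. a i * bary i x) \<le> (\<Sum>i\<in>UNIV. hi * bary i x)"
    by (intro sum_mono mult_right_mono 0 b)+
  then show ?case by (simp add: sum_bary flip: sum_distrib_left)
next
  case (Suc n)
  obtain j y where y: "y \<in> SG" "x = sg_map j y" using Suc.prems(1) by (rule SG_cases)
  show ?case unfolding y(2) harm_approx_map[OF y(1)]
    by (intro Suc.IH y cell_data_bounds[where lo = lo and hi = hi] Suc.prems)
qed

text \<open>After n levels both functions live in the same cell, with corner values of oscillation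
  at most \<open>(3/5) ^ n * d\<close>, and both stay between the extremes of these values.\<close>

lemma harm_approx_Cauchy:
  assumes "x \<in> SG" "\<And>i k. a i - a k \<le> d"
  shows "\<bar>harm_approx (n + m) a x - harm_approx n a x\<bar> \<le> (3/5) ^ n * d"
  using assms
proof (induction n arbitrary: a x d)
  case 0
  obtain lo where lo: "\<And>i. lo \<le> a i" "\<And>i. a i \<le> lo + d" using osc_bounds[of a d] 0(2) by blast
  show ?case using harm_approx_bounds[of x lo a "lo + d" m, OF 0(1) lo]
      harm_approx_bounds[of x lo a "lo + d" 0, OF 0(1) lo]
    unfolding add_0 power_0 by (simp only: mult_1) linarith
next
  case (Suc n)
  obtain j y where y: "y \<in> SG" "x = sg_map j y" using Suc.prems(1) by (rule SG_cases)
  have "\<bar>harm_approx (n + m) (cell_data j a) y - harm_approx n (cell_data j a) y\<bar> \<le> (3/5) ^ n * (3/5 * d)"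
    by (intro Suc.IH y cell_data_osc Suc.prems)
  then show ?case unfolding y(2) add_Suc harm_approx_map[OF y(1)] by (simp add: mult_ac)
qed

text \<open>The definition by \<open>digit\<close> is not visibly continuous. On each closed cell it
  coincides with a continuous function by \<open>harm_approx_map\<close>, and finitely many closed
  cells are glued.\<close>

lemma continuous_on_harm_approx: "continuous_on SG (harm_approx n a)"
proof (induction n arbitrary: a)
  case 0
  have "continuous_on SG (\<lambda>x. \<Sum>i\<in>UNIV. a i * bary i x)"
    by (intro continuous_on_sum continuous_on_mult continuous_on_const continuous_on_bary)
  then show ?case by (simp add: fun_eq_iff[symmetric] cong: continuous_on_cong)
next
  case (Suc n)
  have "continuous_on (sg_map j ` SG) (harm_approx (Suc n) a)" for j
  proof -
    have "continuous_on (sg_map j ` SG) (\<lambda>y. harm_approx n (cell_data j a) (sg_unmap j y))"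
      by (rule continuous_on_compose2[OF Suc.IH continuous_on_sg_unmap]) auto
    then show ?thesis
      by (rule continuous_on_eq) (auto simp: harm_approx_map simp del: harm_approx.simps)
  qed
  moreover have "closed (sg_map j ` SG)" for j
    by (intro compact_imp_closed compact_continuous_image continuous_on_sg_map compact_SG)
  ultimately have "continuous_on (\<Union>j\<in>UNIV. sg_map j ` SG) (harm_approx (Suc n) a)"
    by (intro continuous_on_closed_Union) auto
  then show ?case by (simp only: SG_invariant[symmetric])
qed

definition harm_ext :: "(3 \<Rightarrow> real) \<Rightarrow> real^2 \<Rightarrow> real" where
  "harm_ext a x = lim (\<lambda>n. harm_approx n a x)"

lemma uniform_limit_harm: "uniform_limit SG (\<lambda>n. harm_approx n a) (harm_ext a) sequentially"
proof -
  obtain d where d: "\<And>i k. a i - a k \<le> d" "d > 0"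
  proof
    fix i k :: 3
    have "a i \<le> Max (range a)" "Min (range a) \<le> a k" by auto
    then show "a i - a k \<le> Max (range a) - Min (range a) + 1" by linarith
    have "Min (range a) \<le> Max (range a)" by (meson Min_le Max_ge finite rangeI finite_imageI order_trans)
    then show "0 < Max (range a) - Min (range a) + 1" by linarith
  qed
  have "uniformly_Cauchy_on SG (\<lambda>n. harm_approx n a)"
  proof (rule uniformly_Cauchy_onI')
    fix e :: real assume "e > 0"
    then obtain M where M: "(3/5) ^ M < e / d"
      using real_arch_pow_inv[of "e/d" "3/5"] d(2) by auto
    show "\<exists>M. \<forall>x\<in>SG. \<forall>m\<ge>M. \<forall>n>m. dist (harm_approx m a x) (harm_approx n a x) < e"
    proof (intro exI ballI allI impI)
      fix x m n assume x: "x \<in> SG" and mn: "M \<le> m" "m < n"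
      have "\<bar>harm_approx (m + (n - m)) a x - harm_approx m a x\<bar> \<le> (3/5) ^ m * d"
        by (rule harm_approx_Cauchy[OF x d(1)])
      also have "\<dots> \<le> (3/5) ^ M * d" using mn d(2) by (intro mult_right_mono power_decreasing) auto
      also have "\<dots> < e" using M d(2) by (simp add: field_simps)
      finally show "dist (harm_approx m a x) (harm_approx n a x) < e"
        using mn by (simp add: dist_real_def abs_minus_commute)
    qed
  qed
  then show ?thesis
    unfolding harm_ext_def[abs_def]
    by (intro iffD1[OF uniformly_convergent_uniform_limit_iff] Cauchy_uniformly_convergent)
qed

lemma continuous_on_harm: "continuous_on SG (harm_ext a)"
  by (rule uniform_limit_theorem[OF _ uniform_limit_harm]) (auto simp: continuous_on_harm_approx)

lemma harm_approx_tendsto: "x \<in> SG \<Longrightarrow> (\<lambda>n. harm_approx n a x) \<longlonglongrightarrow> harm_ext a x"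
  using uniform_limit_harm by (rule tendsto_uniform_limitI)

lemma harm_map: 
  assumes "x \<in> SG"
  shows "harm_ext a (sg_map j x) = harm_ext (cell_data j a) x"
proof -
  have "(\<lambda>n. harm_approx (Suc n) a (sg_map j x)) \<longlonglongrightarrow> harm_ext a (sg_map j x)"
    by (rule LIMSEQ_Suc[OF harm_approx_tendsto[OF sg_map_in_SG[OF assms]]])
  then show ?thesis unfolding harm_approx_map[OF assms]
    using harm_approx_tendsto[OF assms] by (rule LIMSEQ_unique)
qed

lemma harm_vertex [simp]: "harm_ext a (sg_vertex j) = a j"
  by (simp add: harm_ext_def harm_approx_vertex limI)

lemma harm_bounds:
  assumes "x \<in> SG" "\<And>i. lo \<le> a i" "\<And>i. a i \<le> hi"
  shows "lo \<le> harm_ext a x" "harm_ext a x \<le> hi"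
  using harm_approx_bounds[OF assms] harm_approx_tendsto[OF assms(1), of a]
  by (auto intro: LIMSEQ_le_const LIMSEQ_le_const2)

lemma harm_linear:
  assumes "x \<in> SG"
  shows "harm_ext (\<lambda>i. s * a i + t * b i) x = s * harm_ext a x + t * harm_ext b x"
proof -
  have "harm_approx n (\<lambda>i. s * a i + t * b i) x = s * harm_approx n a x + t * harm_approx n b x" for n
    by (induction n arbitrary: a b x)
       (simp_all add: cell_data_linear sum.distrib sum_distrib_left algebra_simps)
  then have "(\<lambda>n. s * harm_approx n a x + t * harm_approx n b x) \<longlonglongrightarrow> harm_ext (\<lambda>i. s * a i + t * b i) x"
    using harm_approx_tendsto[OF assms, of "\<lambda>i. s * a i + t * b i"] by (simp del: harm_approx.simps)
  moreover have "(\<lambda>n. s * harm_approx n a x + t * harm_approx n b x) \<longlonglongrightarrow> s * harm_ext a x + t * harm_ext b x"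
    by (intro tendsto_intros harm_approx_tendsto assms)
  ultimately show ?thesis by (rule LIMSEQ_unique)
qed

text \<open>\<open>foldr\<close> lets the last letter act first on the data, matching the outermost
  map, which determines the largest cell containing the point.\<close>

lemma harm_word:
  assumes "x \<in> SG"
  shows "harm_ext a (sg_word w x) = harm_ext (foldr cell_data w a) x"
  by (induction w arbitrary: a rule: rev_induct)
     (simp_all add: sg_word_snoc harm_map sg_word_in_SG assms)

section \<open>Energy and uniqueness of harmonic functions\<close>

text \<open>Different cells of one level share at most one point, so an edge determines its cell and
  its two corners. If the outermost letters differed, both end points would be the same junction.
  This is what lets the energy be summed cell by cell.\<close>

lemma cell_edge_inject:
  assumes "length w = length w'" "i \<noteq> j"
    "sg_word w (sg_vertex i) = sg_word w' (sg_vertex i')"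
    "sg_word w (sg_vertex j) = sg_word w' (sg_vertex j')"
  shows "w = w' \<and> i = i' \<and> j = j'"
  using assms(1,3,4)
proof (induction w arbitrary: w' rule: rev_induct)
  case Nil
  then show ?case by simp
next
  case (snoc c w)
  obtain v c' where v: "w' = v @ [c']"
    using snoc.prems(1) by (cases w' rule: rev_cases) auto
  let ?x = "sg_word w (sg_vertex i)" and ?x' = "sg_word v (sg_vertex i')"
  let ?y = "sg_word w (sg_vertex j)" and ?y' = "sg_word v (sg_vertex j')"
  have eq: "sg_map c ?x = sg_map c' ?x'" "sg_map c ?y = sg_map c' ?y'"
    using snoc.prems by (simp_all add: v sg_word_snoc)
  have "c = c'"
  proof (rule ccontr)
    assume "c \<noteq> c'"
    then have "?x = sg_vertex c'" "?y = sg_vertex c'"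
      using sg_map_junction(1)[OF _ _ _ eq(1)] sg_map_junction(1)[OF _ _ _ eq(2)]
      by (simp_all add: sg_word_in_SG)
    then have "?x = ?y" by simp
    then show False using assms(2) by simp
  qed
  then show ?case using snoc eq by (simp add: v)
qed

definition tri_energy :: "(3 \<Rightarrow> real) \<Rightarrow> real" where
  "tri_energy a = (a 1 - a 2)\<^sup>2 + (a 2 - a 3)\<^sup>2 + (a 1 - a 3)\<^sup>2"

lemma sg_energy_eq:
  "sg_energy k u = (\<Sum>w\<in>{w. length w = k}. tri_energy (\<lambda>i. u (sg_word w (sg_vertex i))))"
proof -
  define I where "I = {w::3 list. length w = k} \<times> {(i::3, j::3). i \<noteq> j}"
  define g where "g = (\<lambda>(w, i, j). (sg_word w (sg_vertex i), sg_word w (sg_vertex j)))"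
  have "inj_on g I"
  proof (rule inj_onI)
    fix z z' assume z: "z \<in> I" "z' \<in> I" "g z = g z'"
    obtain w i j w' i' j' where [simp]: "z = (w, i, j)" "z' = (w', i', j')"
      by (metis prod_cases3)
    show "z = z'"
      using cell_edge_inject[of w w' i j i' j'] z by (simp add: I_def g_def)
  qed
  moreover have "{(x, y). sg_adj k x y} = g ` I"
  proof
    show "{(x, y). sg_adj k x y} \<subseteq> g ` I"
    proof clarify
      fix x y assume "sg_adj k x y"
      then obtain w i j where "length w = k" "x = sg_word w (sg_vertex i)" "y = sg_word w (sg_vertex j)"
        "i \<noteq> j"
        unfolding sg_adj_def by auto
      then have "(x, y) = g (w, i, j)" "(w, i, j) \<in> I" by (simp_all add: g_def I_def)
      then show "(x, y) \<in> g ` I" by (rule image_eqI)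
    qed
    show "g ` I \<subseteq> {(x, y). sg_adj k x y}"
      by (auto simp: g_def I_def sg_adj_def)
  qed
  ultimately have "sg_energy k u = (\<Sum>z\<in>I. (\<lambda>(x, y). (u x - u y)\<^sup>2) (g z)) / 2"
    unfolding sg_energy_def by (simp add: sum.reindex)
  also have "(\<Sum>z\<in>I. (\<lambda>(x, y). (u x - u y)\<^sup>2) (g z)) =
      (\<Sum>w\<in>{w. length w = k}. \<Sum>(i, j)\<in>{(i, j). i \<noteq> j}.
         (u (sg_word w (sg_vertex i)) - u (sg_word w (sg_vertex j)))\<^sup>2)"
    unfolding I_def g_def by (simp add: sum.cartesian_product case_prod_unfold)
  also have "\<dots> = (\<Sum>w\<in>{w. length w = k}. 2 * tri_energy (\<lambda>i. u (sg_word w (sg_vertex i))))"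
  proof (rule sum.cong[OF refl])
    fix w :: "3 list"
    have *: "{(i::3, j::3). i \<noteq> j} = {(1,2),(2,1),(1,3),(3,1),(2,3),(3,2)}"
    proof -
      have "\<forall>i j::3. i \<noteq> j \<longleftrightarrow> (i, j) \<in> {(1,2),(2,1),(1,3),(3,1),(2,3),(3,2)}"
        by (simp add: forall_3)
      then show ?thesis by (intro set_eqI) (simp add: split_paired_all del: insert_iff)
    qed
    show "(\<Sum>(i, j)\<in>{(i, j). i \<noteq> j}. (u (sg_word w (sg_vertex i)) - u (sg_word w (sg_vertex j)))\<^sup>2) =
        2 * tri_energy (\<lambda>i. u (sg_word w (sg_vertex i)))"
      unfolding * by (simp add: tri_energy_def power2_commute)
  qed
  finally show ?thesis by (simp flip: sum_distrib_left)
qed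

lemma words_Suc: "{w. length w = Suc n} = (\<lambda>(j, w). j # w) ` (UNIV \<times> {w. length w = n})"
  by (auto simp: length_Suc_conv image_iff)

text \<open>The new letter is put in front, where it is the innermost map: the cells of level k+1
  are grouped by the cell of level k that they subdivide.\<close>

lemma sg_energy_Suc:
  "sg_energy (Suc k) u =
     (\<Sum>w\<in>{w. length w = k}. \<Sum>j\<in>UNIV. tri_energy (\<lambda>i. u (sg_word w (sg_map j (sg_vertex i)))))"
proof -
  have "inj_on (\<lambda>(j, w). j # w) (UNIV \<times> {w. length w = k})" by (auto simp: inj_on_def)
  then have "sg_energy (Suc k) u = (\<Sum>(j, w)\<in>UNIV \<times> {w. length w = k}.
      tri_energy (\<lambda>i. u (sg_word w (sg_map j (sg_vertex i)))))"
    unfolding sg_energy_eq words_Suc by (subst sum.reindex) (simp_all add: case_prod_unfold sg_word_Cons)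
  also have "\<dots> = (\<Sum>j\<in>UNIV. \<Sum>w\<in>{w. length w = k}. tri_energy (\<lambda>i. u (sg_word w (sg_map j (sg_vertex i)))))"
    by (simp add: sum.cartesian_product)
  finally show ?thesis by (simp add: sum.swap[of _ "{w. length w = k}"])
qed

text \<open>Completing the square: the right-hand side exceeds $\frac35$ of the energy of the corner values
  by a positive definite form in the deviations of the midpoint values from the
  $\frac25$-$\frac25$-$\frac15$ rule.\<close>

lemma tri_energy_split:
  fixes a1 a2 a3 m12 m13 m23 :: real
  defines "d12 \<equiv> m12 - (2 * a1 + 2 * a2 + a3) / 5"
    and "d13 \<equiv> m13 - (2 * a1 + a2 + 2 * a3) / 5"
    and "d23 \<equiv> m23 - (a1 + 2 * a2 + 2 * a3) / 5"
  shows "((a1 - m12)\<^sup>2 + (m12 - m13)\<^sup>2 + (a1 - m13)\<^sup>2) + ((m12 - a2)\<^sup>2 + (a2 - m23)\<^sup>2 + (m12 - m23)\<^sup>2)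
      + ((m13 - m23)\<^sup>2 + (m23 - a3)\<^sup>2 + (m13 - a3)\<^sup>2) =
    3/5 * ((a1 - a2)\<^sup>2 + (a2 - a3)\<^sup>2 + (a1 - a3)\<^sup>2) +
      ((d12 - d13)\<^sup>2 + (d12 - d23)\<^sup>2 + (d13 - d23)\<^sup>2 + 2 * (d12\<^sup>2 + d13\<^sup>2 + d23\<^sup>2))"
  unfolding d12_def d13_def d23_def by (simp add: power2_eq_square field_simps)

text \<open>fixes g Of the quadratic form in the deviations only the part
  \<open>2 * (d12^2 + d13^2 + d23^2)\<close> is definite; it forces all three midpoint values to
  follow the rule in the case of equality.\<close>

lemma
  fixes g :: "real^2 \<Rightarrow> real"
  defines "S \<equiv> \<Sum>j\<in>UNIV. tri_energy (\<lambda>i. g (sg_map j (sg_vertex i)))"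
    and "T \<equiv> 3/5 * tri_energy (\<lambda>i. g (sg_vertex i))"
  shows cell_energy_ge: "T \<le> S"
    and cell_energy_eq_iff:
      "S = T \<longleftrightarrow> (\<forall>i j. g (sg_map j (sg_vertex i)) = cell_data j (\<lambda>i. g (sg_vertex i)) i)"
proof -
  let ?a1 = "g (sg_vertex 1)" and ?a2 = "g (sg_vertex 2)" and ?a3 = "g (sg_vertex 3)"
  let ?m12 = "g (sg_map 1 (sg_vertex 2))" and ?m13 = "g (sg_map 1 (sg_vertex 3))"
    and ?m23 = "g (sg_map 2 (sg_vertex 3))"
  define d12 where "d12 = ?m12 - (2 * ?a1 + 2 * ?a2 + ?a3) / 5"
  define d13 where "d13 = ?m13 - (2 * ?a1 + ?a2 + 2 * ?a3) / 5"
  define d23 where "d23 = ?m23 - (?a1 + 2 * ?a2 + 2 * ?a3) / 5"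
  have c: "sg_map 2 (sg_vertex 1) = sg_map 1 (sg_vertex 2)" "sg_map 3 (sg_vertex 1) = sg_map 1 (sg_vertex 3)"
    "sg_map 3 (sg_vertex 2) = sg_map 2 (sg_vertex 3)"
    by (rule sg_map_vertex_commute)+
  have eq: "S = T + ((d12 - d13)\<^sup>2 + (d12 - d23)\<^sup>2 + (d13 - d23)\<^sup>2 + 2 * (d12\<^sup>2 + d13\<^sup>2 + d23\<^sup>2))"
    unfolding S_def T_def tri_energy_def UNIV_3
    using tri_energy_split[of ?a1 ?m12 ?m13 ?a2 ?m23 ?a3]
    by (simp add: c d12_def d13_def d23_def)
  then show "T \<le> S" by simp
  have "S = T \<longleftrightarrow> (d12 - d13)\<^sup>2 + (d12 - d23)\<^sup>2 + (d13 - d23)\<^sup>2 + 2 * (d12\<^sup>2 + d13\<^sup>2 + d23\<^sup>2) = 0"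
    using eq by linarith
  also have "\<dots> \<longleftrightarrow> d12 = 0 \<and> d13 = 0 \<and> d23 = 0"
    by (auto simp: add_nonneg_eq_0_iff)
  also have "\<dots> \<longleftrightarrow> (\<forall>i j. g (sg_map j (sg_vertex i)) = cell_data j (\<lambda>i. g (sg_vertex i)) i)"
    by (auto simp: forall_3 c cell_data_def sum_3 d12_def d13_def d23_def field_simps)
  finally show "S = T \<longleftrightarrow> (\<forall>i j. g (sg_map j (sg_vertex i)) = cell_data j (\<lambda>i. g (sg_vertex i)) i)" .
qed

text \<open>Linear and local, this condition replaces the infinitely many minimisation problems in
  \<open>harmonic\<close>.\<close>

definition cell_rule :: "(real^2 \<Rightarrow> real) \<Rightarrow> bool" where
  "cell_rule u \<longleftrightarrow> (\<forall>w i j. u (sg_word w (sg_map j (sg_vertex i))) =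
     cell_data j (\<lambda>i. u (sg_word w (sg_vertex i))) i)"

text \<open>Here 3/5 is the renormalisation factor of the energy:
  \<open>(5/3) ^ k * sg_energy k u\<close> does not decrease in k. It coincides numerically with the
  oscillation factor of \<open>cell_data_osc\<close>.\<close>

lemma sg_energy_Suc_ge: "3/5 * sg_energy k u \<le> sg_energy (Suc k) u"
  unfolding sg_energy_eq[of k] sg_energy_Suc sum_distrib_left
  by (intro sum_mono cell_energy_ge)

lemma sg_energy_ge: "(3/5) ^ k * sg_energy 0 u \<le> sg_energy k u"
proof (induction k)
  case (Suc k)
  then show ?case using sg_energy_Suc_ge[of k u] by simp
qed simp

lemma finite_words: "finite {w::3 list. length w = k}"
  using finite_lists_length_eq[of "UNIV::3 set" k] by simp

text \<open>A sum of non-negative excesses vanishes only if each of them does, so equality of the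
  total energies is equality in every cell.\<close>

lemma sg_energy_eq_iff:
  "(\<forall>k. sg_energy (Suc k) u = 3/5 * sg_energy k u) \<longleftrightarrow> cell_rule u"
proof -
  have "sg_energy (Suc k) u = 3/5 * sg_energy k u \<longleftrightarrow>
      (\<forall>w\<in>{w. length w = k}. \<forall>i j. u (sg_word w (sg_map j (sg_vertex i))) =
         cell_data j (\<lambda>i. u (sg_word w (sg_vertex i))) i)" for k
  proof -
    let ?S = "\<lambda>w. \<Sum>j\<in>UNIV. tri_energy (\<lambda>i. u (sg_word w (sg_map j (sg_vertex i))))"
    let ?T = "\<lambda>w. 3/5 * tri_energy (\<lambda>i. u (sg_word w (sg_vertex i)))"
    have "(\<Sum>w\<in>{w. length w = k}. ?S w - ?T w) = sg_energy (Suc k) u - 3/5 * sg_energy k u"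
      unfolding sg_energy_eq[of k] sg_energy_Suc sum_distrib_left sum_subtractf ..
    then have "sg_energy (Suc k) u = 3/5 * sg_energy k u \<longleftrightarrow> (\<Sum>w\<in>{w. length w = k}. ?S w - ?T w) = 0"
      by linarith
    also have "\<dots> \<longleftrightarrow> (\<forall>w\<in>{w. length w = k}. ?S w - ?T w = 0)"
    proof (rule sum_nonneg_eq_0_iff[OF finite_words])
      fix w :: "3 list"
      show "0 \<le> ?S w - ?T w" using cell_energy_ge[of "\<lambda>x. u (sg_word w x)"] by linarith
    qed
    also have "\<dots> \<longleftrightarrow> (\<forall>w\<in>{w. length w = k}. \<forall>i j. u (sg_word w (sg_map j (sg_vertex i))) =
         cell_data j (\<lambda>i. u (sg_word w (sg_vertex i))) i)"
    proof (rule ball_cong[OF refl])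
      fix w :: "3 list"
      show "?S w - ?T w = 0 \<longleftrightarrow> (\<forall>i j. u (sg_word w (sg_map j (sg_vertex i))) =
         cell_data j (\<lambda>i. u (sg_word w (sg_vertex i))) i)"
        unfolding cell_energy_eq_iff[of "\<lambda>x. u (sg_word w x)", symmetric] by linarith
    qed
    finally show ?thesis .
  qed
  then show ?thesis unfolding cell_rule_def by blast
qed

lemma sg_energy_cell_rule:
  assumes "cell_rule u"
  shows "sg_energy k u = (3/5) ^ k * sg_energy 0 u"
proof (induction k)
  case (Suc k)
  have "sg_energy (Suc k) u = 3/5 * sg_energy k u" using assms sg_energy_eq_iff by blast
  then show ?case using Suc by simp
qed simp

lemma sg_energy_0: "sg_energy 0 u = tri_energy (\<lambda>i. u (sg_vertex i))"
  by (simp add: sg_energy_eq)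

lemma cell_rule_harm_ext: "cell_rule (harm_ext a)"
  unfolding cell_rule_def by (simp add: harm_word harm_map sg_map_in_SG)

text \<open>\<open>sg_energy_ge\<close> bounds the energy of level k below in terms of the corner
  values, and functions obeying the rule attain the bound. A minimiser must therefore attain it on
  all levels, which means equality between consecutive levels.\<close>

lemma harmonic_iff_cell_rule: "harmonic u \<longleftrightarrow> cell_rule u"
proof
  assume u: "cell_rule u"
  show "harmonic u"
    unfolding harmonic_def
  proof (intro allI impI)
    fix k :: nat and v assume "\<forall>x\<in>sg_V 0. v x = u x"
    then have "sg_energy 0 v = sg_energy 0 u" by (simp add: sg_energy_0 sg_V_0)
    then show "sg_energy k u \<le> sg_energy k v"
      using sg_energy_cell_rule[OF u, of k] sg_energy_ge[of k v] by simp
  qed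
next
  assume u: "harmonic u"
  \<comment> \<open>The competitor: it has the same corner values as u and attains the lower
    bound.\<close>
  let ?h = "harm_ext (\<lambda>i. u (sg_vertex i))"
  have eq: "sg_energy k u = (3/5) ^ k * sg_energy 0 u" for k
  proof (cases "k = 0")
    case False
    then have "sg_energy k u \<le> sg_energy k ?h"
      using u by (auto simp: harmonic_def sg_V_0)
    also have "\<dots> = (3/5) ^ k * sg_energy 0 u"
      using sg_energy_cell_rule[OF cell_rule_harm_ext, of k "\<lambda>i. u (sg_vertex i)"]
      by (simp add: sg_energy_0)
    finally show ?thesis using sg_energy_ge[of k u] by linarith
  qed simp
  have "sg_energy (Suc k) u = 3/5 * sg_energy k u" for k
    unfolding eq[of "Suc k"] eq[of k] by simp
  then show "cell_rule u" using sg_energy_eq_iff by blast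
qed

lemma cell_rule_unique:
  assumes "cell_rule u" "cell_rule v" "\<And>i. u (sg_vertex i) = v (sg_vertex i)" "x \<in> sg_Vstar"
  shows "u x = v x"
proof -
  have "\<forall>i. u (sg_word w (sg_vertex i)) = v (sg_word w (sg_vertex i))" for w
    using assms(1-3)
    by (induction w) (simp_all add: sg_word_Cons cell_rule_def)
  then show ?thesis using assms(4) by (auto simp: sg_V_def)
qed

text \<open>Resolves the definite description. The rule determines a harmonic function on the
  vertices of all levels; these are dense in \<open>SG\<close>, and continuity fixes the
  rest.\<close>

lemma sg_h_eq_harm_ext:
  assumes "x \<in> SG"
  shows "sg_h j x = harm_ext (\<lambda>i. if i = j then 1 else 0) x"
proof -
  let ?h = "harm_ext (\<lambda>i. if i = j then 1 else 0)"
  have "sg_h j = restrict ?h SG"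
    unfolding sg_h_def
  proof (rule the_equality)
    have "cell_rule (restrict ?h SG)"
      using cell_rule_harm_ext[of "\<lambda>i. if i = j then 1 else 0"]
      unfolding cell_rule_def by (simp add: sg_word_in_SG sg_map_in_SG)
    then show "restrict ?h SG \<in> extensional SG \<and> continuous_on SG (restrict ?h SG) \<and>
        harmonic (restrict ?h SG) \<and> (\<forall>k. restrict ?h SG (sg_vertex k) = (if k = j then 1 else 0))"
      using continuous_on_harm by (simp add: harmonic_iff_cell_rule cong: continuous_on_cong)
  next
    fix u assume u: "u \<in> extensional SG \<and> continuous_on SG u \<and> harmonic u \<and>
      (\<forall>k. u (sg_vertex k) = (if k = j then 1 else 0))"
    show "u = restrict ?h SG"
    proof (rule extensionalityI)
      show "u \<in> extensional SG" "restrict ?h SG \<in> extensional SG" using u by simp_all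
      fix x assume x: "x \<in> SG"
      have "u x - ?h x = 0"
      proof (rule continuous_constant_on_closure[of sg_Vstar "\<lambda>x. u x - ?h x" 0 x])
        show "continuous_on (closure sg_Vstar) (\<lambda>x. u x - ?h x)"
          using u continuous_on_harm unfolding SG_eq[symmetric] by (intro continuous_on_diff) auto
        show "x \<in> closure sg_Vstar" using x by (simp only: SG_eq)
        show "u y - ?h y = 0" if "y \<in> sg_Vstar" for y
          using cell_rule_unique[OF _ cell_rule_harm_ext _ that] u by (simp add: harmonic_iff_cell_rule)
      qed
      then show "u x = restrict ?h SG x" using x by simp
    qed
  qed
  then show ?thesis using assms by simp
qed

section \<open>Lengths of the edge curves\<close>

lemma sum_UNIV_3:
  fixes f :: "3 \<Rightarrow> 'a::comm_monoid_add"
  assumes "i \<noteq> j" "k \<noteq> i" "k \<noteq> j"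
  shows "(\<Sum>m\<in>UNIV. f m) = f i + f j + f k"
  using assms exhaust_3[of i] exhaust_3[of j] exhaust_3[of k]
  by (auto simp: sum_3 add_ac)

lemma cases_3:
  fixes i j k m :: 3
  assumes "i \<noteq> j" "k \<noteq> i" "k \<noteq> j"
  shows "m = i \<or> m = j \<or> m = k"
  using assms exhaust_3[of i] exhaust_3[of j] exhaust_3[of k] exhaust_3[of m] by auto

lemma ex_third_3: "\<exists>k::3. k \<noteq> i \<and> k \<noteq> j"
  using exhaust_3[of i] exhaust_3[of j] three_distinct by metis

lemma sg_map_linepath: "sg_map j (linepath a b t) = linepath (sg_map j a) (sg_map j b) t"
  by (simp add: linepath_def sg_map_def vec_eq_iff algebra_simps diff_divide_distrib add_divide_distrib)

lemma sg_word_linepath: "sg_word w (linepath a b t) = linepath (sg_word w a) (sg_word w b) t"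
  by (induction w rule: rev_induct) (simp_all add: sg_word_snoc sg_map_linepath)

lemma linepath_sg_vertex_left:
  "linepath (sg_vertex i) (sg_vertex j) t = sg_map i (linepath (sg_vertex i) (sg_vertex j) (2 * t))"
  by (simp add: linepath_def sg_map_def vec_eq_iff algebra_simps diff_divide_distrib add_divide_distrib)

lemma linepath_sg_vertex_right:
  "linepath (sg_vertex i) (sg_vertex j) t = sg_map j (linepath (sg_vertex i) (sg_vertex j) (2 * t - 1))"
  by (simp add: linepath_def sg_map_def vec_eq_iff algebra_simps diff_divide_distrib add_divide_distrib)

text \<open>The edge is covered by its images under \<open>sg_map i\<close> and
  \<open>sg_map j\<close>, its two halves, so \<open>invariant_subset_closure\<close>
  applies.\<close>

lemma linepath_in_SG:
  assumes "0 \<le> t" "t \<le> 1"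
  shows "linepath (sg_vertex i) (sg_vertex j) t \<in> SG"
proof -
  let ?L = "linepath (sg_vertex i) (sg_vertex j)"
  have "?L ` {0..1} \<subseteq> (\<Union>j. sg_map j ` ?L ` {0..1})"
  proof clarify
    fix t :: real assume t: "t \<in> {0..1}"
    show "?L t \<in> (\<Union>j. sg_map j ` ?L ` {0..1})"
    proof (cases "t \<le> 1/2")
      case True
      then have "2 * t \<in> {0..1}" using t by simp
      then show ?thesis by (subst linepath_sg_vertex_left) blast
    next
      case False
      then have "2 * t - 1 \<in> {0..1}" using t by simp
      then show ?thesis by (subst linepath_sg_vertex_right) blast
    qed
  qed
  moreover have "bounded (?L ` {0..1})"
    by (simp add: linepath_image_01 bounded_closed_segment)
  ultimately have "?L ` {0..1} \<subseteq> SG"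
    unfolding SG_eq by (rule invariant_subset_closure)
  then show ?thesis using assms by auto
qed

text \<open>Ordered corner values $a_i \le a_k \le a_j$ are inherited by both half edges.\<close>

lemma harm_ext_edge_approx_mono:
  assumes "i \<noteq> j" "k \<noteq> i" "k \<noteq> j" "a i \<le> a k" "a k \<le> a j" "a j - a i \<le> d"
    "0 \<le> s" "s \<le> t" "t \<le> 1"
  shows "harm_ext a (linepath (sg_vertex i) (sg_vertex j) s)
    \<le> harm_ext a (linepath (sg_vertex i) (sg_vertex j) t) + (3/5) ^ n * d"
  using assms(4-)
proof (induction n arbitrary: a d s t)
  case 0
  have "a i \<le> a m \<and> a m \<le> a j" for m
    using cases_3[OF assms(1-3), of m] 0 by auto
  then show ?case
    using harm_bounds[of "linepath (sg_vertex i) (sg_vertex j) s" "a i" a "a j"]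
      harm_bounds[of "linepath (sg_vertex i) (sg_vertex j) t" "a i" a "a j"] 0
    by (simp add: linepath_in_SG)
next
  case (Suc n)
  let ?L = "linepath (sg_vertex i) (sg_vertex j)"
  let ?b = "cell_data i a" and ?c = "cell_data j a"
  note s3 = sum_UNIV_3[OF assms(1-3)]
  have ne: "j \<noteq> i" "i \<noteq> k" "j \<noteq> k" using assms(1-3) by auto
  have b: "?b i \<le> ?b k" "?b k \<le> ?b j" "?b j - ?b i \<le> 3/5 * d"
    and c: "?c i \<le> ?c k" "?c k \<le> ?c j" "?c j - ?c i \<le> 3/5 * d"
    using Suc.prems ne assms(1-3) by (simp_all add: cell_data_def s3 field_simps)
  have d: "0 \<le> (3/5) ^ Suc n * d" using Suc.prems by simp
  have mem: "u \<in> {0..1} \<Longrightarrow> ?L u \<in> SG" for u by (simp add: linepath_in_SG)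
  have left: "harm_ext a (?L u) = harm_ext ?b (?L (2 * u))" if "0 \<le> u" "u \<le> 1/2" for u
    using that mem[of "2 * u"] by (subst linepath_sg_vertex_left) (simp add: harm_map)
  have right: "harm_ext a (?L u) = harm_ext ?c (?L (2 * u - 1))" if "1/2 \<le> u" "u \<le> 1" for u
    using that mem[of "2 * u - 1"] by (subst linepath_sg_vertex_right) (simp add: harm_map)
  consider "t \<le> 1/2" | "1/2 \<le> s" | "s \<le> 1/2" "1/2 \<le> t" by linarith
  then show ?case
  proof cases
    case 1
    then have "harm_ext ?b (?L (2 * s)) \<le> harm_ext ?b (?L (2 * t)) + (3/5) ^ n * (3/5 * d)"
      using Suc.prems by (intro Suc.IH b) auto
    then show ?thesis using 1 Suc.prems by (simp add: left mult_ac)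
  next
    case 2
    then have "harm_ext ?c (?L (2 * s - 1)) \<le> harm_ext ?c (?L (2 * t - 1)) + (3/5) ^ n * (3/5 * d)"
      using Suc.prems by (intro Suc.IH c) auto
    then show ?thesis using 2 Suc.prems by (simp add: right mult_ac)
  next
    case 3
    \<comment> \<open>The two points lie on different halves; both values are compared with the
      value at the midpoint, which is \<open>cell_data i a j\<close> seen from the left and
      \<open>cell_data j a i\<close> seen from the right.\<close>
    have "?b i \<le> ?b m \<and> ?b m \<le> ?b j" "?c i \<le> ?c m \<and> ?c m \<le> ?c j" for m
      using cases_3[OF assms(1-3), of m] b c by auto
    then have "harm_ext ?b (?L (2 * s)) \<le> ?b j" "?c i \<le> harm_ext ?c (?L (2 * t - 1))"
      using 3 Suc.prems mem[of "2 * s"] mem[of "2 * t - 1"]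
        harm_bounds(2)[of "?L (2 * s)" "?b i" ?b "?b j"]
        harm_bounds(1)[of "?L (2 * t - 1)" "?c i" ?c "?c j"] by auto
    then show ?thesis
      using left[OF Suc.prems(4) 3(1)] right[OF 3(2) Suc.prems(6)] d cell_data_commute[of i a j] by linarith
  qed
qed

text \<open>The error term of the approximate version decays geometrically in n.\<close>

lemma harm_ext_edge_mono:
  assumes "i \<noteq> j" "k \<noteq> i" "k \<noteq> j" "a i \<le> a k" "a k \<le> a j"
    "0 \<le> s" "s \<le> t" "t \<le> 1"
  shows "harm_ext a (linepath (sg_vertex i) (sg_vertex j) s)
    \<le> harm_ext a (linepath (sg_vertex i) (sg_vertex j) t)" (is "?l \<le> ?r")
proof -
  have "(\<lambda>n. ?r + (3/5) ^ n * (a j - a i)) \<longlonglongrightarrow> ?r + 0 * (a j - a i)"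
    by (intro tendsto_intros LIMSEQ_power_zero) simp
  then show ?thesis
    using harm_ext_edge_approx_mono[OF assms(1-5) order_refl assms(6-)]
    by (intro LIMSEQ_le_const) auto
qed

abbreviation unit_data :: "3 \<Rightarrow> 3 \<Rightarrow> real" where
  "unit_data l \<equiv> \<lambda>i. if i = l then 1 else 0"

text \<open>The corner values 0, 0, 1 are ordered along the edge with the third corner in between.
  The second claim is the first one on the reversed edge.\<close>

lemma harm_ext_unit_mono:
  assumes "i \<noteq> j" "0 \<le> s" "s \<le> t" "t \<le> 1"
  shows "harm_ext (unit_data j) (linepath (sg_vertex i) (sg_vertex j) s)
      \<le> harm_ext (unit_data j) (linepath (sg_vertex i) (sg_vertex j) t)"
    and "harm_ext (unit_data i) (linepath (sg_vertex i) (sg_vertex j) t)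
      \<le> harm_ext (unit_data i) (linepath (sg_vertex i) (sg_vertex j) s)"
proof -
  obtain k where k: "k \<noteq> i" "k \<noteq> j" using ex_third_3 by blast
  show "harm_ext (unit_data j) (linepath (sg_vertex i) (sg_vertex j) s)
      \<le> harm_ext (unit_data j) (linepath (sg_vertex i) (sg_vertex j) t)"
    using assms k by (intro harm_ext_edge_mono[where k = k]) auto
  have "harm_ext (unit_data i) (linepath (sg_vertex j) (sg_vertex i) (1 - t))
      \<le> harm_ext (unit_data i) (linepath (sg_vertex j) (sg_vertex i) (1 - s))"
    using assms k by (intro harm_ext_edge_mono[where k = k]) auto
  then show "harm_ext (unit_data i) (linepath (sg_vertex i) (sg_vertex j) t)
      \<le> harm_ext (unit_data i) (linepath (sg_vertex i) (sg_vertex j) s)"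
    by (simp add: linepath_def add.commute)
qed

text \<open>Harmonic functions form a three-dimensional space. This basis is chosen because on the
  edge from i to j its members are constant or monotone.\<close>

lemma harm_ext_expand:
  assumes "x \<in> SG" "i \<noteq> j" "k \<noteq> i" "k \<noteq> j"
  shows "harm_ext a x = a k + (a i - a k) * harm_ext (unit_data i) x + (a j - a k) * harm_ext (unit_data j) x"
proof -
  have const: "harm_ext (\<lambda>_. 1) x = 1"
    using harm_bounds[OF assms(1), of 1 "\<lambda>_. 1" 1] by simp
  have "a = (\<lambda>m. 1 * (a k * 1 + (a i - a k) * unit_data i m) + (a j - a k) * unit_data j m)"
    using assms(2-) cases_3[OF assms(2-)] by (intro ext) fastforce
  then have "harm_ext a x =
      harm_ext (\<lambda>m. 1 * (a k * 1 + (a i - a k) * unit_data i m) + (a j - a k) * unit_data j m) x"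
    by (rule arg_cong)
  also have "\<dots> = 1 * (a k * harm_ext (\<lambda>_. 1) x + (a i - a k) * harm_ext (unit_data i) x)
      + (a j - a k) * harm_ext (unit_data j) x"
    by (simp only: harm_linear[OF assms(1)])
  finally show ?thesis by (simp add: const)
qed

section \<open>Estimating the length of one edge curve\<close>

lemma foldr_cell_data_osc:
  assumes "\<And>i k. a i - a k \<le> d"
  shows "foldr cell_data w a i - foldr cell_data w a k \<le> (3/5) ^ length w * d"
  by (induction w arbitrary: i k) (use assms cell_data_osc in \<open>force simp: mult.assoc\<close>)+

text \<open>The rule loses no information: on any cell, every choice of corner values comes from a
  global harmonic function. This yields positive lengths.\<close>

lemma foldr_cell_data_surj: "\<exists>a. foldr cell_data w a = b"
proof (induction w arbitrary: b)
  case (Cons j w)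
  \<comment> \<open>The inverse of the rule: summing it over the corners gives
    \<open>sum a = 5/3 * sum b - 2 * b j\<close>, which is inserted into
    \<open>5 * b i = a i + b j + sum a\<close>.\<close>
  define a where "a = (\<lambda>i. if i = j then b j else 5 * b i + b j - 5/3 * (\<Sum>k\<in>UNIV. b k))"
  have "cell_data j a = b"
    using exhaust_3[of j] by (auto simp: fun_eq_iff forall_3 cell_data_def a_def sum_3 field_simps)
  then show ?case using Cons[of a] by auto
qed simp

lemma Phi_word:
  assumes "x \<in> SG"
  shows "Phi (sg_word w x) $ l = (harm_ext (foldr cell_data w (unit_data l)) x - 1/3) / sqrt 2"
  using exhaust_3[of l]
  by (auto simp: Phi_def sg_h_eq_harm_ext sg_word_in_SG assms harm_word)

text \<open>If the images agreed, all harmonic functions would take equal values at the two corners,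
  since they are combinations of the coordinates of \<open>Phi\<close> and constants; yet one of
  them has the values 1 and 0 there.\<close>

lemma Phi_word_vertex_neq:
  assumes "i \<noteq> j"
  shows "Phi (sg_word w (sg_vertex i)) \<noteq> Phi (sg_word w (sg_vertex j))"
proof
  assume eq: "Phi (sg_word w (sg_vertex i)) = Phi (sg_word w (sg_vertex j))"
  have unit: "harm_ext (unit_data l) (sg_word w (sg_vertex i)) = harm_ext (unit_data l) (sg_word w (sg_vertex j))" for l
    using arg_cong[OF eq, of "\<lambda>v. v $ l"] by (simp add: Phi_word harm_word)
  obtain k where k: "k \<noteq> i" "k \<noteq> j" using ex_third_3 by blast
  obtain a where a: "foldr cell_data w a = unit_data i" using foldr_cell_data_surj by blast
  have "harm_ext a (sg_word w (sg_vertex i)) = harm_ext a (sg_word w (sg_vertex j))"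
    unfolding harm_ext_expand[OF sg_word_in_SG[OF sg_vertex_in_SG] assms k, of a] unit ..
  then show False using assms by (simp add: harm_word a)
qed

text \<open>Each coordinate of \<open>Phi\<close> on the cell is a constant plus two monotone
  functions with coefficients at most \<open>(3/5) ^ length w\<close>. As one of these functions
  increases and the other decreases, their variations add up to the increment of the single function
  v. The factor 3 counts the coordinates in the l1 bound of the norm.\<close>

lemma Phi_edge_dist:
  fixes s t :: real
  assumes "i \<noteq> j" "0 \<le> s" "s \<le> t" "t \<le> 1"
  defines "L \<equiv> linepath (sg_vertex i) (sg_vertex j)"
  defines "v \<equiv> \<lambda>t. harm_ext (unit_data j) (L t) - harm_ext (unit_data i) (L t)"
  shows "dist (Phi (sg_word w (L s))) (Phi (sg_word w (L t))) \<le> 3 * (3/5) ^ length w * (v t - v s)"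
proof -
  obtain k where k: "k \<noteq> i" "k \<noteq> j" using ex_third_3 by blast
  have L: "L s \<in> SG" "L t \<in> SG" using assms(2-4) unfolding L_def by (auto intro: linepath_in_SG)
  have mono: "harm_ext (unit_data j) (L s) \<le> harm_ext (unit_data j) (L t)"
    "harm_ext (unit_data i) (L t) \<le> harm_ext (unit_data i) (L s)"
    unfolding L_def by (rule harm_ext_unit_mono[OF assms(1-4)])+
  have "dist (Phi (sg_word w (L s))) (Phi (sg_word w (L t)))
      \<le> (\<Sum>l\<in>UNIV. \<bar>Phi (sg_word w (L s)) $ l - Phi (sg_word w (L t)) $ l\<bar>)"
    unfolding dist_norm by (rule order_trans[OF norm_le_l1_cart]) simp
  also have "\<dots> \<le> (\<Sum>l\<in>(UNIV :: 3 set). (3/5) ^ length w * (v t - v s))"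
  proof (rule sum_mono)
    fix l :: 3
    define b where "b = foldr cell_data w (unit_data l)"
    have osc: "\<bar>b m - b k\<bar> \<le> (3/5) ^ length w" for m
      using foldr_cell_data_osc[of "unit_data l" 1 w m k] foldr_cell_data_osc[of "unit_data l" 1 w k m]
      unfolding b_def by (simp add: abs_le_iff)
    have "\<bar>Phi (sg_word w (L s)) $ l - Phi (sg_word w (L t)) $ l\<bar> =
        \<bar>harm_ext b (L s) - harm_ext b (L t)\<bar> / sqrt 2"
      unfolding Phi_word[OF L(1)] Phi_word[OF L(2)] b_def[symmetric]
      by (simp flip: diff_divide_distrib)
    also have "\<dots> \<le> \<bar>harm_ext b (L s) - harm_ext b (L t)\<bar>"
      by (simp add: divide_le_eq mult_le_cancel_left1)
    also have "\<dots> = \<bar>(b i - b k) * (harm_ext (unit_data i) (L s) - harm_ext (unit_data i) (L t)) +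
        (b j - b k) * (harm_ext (unit_data j) (L s) - harm_ext (unit_data j) (L t))\<bar>"
      unfolding harm_ext_expand[OF L(1) assms(1) k, of b] harm_ext_expand[OF L(2) assms(1) k, of b]
      by (simp add: algebra_simps)
    also have "\<dots> \<le> \<bar>b i - b k\<bar> * (harm_ext (unit_data i) (L s) - harm_ext (unit_data i) (L t)) +
        \<bar>b j - b k\<bar> * (harm_ext (unit_data j) (L t) - harm_ext (unit_data j) (L s))"
      using mono by (intro order_trans[OF abs_triangle_ineq]) (simp add: abs_mult)
    also have "\<dots> \<le> (3/5) ^ length w * (harm_ext (unit_data i) (L s) - harm_ext (unit_data i) (L t)) +
        (3/5) ^ length w * (harm_ext (unit_data j) (L t) - harm_ext (unit_data j) (L s))"
      using mono osc by (intro add_mono mult_right_mono) auto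
    also have "\<dots> = (3/5) ^ length w * (v t - v s)" by (simp add: v_def algebra_simps)
    finally show "\<bar>Phi (sg_word w (L s)) $ l - Phi (sg_word w (L t)) $ l\<bar>
        \<le> (3/5) ^ length w * (v t - v s)" .
  qed
  finally show ?thesis by simp
qed

text \<open>The bounds by increments of v telescope over any partition. Along the edge v runs from
  -1 to 1, whence the constant 6 = 3 * 2. Positivity comes from the partition with one step.\<close>

lemma Phi_edge_length:
  fixes w :: "3 list"
  assumes "i \<noteq> j"
  defines "c \<equiv> \<lambda>t. Phi (sg_word w (linepath (sg_vertex i) (sg_vertex j) t))"
  shows "0 < curve_length c 0 1" "curve_length c 0 1 \<le> 6 * (3/5) ^ length w"
proof -
  define P where "P = {(\<Sum>m<n. dist (c (t m)) (c (t (Suc m)))) | (t :: nat \<Rightarrow> real) n.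
            t 0 = 0 \<and> t n = 1 \<and> (\<forall>m<n. t m \<le> t (Suc m))}"
  have len: "curve_length c 0 1 = Sup P" unfolding curve_length_def P_def ..
  have bound: "S \<le> 6 * (3/5) ^ length w" if S_P: "S \<in> P" for S
  proof -
    obtain t n where S: "S = (\<Sum>m<n. dist (c (t m)) (c (t (Suc m))))"
      and t: "t 0 = 0" "t n = (1::real)" "\<forall>m<n. t m \<le> t (Suc m)"
      using S_P unfolding P_def by blast
    have mono: "t m \<le> t m'" if "m \<le> m'" "m' \<le> n" for m m'
      using that by (induction rule: dec_induct) (use t(3) in \<open>auto intro: order_trans\<close>)
    define v where "v = (\<lambda>t. harm_ext (unit_data j) (linepath (sg_vertex i) (sg_vertex j) t) -
      harm_ext (unit_data i) (linepath (sg_vertex i) (sg_vertex j) t))"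
    have "S \<le> (\<Sum>m<n. 3 * (3/5) ^ length w * (v (t (Suc m)) - v (t m)))"
      unfolding S c_def v_def
    proof (intro sum_mono Phi_edge_dist assms(1))
      fix m assume "m \<in> {..<n}"
      then show "0 \<le> t m" "t m \<le> t (Suc m)" "t (Suc m) \<le> 1"
        using mono[of 0 m] mono[of m "Suc m"] mono[of "Suc m" n] t by auto
    qed
    also have "\<dots> = 3 * (3/5) ^ length w * (v (t n) - v (t 0))"
      using sum_lessThan_telescope[of "\<lambda>m. v (t m)" n] by (simp only: sum_distrib_left[symmetric])
    also have "v (t n) - v (t 0) = 2"
      using assms(1) unfolding t v_def linepath_0' linepath_1' by simp
    finally show ?thesis by simp
  qed
  \<comment> \<open>The partition with \<open>t = real\<close> and one step has the points 0 and
    1.\<close>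
  have "dist (c 0) (c 1) \<in> P"
    unfolding P_def by (rule CollectI, intro exI[of _ real] exI[of _ "Suc 0"]) simp
  moreover have "0 < dist (c 0) (c 1)"
    using Phi_word_vertex_neq[OF assms(1), of w] by (simp add: c_def linepath_0' linepath_1')
  moreover have "bdd_above P" using bound by (rule bdd_aboveI)
  ultimately show "0 < curve_length c 0 1"
    unfolding len by (meson cSup_upper less_le_trans)
  show "curve_length c 0 1 \<le> 6 * (3/5) ^ length w"
    unfolding len using bound \<open>dist (c 0) (c 1) \<in> P\<close> by (intro cSup_least) auto
qed

lemma edge_length_bounds:
  assumes "i \<noteq> j" "R = sg_word w ` closed_segment (sg_vertex i) (sg_vertex j)"
  shows "0 < edge_length R" "edge_length R \<le> 6 * (3/5) ^ length w"
proof -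
  have R: "R = closed_segment (sg_word w (sg_vertex i)) (sg_word w (sg_vertex j))"
    unfolding assms(2) linepath_image_01[symmetric] image_image sg_word_linepath ..
  define c where "c = (SOME c. \<exists>a b. R = closed_segment a b \<and> c = linepath a b)"
  have "\<exists>a b. R = closed_segment a b \<and> c = linepath a b"
    unfolding c_def by (rule someI_ex[where P = "\<lambda>c. \<exists>a b. R = closed_segment a b \<and> c = linepath a b"])
      (intro exI conjI, rule R, rule refl)
  then obtain a b where ab: "R = closed_segment a b" "c = linepath a b" by blast
  \<comment> \<open>A segment determines its end points up to order, so the chosen parametrization
    is one of the two orientations, and the length bound holds for both.\<close>
  then have "{a, b} = {sg_word w (sg_vertex i), sg_word w (sg_vertex j)}"
    using R by simp
  then obtain i' j' where "i' \<noteq> j'" "a = sg_word w (sg_vertex i')" "b = sg_word w (sg_vertex j')"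
    using assms(1) by (metis doubleton_eq_iff)
  then have "edge_length R = curve_length (\<lambda>t. Phi (sg_word w (linepath (sg_vertex i') (sg_vertex j') t))) 0 1"
    unfolding edge_length_def edge_curve_def c_def[symmetric] ab(2)
    by (simp add: comp_def sg_word_linepath)
  then show "0 < edge_length R" "edge_length R \<le> 6 * (3/5) ^ length w"
    using Phi_edge_length[OF \<open>i' \<noteq> j'\<close>, of w] by simp_all
qed

section \<open>Summing the lengths over all edges\<close>

lemma card_words: "card {w::3 list. length w = n} = 3 ^ n"
  using card_lists_length_eq[of "UNIV :: 3 set" n] by simp

text \<open>All nine pairs of corners are counted for each word, a harmless overcount; the
  \<open>3 ^ n\<close> words of length n contribute \<open>(3 * q) ^ n\<close>.\<close>

lemma words_summable_on:
  fixes q :: real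
  assumes "0 \<le> q" "3 * q < 1"
  shows "(\<lambda>(w::3 list, i::3, j::3). q ^ length w) summable_on UNIV"
proof (rule nonneg_bdd_above_summable_on)
  show "bdd_above (sum (\<lambda>(w::3 list, i::3, j::3). q ^ length w) ` {F. F \<subseteq> UNIV \<and> finite F})"
  proof (rule bdd_aboveI2)
    fix F :: "(3 list \<times> 3 \<times> 3) set" assume "F \<in> {F. F \<subseteq> UNIV \<and> finite F}"
    then have F: "finite F" by simp
    define N where "N = Suc (Max (insert 0 ((length \<circ> fst) ` F)))"
    let ?W = "\<Union>n<N. {w::3 list. length w = n}"
    have sub: "F \<subseteq> ?W \<times> UNIV"
      using F by (force simp: N_def less_Suc_eq_le intro!: Max_ge)
    have fin: "finite ?W" using finite_words by blast
    have "(\<Sum>(w, i, j)\<in>F. q ^ length w) \<le> (\<Sum>(w, i, j)\<in>?W \<times> (UNIV :: (3 \<times> 3) set). q ^ length w)"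
      using fin sub assms by (intro sum_mono2) (auto intro!: finite_cartesian_product)
    also have "\<dots> = (\<Sum>w\<in>?W. \<Sum>_\<in>(UNIV :: (3 \<times> 3) set). q ^ length w)"
      unfolding sum.cartesian_product by (simp only: case_prod_unfold)
    also have "\<dots> = 9 * (\<Sum>w\<in>?W. q ^ length w)"
      by (simp add: sum_distrib_left card_UNIV_unit flip: UNIV_Times_UNIV)
    also have "(\<Sum>w\<in>?W. q ^ length w) = (\<Sum>n<N. \<Sum>w\<in>{w::3 list. length w = n}. q ^ length w)"
      using finite_words by (intro sum.UNION_disjoint) auto
    also have "\<dots> = (\<Sum>n<N. (3 * q) ^ n)"
      by (intro sum.cong refl) (simp add: card_words power_mult_distrib)
    also have "\<dots> \<le> (\<Sum>n. (3 * q) ^ n)"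
      using assms by (intro sum_le_suminf summable_geometric) auto
    finally show "(\<Sum>(w, i, j)\<in>F. q ^ length w) \<le> 9 * (\<Sum>n. (3 * q) ^ n)"
      by (simp only: case_prod_unfold)
  qed
qed (use assms in auto)

lemma edge_length_pos: "R \<in> sg_edges \<Longrightarrow> 0 < edge_length R"
  unfolding sg_edges_def using edge_length_bounds(1) by blast

text \<open>Every edge of the enumeration is given some name (w, i, j). The name determines the
  edge, so the choice is injective and the series is dominated by a sum over names. The condition on
  s is exactly \<open>3 * (3/5) powr s < 1\<close>.\<close>

lemma edge_length_summable:
  fixes R :: "nat \<Rightarrow> (real^2) set"
  assumes R: "bij_betw R UNIV sg_edges" and s: "ln 3 / (ln 5 - ln 3) < s"
  shows "summable (\<lambda>j. edge_length (R j) powr s)"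
proof -
  have pos: "0 < ln 5 - ln (3::real)" by simp
  have "0 < ln 3 / (ln 5 - ln (3::real))" by (intro divide_pos_pos pos) simp
  then have s0: "0 < s" using s by linarith
  define q :: real where "q = (3/5) powr s"
  have q: "0 \<le> q" "3 * q < 1"
  proof -
    have "ln (3 * q) = ln 3 - s * (ln 5 - ln 3)"
      by (simp add: q_def ln_mult ln_powr ln_div algebra_simps)
    also have "\<dots> < 0" using s pos by (simp add: pos_divide_less_eq)
    finally show "3 * q < 1" by (simp add: q_def)
  qed (simp add: q_def)
  have "\<forall>m. \<exists>z. case z of (w, i, j) \<Rightarrow> i \<noteq> j \<and> R m = sg_word w ` closed_segment (sg_vertex i) (sg_vertex j)"
  proof
    fix m
    have "R m \<in> sg_edges" using R by (auto simp: bij_betw_def)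
    then show "\<exists>z. case z of (w, i, j) \<Rightarrow> i \<noteq> j \<and> R m = sg_word w ` closed_segment (sg_vertex i) (sg_vertex j)"
      unfolding sg_edges_def by auto
  qed
  from choice[OF this] obtain z where
    z: "\<forall>m. case z m of (w, i, j) \<Rightarrow> i \<noteq> j \<and> R m = sg_word w ` closed_segment (sg_vertex i) (sg_vertex j)" ..
  have "inj z"
  proof (rule injI)
    fix m m' assume "z m = z m'"
    then have "R m = R m'" using z[rule_format, of m] z[rule_format, of m'] by (auto split: prod.splits)
    then show "m = m'" using R by (auto simp: bij_betw_def inj_on_def)
  qed
  let ?g = "\<lambda>(w::3 list, i::3, j::3). q ^ length w"
  have "?g summable_on range z"
    by (rule summable_on_subset_banach[OF words_summable_on[OF q]]) simp
  then have "(?g \<circ> z) summable_on UNIV" using summable_on_reindex[OF \<open>inj z\<close>] by blast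
  then have "summable (\<lambda>m. 6 powr s * ?g (z m))"
    by (intro summable_mult summable_on_imp_summable) (simp add: comp_def)
  then show ?thesis
  proof (rule summable_comparison_test'[where N = 0])
    fix m :: nat
    obtain w i j where zm: "z m = (w, i, j)" by (rule prod_cases3)
    then have b: "0 < edge_length (R m)" "edge_length (R m) \<le> 6 * (3/5) ^ length w"
      using z[rule_format, of m] edge_length_bounds[of i j "R m" w] by auto
    have "edge_length (R m) powr s \<le> (6 * (3/5) ^ length w) powr s"
      using b s0 by (intro powr_mono2) auto
    also have "\<dots> = 6 powr s * q ^ length w"
      by (simp add: powr_mult q_def powr_powr mult.commute flip: powr_realpow)
    finally show "norm (edge_length (R m) powr s) \<le> 6 powr s * ?g (z m)" by (simp add: zm)
  qed
qed

section \<open>Spaces with a semi-inner product\<close>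

text \<open>The form is only semidefinite because vectors are functions and not classes of
  functions; identities between operators hold up to \<open>st_eq\<close> and are used after pairing
  with a vector, through \<open>inner_null_left\<close>.\<close>

locale semi_inner_space =
  fixes S :: "('x, 'i) spectral_triple"
  assumes zero_mem: "(\<lambda>_. 0) \<in> st_space S"
    and add_mem: "g \<in> st_space S \<Longrightarrow> h \<in> st_space S \<Longrightarrow> (\<lambda>x. g x + h x) \<in> st_space S"
    and scale_mem: "h \<in> st_space S \<Longrightarrow> (\<lambda>x. c * h x) \<in> st_space S"
    and inner_add_left: "g \<in> st_space S \<Longrightarrow> h \<in> st_space S \<Longrightarrow> k \<in> st_space S \<Longrightarrow>
      st_inner S (\<lambda>x. g x + h x) k = st_inner S g k + st_inner S h k"
    and inner_scale_left: "h \<in> st_space S \<Longrightarrow> k \<in> st_space S \<Longrightarrow>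
      st_inner S (\<lambda>x. c * h x) k = c * st_inner S h k"
    and inner_commute: "g \<in> st_space S \<Longrightarrow> h \<in> st_space S \<Longrightarrow> st_inner S h g = cnj (st_inner S g h)"
    and inner_nonneg: "h \<in> st_space S \<Longrightarrow> 0 \<le> Re (st_inner S h h)"
begin

abbreviation V where "V \<equiv> st_space S"
abbreviation ip where "ip \<equiv> st_inner S"
abbreviation nrm where "nrm \<equiv> st_norm S"

lemma diff_mem:
  assumes "g \<in> V" "h \<in> V"
  shows "(\<lambda>x. g x - h x) \<in> V"
  using add_mem[OF assms(1) scale_mem[OF assms(2), of "-1"]] by simp

lemma sum_mem:
  assumes "\<And>i. i \<in> I \<Longrightarrow> f i \<in> V"
  shows "(\<lambda>x. \<Sum>i\<in>I. f i x) \<in> V"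
  using assms by (induction I rule: infinite_finite_induct) (simp_all add: zero_mem add_mem)

lemma inner_zero_left: "k \<in> V \<Longrightarrow> ip (\<lambda>_. 0) k = 0"
  using inner_scale_left[of "\<lambda>_. 0" k 0] zero_mem by simp

lemma inner_diff_left:
  assumes "g \<in> V" "h \<in> V" "k \<in> V"
  shows "ip (\<lambda>x. g x - h x) k = ip g k - ip h k"
  using inner_add_left[OF assms(1) scale_mem[OF assms(2), of "-1"] assms(3)]
    inner_scale_left[OF assms(2,3), of "-1"] by simp

lemma inner_scale_right:
  assumes "h \<in> V" "k \<in> V"
  shows "ip h (\<lambda>x. c * k x) = cnj c * ip h k"
  using inner_commute[OF scale_mem[OF assms(2)] assms(1), of c] inner_commute[OF assms(2,1)]
  by (simp add: inner_scale_left assms)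

lemma inner_diff_right:
  assumes "g \<in> V" "h \<in> V" "k \<in> V"
  shows "ip k (\<lambda>x. g x - h x) = ip k g - ip k h"
  using inner_commute[OF diff_mem[OF assms(1,2)] assms(3)] inner_commute[OF assms(1,3)]
    inner_commute[OF assms(2,3)] by (simp add: inner_diff_left assms)

lemma inner_sum_left:
  assumes "\<And>i. i \<in> I \<Longrightarrow> f i \<in> V" "k \<in> V"
  shows "ip (\<lambda>x. \<Sum>i\<in>I. f i x) k = (\<Sum>i\<in>I. ip (f i) k)"
  using assms
  by (induction I rule: infinite_finite_induct)
     (simp_all add: inner_zero_left inner_add_left sum_mem)

lemma nrm_nonneg: "h \<in> V \<Longrightarrow> 0 \<le> nrm h"
  by (simp add: st_norm_def inner_nonneg)

lemma nrm_sq: "h \<in> V \<Longrightarrow> (nrm h)\<^sup>2 = Re (ip h h)"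
  by (simp add: st_norm_def inner_nonneg)

lemma inner_self: "h \<in> V \<Longrightarrow> ip h h = of_real ((nrm h)\<^sup>2)"
  using inner_commute[of h h] by (simp add: nrm_sq complex_eq_iff)

text \<open>The common source of the Cauchy-Schwarz inequality, the parallelogram bound and the
  homogeneity of the seminorm.\<close>

lemma nrm_diff_scale_sq:
  assumes "g \<in> V" "h \<in> V"
  shows "(nrm (\<lambda>x. g x - c * h x))\<^sup>2 = (nrm g)\<^sup>2 - 2 * Re (cnj c * ip g h) + (cmod c)\<^sup>2 * (nrm h)\<^sup>2"
proof -
  have ch: "(\<lambda>x. c * h x) \<in> V" by (rule scale_mem[OF assms(2)])
  have "ip (\<lambda>x. g x - c * h x) (\<lambda>x. g x - c * h x) =
      ip g g - cnj c * ip g h - c * ip h g + c * cnj c * ip h h"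
    by (simp add: inner_diff_left inner_diff_right inner_scale_left inner_scale_right ch assms
        diff_mem algebra_simps)
  also have "\<dots> = ip g g - (cnj c * ip g h + cnj (cnj c * ip g h)) + c * cnj c * ip h h"
    using inner_commute[OF assms] by simp
  also have "cnj c * ip g h + cnj (cnj c * ip g h) = of_real (2 * Re (cnj c * ip g h))"
    by (rule complex_add_cnj)
  also have "c * cnj c = of_real ((cmod c)\<^sup>2)" by (rule complex_norm_square[symmetric])
  finally show ?thesis
    using nrm_sq[OF diff_mem[OF assms(1) ch]] by (simp add: inner_self assms)
qed

lemma Cauchy_Schwarz:
  assumes "g \<in> V" "h \<in> V"
  shows "cmod (ip g h) \<le> nrm g * nrm h"
proof -
  define A where "A = (cmod (ip g h))\<^sup>2"
  \<comment> \<open>The square of the norm of \<open>g - c * h\<close> for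
    \<open>c = t * ip g h\<close>, a quadratic polynomial in the real parameter t.\<close>
  have *: "0 \<le> (nrm g)\<^sup>2 - 2 * t * A + t\<^sup>2 * A * (nrm h)\<^sup>2" for t :: real
  proof -
    have "cnj (of_real t * ip g h) * ip g h = of_real t * (ip g h * cnj (ip g h))"
      by (simp add: mult_ac)
    also have "\<dots> = of_real (t * A)"
      by (simp add: A_def complex_norm_square[symmetric])
    finally have "Re (cnj (of_real t * ip g h) * ip g h) = t * A"
      by (metis Re_complex_of_real)
    then have "(nrm (\<lambda>x. g x - (of_real t * ip g h) * h x))\<^sup>2 =
        (nrm g)\<^sup>2 - 2 * (t * A) + (cmod (of_real t * ip g h))\<^sup>2 * (nrm h)\<^sup>2"
      by (simp only: nrm_diff_scale_sq[OF assms])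
    also have "\<dots> = (nrm g)\<^sup>2 - 2 * t * A + t\<^sup>2 * A * (nrm h)\<^sup>2"
      by (simp add: A_def norm_mult power_mult_distrib)
    finally show ?thesis by (metis zero_le_power2)
  qed
  have "A \<le> (nrm g)\<^sup>2 * (nrm h)\<^sup>2"
  proof (cases "nrm h = 0")
    case True
    have "A = 0"
    proof (rule ccontr)
      assume "A \<noteq> 0"
      \<comment> \<open>For a null vector h the polynomial is linear in t; this t gives it the value
        -1.\<close>
      then show False using *[of "((nrm g)\<^sup>2 + 1) / (2 * A)"] True by simp
    qed
    then show ?thesis by simp
  next
    case False
    then have "0 \<le> (nrm g)\<^sup>2 - A / (nrm h)\<^sup>2"
      using *[of "1 / (nrm h)\<^sup>2"] by (simp add: power2_eq_square field_simps)
    then show ?thesis using False by (simp add: field_simps)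
  qed
  then have "(cmod (ip g h))\<^sup>2 \<le> (nrm g * nrm h)\<^sup>2" by (simp add: A_def power_mult_distrib)
  then show ?thesis
    by (rule power2_le_imp_le) (simp add: nrm_nonneg assms)
qed

lemma inner_null_left:
  assumes "g \<in> V" "h \<in> V" "k \<in> V" "st_eq S g h"
  shows "ip g k = ip h k"
proof -
  have "cmod (ip (\<lambda>x. g x - h x) k) \<le> 0"
    using Cauchy_Schwarz[OF diff_mem[OF assms(1,2)] assms(3)] assms(4) by (simp add: st_eq_def)
  then show ?thesis by (simp add: inner_diff_left assms)
qed

lemma nrm_add_sq_le:
  assumes "g \<in> V" "h \<in> V"
  shows "(nrm (\<lambda>x. g x + h x))\<^sup>2 \<le> 2 * (nrm g)\<^sup>2 + 2 * (nrm h)\<^sup>2"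
proof -
  have "(nrm (\<lambda>x. g x + h x))\<^sup>2 + (nrm (\<lambda>x. g x - h x))\<^sup>2 = 2 * (nrm g)\<^sup>2 + 2 * (nrm h)\<^sup>2"
    using nrm_diff_scale_sq[OF assms, of "-1"] nrm_diff_scale_sq[OF assms, of 1] by simp
  then show ?thesis using zero_le_power2[of "nrm (\<lambda>x. g x - h x)"] by linarith
qed

lemma nrm_scale: "h \<in> V \<Longrightarrow> nrm (\<lambda>x. c * h x) = cmod c * nrm h"
proof -
  assume h: "h \<in> V"
  have "(nrm (\<lambda>x. c * h x))\<^sup>2 = (cmod c * nrm h)\<^sup>2"
    using nrm_diff_scale_sq[OF zero_mem h, of "-c"] inner_zero_left[OF zero_mem]
    by (simp add: st_norm_def inner_zero_left h power_mult_distrib)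
  then show ?thesis
    by (rule power2_eq_imp_eq) (simp_all add: nrm_nonneg h scale_mem)
qed

definition orthonormal :: "(nat \<Rightarrow> 'i \<Rightarrow> complex) \<Rightarrow> bool" where
  "orthonormal e \<longleftrightarrow> (\<forall>n. e n \<in> V) \<and> (\<forall>m n. ip (e m) (e n) = (if m = n then 1 else 0))"

lemma orthonormal_expansion:
  assumes e: "orthonormal e" and h: "h \<in> V"
  defines "P \<equiv> \<lambda>N x. \<Sum>n<N. ip h (e n) * e n x"
  shows "P N \<in> V"
    and "(nrm (\<lambda>x. h x - P N x))\<^sup>2 = (nrm h)\<^sup>2 - (\<Sum>n<N. (cmod (ip h (e n)))\<^sup>2)"
proof -
  have en: "e n \<in> V" for n using e by (simp add: orthonormal_def)
  show P: "P N \<in> V" unfolding P_def by (intro sum_mem scale_mem en)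
  have ipP: "ip (P N) k = (\<Sum>n<N. ip h (e n) * ip (e n) k)" if "k \<in> V" for k
    unfolding P_def by (simp add: inner_sum_left inner_scale_left scale_mem en that)
  have ortho: "ip (e m) (e n) = (if m = n then 1 else 0)" for m n
    using e unfolding orthonormal_def by blast
  have Pe: "ip (P N) (e n) = (if n < N then ip h (e n) else 0)" for n
    by (simp add: ipP[OF en] ortho if_distrib sum.delta cong: if_cong)
  have "ip (P N) h = of_real (\<Sum>n<N. (cmod (ip h (e n)))\<^sup>2)"
    by (simp add: ipP[OF h] inner_commute[OF h en] complex_norm_square del: of_real_power)
  moreover have "ip (P N) (P N) = ip (P N) h"
  proof -
    have "ip (e n) (P N) = (if n < N then ip (e n) h else 0)" for n
      using inner_commute[OF P en[of n]] inner_commute[OF h en[of n]] Pe by simp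
    then show ?thesis by (simp add: ipP P h)
  qed
  moreover have "ip h (P N) = cnj (ip (P N) h)" by (rule inner_commute[OF P h])
  ultimately show "(nrm (\<lambda>x. h x - P N x))\<^sup>2 = (nrm h)\<^sup>2 - (\<Sum>n<N. (cmod (ip h (e n)))\<^sup>2)"
    by (simp add: nrm_sq diff_mem P h inner_diff_left inner_diff_right)
qed

lemma Bessel:
  assumes "orthonormal e" "h \<in> V"
  shows "(\<Sum>n<N. (cmod (ip h (e n)))\<^sup>2) \<le> (nrm h)\<^sup>2"
  using zero_le_power2[of "nrm (\<lambda>x. h x - (\<Sum>n<N. ip h (e n) * e n x))"]
  unfolding orthonormal_expansion(2)[OF assms] by simp

text \<open>Replaces norm convergence of vector series by an identity between sums of non-negative
  numbers, which can be rearranged freely; this is what makes the passage to direct sums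
  easy.\<close>

lemma onb_iff_Parseval:
  "st_onb S e \<longleftrightarrow> orthonormal e \<and> (\<forall>h\<in>V. (\<lambda>n. (cmod (ip h (e n)))\<^sup>2) sums (nrm h)\<^sup>2)"
proof -
  have "(\<lambda>N. nrm (\<lambda>x. h x - (\<Sum>n<N. ip h (e n) * e n x))) \<longlonglongrightarrow> 0 \<longleftrightarrow>
      (\<lambda>n. (cmod (ip h (e n)))\<^sup>2) sums (nrm h)\<^sup>2" if e: "orthonormal e" and h: "h \<in> V" for h
  proof -
    let ?r = "\<lambda>N. nrm (\<lambda>x. h x - (\<Sum>n<N. ip h (e n) * e n x))"
    have "?r \<longlonglongrightarrow> 0 \<longleftrightarrow> (\<lambda>N. (?r N)\<^sup>2) \<longlonglongrightarrow> 0"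
    proof
      assume "(\<lambda>N. (?r N)\<^sup>2) \<longlonglongrightarrow> 0"
      then have "(\<lambda>N. sqrt ((?r N)\<^sup>2)) \<longlonglongrightarrow> sqrt 0" by (rule tendsto_real_sqrt)
      then show "?r \<longlonglongrightarrow> 0"
        by (simp add: nrm_nonneg diff_mem h orthonormal_expansion(1)[OF e h])
    qed (use tendsto_power[of ?r 0 _ 2] in simp)
    also have "\<dots> \<longleftrightarrow> (\<lambda>N. (nrm h)\<^sup>2 - (\<Sum>n<N. (cmod (ip h (e n)))\<^sup>2)) \<longlonglongrightarrow> 0"
      by (simp only: orthonormal_expansion(2)[OF e h])
    also have "\<dots> \<longleftrightarrow> (\<lambda>n. (cmod (ip h (e n)))\<^sup>2) sums (nrm h)\<^sup>2"
      unfolding sums_def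
    proof
      assume "(\<lambda>N. (nrm h)\<^sup>2 - (\<Sum>n<N. (cmod (ip h (e n)))\<^sup>2)) \<longlonglongrightarrow> 0"
      from tendsto_diff[OF tendsto_const[of "(nrm h)\<^sup>2"] this]
      show "(\<lambda>N. \<Sum>n<N. (cmod (ip h (e n)))\<^sup>2) \<longlonglongrightarrow> (nrm h)\<^sup>2" by simp
    next
      assume "(\<lambda>N. \<Sum>n<N. (cmod (ip h (e n)))\<^sup>2) \<longlonglongrightarrow> (nrm h)\<^sup>2"
      from tendsto_diff[OF tendsto_const[of "(nrm h)\<^sup>2"] this]
      show "(\<lambda>N. (nrm h)\<^sup>2 - (\<Sum>n<N. (cmod (ip h (e n)))\<^sup>2)) \<longlonglongrightarrow> 0" by simp
    qed
    finally show ?thesis .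
  qed
  then show ?thesis unfolding st_onb_def orthonormal_def by blast
qed

lemma Parseval: "st_onb S e \<Longrightarrow> h \<in> V \<Longrightarrow> (\<lambda>n. (cmod (ip h (e n)))\<^sup>2) sums (nrm h)\<^sup>2"
  by (simp add: onb_iff_Parseval)

lemma Parseval_inner:
  assumes e: "st_onb S e" and g: "g \<in> V" and h: "h \<in> V"
  shows "(\<lambda>n. ip g (e n) * cnj (ip h (e n))) sums ip g h"
proof -
  let ?P = "\<lambda>N x. \<Sum>n<N. ip g (e n) * e n x"
  have en: "e n \<in> V" for n using e by (simp add: st_onb_def)
  have P: "?P N \<in> V" for N by (intro sum_mem scale_mem en)
  have "(\<lambda>N. nrm (\<lambda>x. g x - ?P N x) * nrm h) \<longlonglongrightarrow> 0 * nrm h"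
    using e g by (intro tendsto_intros) (auto simp: st_onb_def)
  then have "(\<lambda>N. ip (\<lambda>x. g x - ?P N x) h) \<longlonglongrightarrow> 0"
    unfolding mult_zero_left
    by (rule Lim_null_comparison[OF always_eventually[OF allI], rotated])
       (rule Cauchy_Schwarz[OF diff_mem[OF g P] h])
  from tendsto_diff[OF tendsto_const[of "ip g h"] this]
  have "(\<lambda>N. ip (?P N) h) \<longlonglongrightarrow> ip g h"
    by (simp only: inner_diff_left[OF g P h] diff_diff_eq2 add_diff_cancel_left' diff_zero)
  then show ?thesis
    by (simp add: sums_def inner_sum_left inner_scale_left scale_mem en h inner_commute[OF h en])
qed

text \<open>T is known on basis vectors only, and only up to null vectors. Pairing with
  \<open>e m\<close> removes the ambiguity, and boundedness allows the passage from finite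
  expansions of h to h itself.\<close>

lemma bounded_linear_diagonal:
  assumes T: "st_bounded_linear S T" and e: "st_onb S e"
    and eig: "\<And>n. st_eq S (T (e n)) (\<lambda>x. of_real (\<phi> n) * e n x)" and h: "h \<in> V"
  shows "ip (T h) (e m) = of_real (\<phi> m) * ip h (e m)"
proof -
  have en: "e n \<in> V" for n using e by (simp add: st_onb_def)
  have T_mem: "T g \<in> V" if "g \<in> V" for g using T that by (simp add: st_bounded_linear_def)
  have T_add: "ip (T (\<lambda>x. f x + g x)) k = ip (T f) k + ip (T g) k" if "f \<in> V" "g \<in> V" "k \<in> V" for f g k
    using T that inner_null_left[OF T_mem[OF add_mem[OF that(1,2)]] add_mem[OF T_mem T_mem] that(3)]
    by (simp add: st_bounded_linear_def inner_add_left)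
  have T_scale: "ip (T (\<lambda>x. c * g x)) k = c * ip (T g) k" if "g \<in> V" "k \<in> V" for c g k
    using T that inner_null_left[OF T_mem[OF scale_mem[OF that(1)]] scale_mem[OF T_mem] that(2)]
    by (simp add: st_bounded_linear_def inner_scale_left)
  obtain C where "\<forall>g\<in>V. nrm (T g) \<le> C * nrm g"
    using T unfolding st_bounded_linear_def by blast
  then have C: "nrm (T g) \<le> C * nrm g" if "g \<in> V" for g using that by blast
  let ?P = "\<lambda>N x. \<Sum>n<N. ip h (e n) * e n x"
  have P: "?P N \<in> V" for N by (intro sum_mem scale_mem en)
  have Te: "ip (T (e n)) (e m) = (if n = m then of_real (\<phi> m) else 0)" for n
    using inner_null_left[OF T_mem[OF en] scale_mem[OF en] en eig, of n m] e
    by (simp add: inner_scale_left en st_onb_def)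
  have TP: "ip (T (?P N)) (e m) = (\<Sum>n<N. ip h (e n) * ip (T (e n)) (e m))" for N
  proof (induction N)
    case 0
    show ?case using T_scale[OF h en, of 0 m] by simp
  next
    case (Suc N)
    then show ?case using T_add[OF P[of N] scale_mem[OF en] en, of "ip h (e N)" N m]
      by (simp add: T_scale en)
  qed
  have split: "ip (T (?P N)) (e m) = ip (T h) (e m) - ip (T (\<lambda>x. h x - ?P N x)) (e m)" for N
    using T_add[OF P[of N] diff_mem[OF h P[of N]] en, of m] by simp
  have "(\<lambda>N. C * nrm (\<lambda>x. h x - ?P N x) * nrm (e m)) \<longlonglongrightarrow> C * 0 * nrm (e m)"
    using e h by (intro tendsto_intros) (auto simp: st_onb_def)
  moreover have "cmod (ip (T (\<lambda>x. h x - ?P N x)) (e m)) \<le> C * nrm (\<lambda>x. h x - ?P N x) * nrm (e m)" for N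
    by (rule order_trans[OF Cauchy_Schwarz[OF T_mem[OF diff_mem[OF h P]] en]
          mult_right_mono[OF C[OF diff_mem[OF h P]] nrm_nonneg[OF en]]])
  ultimately have "(\<lambda>N. ip (T (\<lambda>x. h x - ?P N x)) (e m)) \<longlonglongrightarrow> 0"
    unfolding mult_zero_right mult_zero_left
    by (rule Lim_null_comparison[OF always_eventually[OF allI], rotated])
  from tendsto_diff[OF tendsto_const[of "ip (T h) (e m)"] this]
  have "(\<lambda>N. ip (T (?P N)) (e m)) \<longlonglongrightarrow> ip (T h) (e m)"
    by (simp only: split diff_zero)
  moreover have "\<forall>\<^sub>F N in sequentially. ip (T (?P N)) (e m) = of_real (\<phi> m) * ip h (e m)"
    using eventually_gt_at_top[of m]
    by eventually_elim (simp add: TP Te if_distrib sum.delta cong: if_cong)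
  then have "(\<lambda>N. ip (T (?P N)) (e m)) \<longlonglongrightarrow> of_real (\<phi> m) * ip h (e m)"
    by (rule tendsto_eventually)
  ultimately show ?thesis by (rule LIMSEQ_unique)
qed

end

section \<open>Traces and eigenvalue sums through doubly indexed sums\<close>

lemma suminf_ennreal_swap:
  fixes f :: "nat \<Rightarrow> nat \<Rightarrow> ennreal"
  shows "(\<Sum>n. \<Sum>m. f n m) = (\<Sum>m. \<Sum>n. f n m)"
  using nn_integral_suminf[of "\<lambda>m n. f n m" "count_space UNIV"]
  unfolding nn_integral_count_space_nat by simp

context semi_inner_space
begin

text \<open>The basis f in \<open>st_trace\<close> is an arbitrary choice. The numbers
  \<open>\<phi> m * |ip (f n) (e m)|^2\<close> sum over m to the n-th diagonal entry, by Parseval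
  for e, and over n to \<open>\<phi> m\<close>, by Parseval for f.\<close>

lemma trace_eq:
  assumes T: "st_bounded_linear S T" and e: "st_onb S e"
    and eig: "\<And>n. st_eq S (T (e n)) (\<lambda>x. of_real (\<phi> n) * e n x)" and nonneg: "\<And>n. 0 \<le> \<phi> n"
  shows "st_trace S T = (\<Sum>n. ennreal (\<phi> n))"
proof -
  define f where "f = (SOME f. st_onb S f)"
  have f: "st_onb S f" unfolding f_def using e by (rule someI[of "st_onb S" e])
  have en: "e n \<in> V" and fn: "f n \<in> V" for n using e f by (simp_all add: st_onb_def)
  have Tf: "T (f n) \<in> V" for n using T fn by (simp add: st_bounded_linear_def)
  have row: "ennreal (Re (ip (T (f n)) (f n))) = (\<Sum>m. ennreal (\<phi> m * (cmod (ip (f n) (e m)))\<^sup>2))" for n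
  proof -
    have "(\<lambda>m. Re (ip (T (f n)) (e m) * cnj (ip (f n) (e m)))) sums Re (ip (T (f n)) (f n))"
      by (intro sums_Re Parseval_inner e Tf fn)
    moreover have "Re (ip (T (f n)) (e m) * cnj (ip (f n) (e m))) = \<phi> m * (cmod (ip (f n) (e m)))\<^sup>2" for m
    proof -
      have "ip (T (f n)) (e m) * cnj (ip (f n) (e m)) = of_real (\<phi> m) * (ip (f n) (e m) * cnj (ip (f n) (e m)))"
        by (simp add: bounded_linear_diagonal[OF T e eig fn] mult.assoc)
      also have "\<dots> = of_real (\<phi> m * (cmod (ip (f n) (e m)))\<^sup>2)"
        by (simp only: of_real_mult complex_norm_square)
      finally show ?thesis by simp
    qed
    ultimately have "(\<lambda>m. \<phi> m * (cmod (ip (f n) (e m)))\<^sup>2) sums Re (ip (T (f n)) (f n))" by simp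
    then show ?thesis using nonneg by (intro suminf_ennreal_eq[symmetric]) auto
  qed
  have column: "(\<Sum>n. ennreal (\<phi> m * (cmod (ip (f n) (e m)))\<^sup>2)) = ennreal (\<phi> m)" for m
  proof -
    have "(nrm (e m))\<^sup>2 = 1" using e by (simp add: nrm_sq en st_onb_def)
    then have "(\<lambda>n. \<phi> m * (cmod (ip (e m) (f n)))\<^sup>2) sums (\<phi> m * 1)"
      using Parseval[OF f en[of m]] by (intro sums_mult) simp
    moreover have "cmod (ip (e m) (f n)) = cmod (ip (f n) (e m))" for n
      using inner_commute[OF fn en, of m n] by simp
    ultimately show ?thesis using nonneg by (intro suminf_ennreal_eq) auto
  qed
  have "st_trace S T = (\<Sum>n. ennreal (Re (ip (T (f n)) (f n))))"
    by (simp add: st_trace_def f_def Let_def)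
  also have "\<dots> = (\<Sum>m. \<Sum>n. ennreal (\<phi> m * (cmod (ip (f n) (e m)))\<^sup>2))"
    unfolding row by (rule suminf_ennreal_swap)
  finally show ?thesis by (simp only: column)
qed

text \<open>Both sides are compared through the doubly indexed sum of
  $\varphi(\nu_k)\,|\langle e_n, b_k\rangle|^2 = \varphi(\lambda_n)\,|\langle e_n, b_k\rangle|^2$.\<close>

lemma eigenvalue_sum_ge:
  assumes e: "st_onb S e" and b: "orthonormal b"
    and eig: "\<And>n k. of_real (lam n) * ip (e n) (b k) = of_real (\<nu> k) * ip (e n) (b k)"
    and nonneg: "\<And>t. 0 \<le> \<phi> t"
  shows "(\<Sum>k. ennreal (\<phi> (\<nu> k))) \<le> (\<Sum>n. ennreal (\<phi> (lam n)))"
proof -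
  have en: "e n \<in> V" and bk: "b k \<in> V" for n k using e b by (simp_all add: st_onb_def orthonormal_def)
  have sym: "cmod (ip (b k) (e n)) = cmod (ip (e n) (b k))" for k n
    using inner_commute[OF en bk, of k n] by simp
  \<comment> \<open>By \<open>eig\<close>, vectors with different eigenvalues are orthogonal, so
    either the weight vanishes or the eigenvalues agree.\<close>
  have eq: "\<phi> (\<nu> k) * (cmod (ip (e n) (b k)))\<^sup>2 = \<phi> (lam n) * (cmod (ip (e n) (b k)))\<^sup>2" for n k
    using eig[of n k] by (cases "ip (e n) (b k) = 0") auto
  have column: "ennreal (\<phi> (\<nu> k)) = (\<Sum>n. ennreal (\<phi> (lam n) * (cmod (ip (e n) (b k)))\<^sup>2))" for k
  proof -
    have "(nrm (b k))\<^sup>2 = 1" using b by (simp add: nrm_sq bk orthonormal_def)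
    then have "(\<lambda>n. \<phi> (\<nu> k) * (cmod (ip (b k) (e n)))\<^sup>2) sums (\<phi> (\<nu> k) * 1)"
      using Parseval[OF e bk[of k]] by (intro sums_mult) simp
    then show ?thesis using nonneg by (intro suminf_ennreal_eq[symmetric]) (auto simp: sym eq)
  qed
  \<comment> \<open>The family b need not be complete, so Bessel's inequality takes the place of
    Parseval's identity and the result is an inequality.\<close>
  have row: "(\<Sum>k. ennreal (\<phi> (lam n) * (cmod (ip (e n) (b k)))\<^sup>2)) \<le> ennreal (\<phi> (lam n))" for n
  proof (rule suminf_le_const[OF summableI])
    fix K
    have "(nrm (e n))\<^sup>2 = 1" using e by (simp add: nrm_sq en st_onb_def)
    then have "(\<Sum>k<K. (cmod (ip (e n) (b k)))\<^sup>2) \<le> 1" using Bessel[OF b en[of n], of K] by simp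
    then have "\<phi> (lam n) * (\<Sum>k<K. (cmod (ip (e n) (b k)))\<^sup>2) \<le> \<phi> (lam n)"
      using nonneg by (simp add: mult_left_le)
    then show "(\<Sum>k<K. ennreal (\<phi> (lam n) * (cmod (ip (e n) (b k)))\<^sup>2)) \<le> ennreal (\<phi> (lam n))"
      using nonneg by (simp add: sum_ennreal ennreal_leI sum_distrib_left)
  qed
  have "(\<Sum>k. ennreal (\<phi> (\<nu> k))) = (\<Sum>n. \<Sum>k. ennreal (\<phi> (lam n) * (cmod (ip (e n) (b k)))\<^sup>2))"
    unfolding column by (rule suminf_ennreal_swap)
  also have "\<dots> \<le> (\<Sum>n. ennreal (\<phi> (lam n)))"
    by (intro suminf_le row summableI)
  finally show ?thesis .
qed

end

section \<open>Direct sums\<close>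

lemma sum_triple_sel [simp]:
  "st_space (sum_triple A S) = sum_space S"
  "st_inner (sum_triple A S) g h = (\<Sum>j. st_inner (S j) (summand j g) (summand j h))"
  "st_dirac (sum_triple A S) = {(h, g). h \<in> sum_space S \<and> g \<in> sum_space S \<and>
     (\<forall>j. (summand j h, summand j g) \<in> st_dirac (S j))}"
  by (simp_all add: sum_triple_def)

lemma summand_arith [simp]:
  "summand j (\<lambda>_. 0) = (\<lambda>_. 0)"
  "summand j (\<lambda>x. g x + h x) = (\<lambda>x. summand j g x + summand j h x)"
  "summand j (\<lambda>x. g x - h x) = (\<lambda>x. summand j g x - summand j h x)"
  "summand j (\<lambda>x. c * h x) = (\<lambda>x. c * summand j h x)"
  by (simp_all add: summand_def)

definition embed :: "nat \<Rightarrow> ('i \<Rightarrow> complex) \<Rightarrow> nat \<times> 'i \<Rightarrow> complex" where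
  "embed j h = (\<lambda>(i, x). if i = j then h x else 0)"

lemma summand_embed: "summand i (embed j h) = (if i = j then h else (\<lambda>_. 0))"
  by (auto simp: summand_def embed_def)

definition sum_op :: "(nat \<Rightarrow> ('i \<Rightarrow> complex) \<Rightarrow> 'i \<Rightarrow> complex) \<Rightarrow>
    (nat \<times> 'i \<Rightarrow> complex) \<Rightarrow> nat \<times> 'i \<Rightarrow> complex" where
  "sum_op T h = (\<lambda>(j, x). T j (summand j h) x)"

lemma summand_sum_op [simp]: "summand j (sum_op T h) = T j (summand j h)"
  by (simp add: summand_def sum_op_def)

locale semi_inner_family =
  fixes S :: "nat \<Rightarrow> ('x, 'i) spectral_triple" and A :: "('x \<Rightarrow> complex) set"
  assumes component: "semi_inner_space (S j)"
begin

abbreviation Sum where "Sum \<equiv> sum_triple A S"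

lemma sum_space_component: "h \<in> sum_space S \<Longrightarrow> summand j h \<in> st_space (S j)"
  by (simp add: sum_space_def)

lemma summable_inner:
  assumes "g \<in> sum_space S" "h \<in> sum_space S"
  shows "summable (\<lambda>j. st_inner (S j) (summand j g) (summand j h))"
proof (rule summable_comparison_test'[where N = 0])
  show "summable (\<lambda>j. (st_norm (S j) (summand j g))\<^sup>2 + (st_norm (S j) (summand j h))\<^sup>2)"
    using assms by (intro summable_add) (simp_all add: sum_space_def)
  fix j
  interpret semi_inner_space "S j" by (rule component)
  have "norm (ip (summand j g) (summand j h)) \<le> nrm (summand j g) * nrm (summand j h)"
    by (intro Cauchy_Schwarz sum_space_component assms)
  also have "\<dots> \<le> (nrm (summand j g))\<^sup>2 + (nrm (summand j h))\<^sup>2"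
    using sum_squares_bound[of "nrm (summand j g)" "nrm (summand j h)"]
      zero_le_power2[of "nrm (summand j g)"] zero_le_power2[of "nrm (summand j h)"] by linarith
  finally show "norm (ip (summand j g) (summand j h)) \<le> (nrm (summand j g))\<^sup>2 + (nrm (summand j h))\<^sup>2" .
qed

lemma norm_sq_sums:
  assumes "h \<in> sum_space S"
  shows "(\<lambda>j. (st_norm (S j) (summand j h))\<^sup>2) sums (st_norm Sum h)\<^sup>2"
proof -
  have eq: "st_inner (S j) (summand j h) (summand j h) = of_real ((st_norm (S j) (summand j h))\<^sup>2)" for j
    using semi_inner_space.inner_self[OF component sum_space_component[OF assms]] .
  have sm: "summable (\<lambda>j. (st_norm (S j) (summand j h))\<^sup>2)" using assms by (simp add: sum_space_def)
  have "st_inner Sum h h = of_real (\<Sum>j. (st_norm (S j) (summand j h))\<^sup>2)"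
    using suminf_of_real[OF sm, where 'a = complex] by (simp add: eq)
  then have "(st_norm Sum h)\<^sup>2 = (\<Sum>j. (st_norm (S j) (summand j h))\<^sup>2)"
    using suminf_nonneg[OF sm] unfolding st_norm_def[of Sum] by simp
  then show ?thesis using summable_sums[OF sm] by simp
qed

sublocale sum: semi_inner_space Sum
proof
  show "(\<lambda>_. 0) \<in> st_space Sum"
    using semi_inner_space.zero_mem[OF component] semi_inner_space.inner_zero_left[OF component]
    by (simp add: sum_space_def st_norm_def)
next
  fix g h :: "nat \<times> 'i \<Rightarrow> complex" assume gh: "g \<in> st_space Sum" "h \<in> st_space Sum"
  have mem: "summand j g \<in> st_space (S j)" "summand j h \<in> st_space (S j)" for j
    using gh by (simp_all add: sum_space_def)
  have "summable (\<lambda>j. (st_norm (S j) (\<lambda>x. summand j g x + summand j h x))\<^sup>2)"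
  proof (rule summable_comparison_test'[where N = 0])
    show "summable (\<lambda>j. 2 * (st_norm (S j) (summand j g))\<^sup>2 + 2 * (st_norm (S j) (summand j h))\<^sup>2)"
      using gh by (intro summable_add summable_mult) (simp_all add: sum_space_def)
  qed (simp add: semi_inner_space.nrm_add_sq_le[OF component] mem)
  then show "(\<lambda>x. g x + h x) \<in> st_space Sum"
    using semi_inner_space.add_mem[OF component mem] by (simp add: sum_space_def)
next
  fix h :: "nat \<times> 'i \<Rightarrow> complex" and c assume h: "h \<in> st_space Sum"
  then have "summable (\<lambda>j. (cmod c)\<^sup>2 * (st_norm (S j) (summand j h))\<^sup>2)"
    by (intro summable_mult) (simp add: sum_space_def)
  then show "(\<lambda>x. c * h x) \<in> st_space Sum"
    using h by (simp add: sum_space_def semi_inner_space.scale_mem[OF component]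
        semi_inner_space.nrm_scale[OF component] power_mult_distrib)
next
  fix g h k :: "nat \<times> 'i \<Rightarrow> complex"
  assume "g \<in> st_space Sum" "h \<in> st_space Sum" "k \<in> st_space Sum"
  then show "st_inner Sum (\<lambda>x. g x + h x) k = st_inner Sum g k + st_inner Sum h k"
    by (simp add: semi_inner_space.inner_add_left[OF component] sum_space_component
        suminf_add summable_inner)
next
  fix h k :: "nat \<times> 'i \<Rightarrow> complex" and c
  assume "h \<in> st_space Sum" "k \<in> st_space Sum"
  then show "st_inner Sum (\<lambda>x. c * h x) k = c * st_inner Sum h k"
    by (simp add: semi_inner_space.inner_scale_left[OF component] sum_space_component
        suminf_mult summable_inner)
next
  fix g h :: "nat \<times> 'i \<Rightarrow> complex"
  assume gh: "g \<in> st_space Sum" "h \<in> st_space Sum"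
  have "(\<lambda>j. st_inner (S j) (summand j g) (summand j h)) sums st_inner Sum g h"
    using summable_inner gh by (simp add: summable_sums)
  then have "(\<lambda>j. cnj (st_inner (S j) (summand j g) (summand j h))) sums cnj (st_inner Sum g h)"
    by (simp only: sums_cnj)
  moreover have "cnj (st_inner (S j) (summand j g) (summand j h)) = st_inner (S j) (summand j h) (summand j g)" for j
    by (rule semi_inner_space.inner_commute[OF component, symmetric]) (use gh in \<open>simp_all add: sum_space_component\<close>)
  ultimately show "st_inner Sum h g = cnj (st_inner Sum g h)"
    by (simp add: sums_iff)
next
  fix h :: "nat \<times> 'i \<Rightarrow> complex" assume h: "h \<in> st_space Sum"
  have "0 \<le> (\<Sum>j. Re (st_inner (S j) (summand j h) (summand j h)))"
    using h by (intro suminf_nonneg summable_Re summable_inner)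
      (auto intro!: semi_inner_space.inner_nonneg[OF component] simp: sum_space_component)
  then show "0 \<le> Re (st_inner Sum h h)"
    using Re_suminf[OF summable_inner[of h h]] h by simp
qed

lemma st_eq_SumI:
  assumes "g \<in> sum_space S" "h \<in> sum_space S" "\<And>j. st_eq (S j) (summand j g) (summand j h)"
  shows "st_eq Sum g h"
proof -
  have "(\<lambda>x. g x - h x) \<in> sum_space S" using sum.diff_mem assms(1,2) by simp
  from norm_sq_sums[OF this] have "(\<lambda>_. 0) sums (st_norm Sum (\<lambda>x. g x - h x))\<^sup>2"
    using assms(3) by (simp add: st_eq_def)
  then show ?thesis by (simp add: st_eq_def sums_iff)
qed

lemma norm_zero_component: "st_norm (S j) (\<lambda>_. 0) = 0"
  using semi_inner_space.inner_zero_left[OF component semi_inner_space.zero_mem[OF component]]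
  by (simp add: st_norm_def)

lemma embed_mem:
  assumes "h \<in> st_space (S j)"
  shows "embed j h \<in> sum_space S"
proof -
  have "summable (\<lambda>i. (st_norm (S i) (summand i (embed j h)))\<^sup>2)"
    by (rule summable_finite[of "{j}"]) (auto simp: summand_embed norm_zero_component)
  then show ?thesis
    using assms semi_inner_space.zero_mem[OF component] by (auto simp: sum_space_def summand_embed)
qed

lemma inner_embed:
  assumes "h \<in> sum_space S" "g \<in> st_space (S j)"
  shows "st_inner Sum h (embed j g) = st_inner (S j) (summand j h) g"
proof -
  have z: "st_inner (S i) (summand i h) (\<lambda>_. 0) = 0" for i
    using semi_inner_space.inner_scale_right[OF component sum_space_component[OF assms(1)]
        semi_inner_space.zero_mem[OF component], of i 0] by simp
  have "(\<Sum>i. st_inner (S i) (summand i h) (summand i (embed j g))) =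
      (\<Sum>i\<in>{j}. st_inner (S i) (summand i h) (summand i (embed j g)))"
    by (rule suminf_finite) (auto simp: summand_embed z)
  then show ?thesis by (simp add: summand_embed)
qed

text \<open>Parseval's identity in each summand and then over the summands is a double sum of
  non-negative terms, which may be enumerated along \<open>prod_decode\<close>.\<close>

lemma onb_Sum:
  assumes b: "\<And>j. st_onb (S j) (b j)"
  shows "st_onb Sum (\<lambda>n. case prod_decode n of (j, k) \<Rightarrow> embed j (b j k))"
  unfolding sum.onb_iff_Parseval
proof (intro conjI ballI)
  have bm: "b j k \<in> st_space (S j)" for j k using b by (simp add: st_onb_def)
  have ortho: "st_inner (S j) (b j k) (b j l) = (if k = l then 1 else 0)" for j k l
    using b[of j] unfolding st_onb_def by blast
  have emb: "st_inner Sum (embed i (b i k)) (embed j (b j l)) = (if (i, k) = (j, l) then 1 else 0)" for i j k l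
    using semi_inner_space.inner_zero_left[OF component bm]
    by (simp add: inner_embed embed_mem bm summand_embed ortho del: sum_triple_sel)
  show "sum.orthonormal (\<lambda>n. case prod_decode n of (j, k) \<Rightarrow> embed j (b j k))"
    unfolding sum.orthonormal_def
  proof (intro conjI allI)
    fix m n
    show "(case prod_decode n of (j, k) \<Rightarrow> embed j (b j k)) \<in> st_space Sum"
      by (simp add: embed_mem bm split: prod.split)
    have "prod_decode m = prod_decode n \<longleftrightarrow> m = n" by (metis prod_decode_inverse)
    then show "st_inner Sum (case prod_decode m of (j, k) \<Rightarrow> embed j (b j k))
        (case prod_decode n of (j, k) \<Rightarrow> embed j (b j k)) = (if m = n then 1 else 0)"
      by (cases "prod_decode m"; cases "prod_decode n") (simp add: emb del: sum_triple_sel)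
  qed
  fix h assume "h \<in> st_space Sum"
  then have h: "h \<in> sum_space S" by simp
  define F where "F = (\<lambda>(j, k). (cmod (st_inner (S j) (summand j h) (b j k)))\<^sup>2)"
  have row: "((\<lambda>k. F (j, k)) has_sum (st_norm (S j) (summand j h))\<^sup>2) UNIV" for j
    using semi_inner_space.Parseval[OF component b sum_space_component[OF h]]
    by (intro sums_nonneg_imp_has_sum) (simp_all add: F_def)
  have col: "((\<lambda>j. (st_norm (S j) (summand j h))\<^sup>2) has_sum (st_norm Sum h)\<^sup>2) UNIV"
    by (intro sums_nonneg_imp_has_sum norm_sq_sums h) simp
  have "F summable_on UNIV \<times> UNIV"
    by (rule summable_on_SigmaI[OF row]) (use col in \<open>auto simp: summable_on_def F_def\<close>)
  then have "(F has_sum (st_norm Sum h)\<^sup>2) (UNIV \<times> UNIV)"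
    by (intro has_sum_SigmaI[OF row col])
  then have "((\<lambda>n. F (prod_decode n)) has_sum (st_norm Sum h)\<^sup>2) UNIV"
    using has_sum_reindex_bij_betw[OF bij_prod_decode, of F] by simp
  then have "(\<lambda>n. F (prod_decode n)) sums (st_norm Sum h)\<^sup>2" by (rule has_sum_imp_sums)
  moreover have "F (prod_decode n) =
      (cmod (st_inner Sum h (case prod_decode n of (j, k) \<Rightarrow> embed j (b j k))))\<^sup>2" for n
    by (simp add: F_def inner_embed h bm del: sum_triple_sel split: prod.split)
  ultimately show "(\<lambda>n. (cmod (st_inner Sum h (case prod_decode n of (j, k) \<Rightarrow> embed j (b j k))))\<^sup>2)
      sums (st_norm Sum h)\<^sup>2" by simp
qed

text \<open>One constant C must serve all summands: boundedness of the single operators would not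
  keep the image square summable.\<close>

lemma sum_op_mem:
  assumes T: "\<And>j. st_bounded_linear (S j) (T j)"
    and C: "\<And>j h. h \<in> st_space (S j) \<Longrightarrow> st_norm (S j) (T j h) \<le> C * st_norm (S j) h"
    and h: "h \<in> sum_space S"
  shows "sum_op T h \<in> sum_space S"
    and "(st_norm Sum (sum_op T h))\<^sup>2 \<le> C\<^sup>2 * (st_norm Sum h)\<^sup>2"
proof -
  have Tm: "T j (summand j h) \<in> st_space (S j)" for j
    using T sum_space_component[OF h] by (simp add: st_bounded_linear_def)
  have le: "(st_norm (S j) (T j (summand j h)))\<^sup>2 \<le> C\<^sup>2 * (st_norm (S j) (summand j h))\<^sup>2" for j
    unfolding power_mult_distrib[symmetric]
    by (intro power_mono C sum_space_component h semi_inner_space.nrm_nonneg[OF component] Tm)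
  have sm: "(\<lambda>j. C\<^sup>2 * (st_norm (S j) (summand j h))\<^sup>2) sums (C\<^sup>2 * (st_norm Sum h)\<^sup>2)"
    by (intro sums_mult norm_sq_sums h)
  then have "summable (\<lambda>j. (st_norm (S j) (T j (summand j h)))\<^sup>2)"
    using le by (intro summable_comparison_test'[OF sums_summable[OF sm]]) simp
  then show mem: "sum_op T h \<in> sum_space S" by (simp add: sum_space_def Tm)
  show "(st_norm Sum (sum_op T h))\<^sup>2 \<le> C\<^sup>2 * (st_norm Sum h)\<^sup>2"
    using norm_sq_sums[OF mem] le by (intro sums_le[OF _ _ sm]) auto
qed

lemma st_bounded_linear_sum_op:
  assumes T: "\<And>j. st_bounded_linear (S j) (T j)"
    and C: "\<And>j h. h \<in> st_space (S j) \<Longrightarrow> st_norm (S j) (T j h) \<le> C * st_norm (S j) h"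
  shows "st_bounded_linear Sum (sum_op T)"
  unfolding st_bounded_linear_def
proof (intro conjI ballI allI exI)
  note mem = sum_op_mem(1)[OF T C]
  fix h assume h: "h \<in> st_space Sum"
  then show "sum_op T h \<in> st_space Sum" using mem by simp
  {
    fix g assume g: "g \<in> st_space Sum"
    have "(\<lambda>x. g x + h x) \<in> sum_space S" "(\<lambda>x. sum_op T g x + sum_op T h x) \<in> sum_space S"
      using sum.add_mem g h mem by simp_all
    then show "st_eq Sum (sum_op T (\<lambda>x. g x + h x)) (\<lambda>x. sum_op T g x + sum_op T h x)"
      using T g h sum_space_component
      by (intro st_eq_SumI mem) (simp_all add: st_bounded_linear_def)
  }
  {
    fix c :: complex
    have "(\<lambda>x. c * h x) \<in> sum_space S" "(\<lambda>x. c * sum_op T h x) \<in> sum_space S"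
      using sum.scale_mem h mem by simp_all
    then show "st_eq Sum (sum_op T (\<lambda>x. c * h x)) (\<lambda>x. c * sum_op T h x)"
      using T h sum_space_component
      by (intro st_eq_SumI mem) (simp_all add: st_bounded_linear_def)
  }
  have "(st_norm Sum (sum_op T h))\<^sup>2 \<le> (\<bar>C\<bar> * st_norm Sum h)\<^sup>2"
    using sum_op_mem(2)[OF T C, of h] h by (simp add: power_mult_distrib)
  then show "st_norm Sum (sum_op T h) \<le> \<bar>C\<bar> * st_norm Sum h"
    by (rule power2_le_imp_le) (use sum.nrm_nonneg h in simp)
qed

lemma sum_op_embed:
  assumes T: "\<And>j. st_bounded_linear (S j) (T j)"
    and C: "\<And>j h. h \<in> st_space (S j) \<Longrightarrow> st_norm (S j) (T j h) \<le> C * st_norm (S j) h"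
    and h: "h \<in> st_space (S j)" and eig: "st_eq (S j) (T j h) (\<lambda>x. c * h x)"
  shows "st_eq Sum (sum_op T (embed j h)) (\<lambda>x. c * embed j h x)"
proof (rule st_eq_SumI)
  show "sum_op T (embed j h) \<in> sum_space S" by (rule sum_op_mem(1)[OF T C embed_mem[OF h]])
  show "(\<lambda>x. c * embed j h x) \<in> sum_space S" using sum.scale_mem embed_mem[OF h] by simp
  fix i
  have z: "(\<lambda>_. 0) \<in> st_space (S i)" by (rule semi_inner_space.zero_mem[OF component])
  then have "T i (\<lambda>_. 0) \<in> st_space (S i)" using T by (simp add: st_bounded_linear_def)
  \<comment> \<open>Linearity holds only modulo null vectors, so \<open>T i\<close> may send the
    zero function to another null vector; the norm bound shows that this does no harm.\<close>
  then have "st_norm (S i) (T i (\<lambda>_. 0)) = 0"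
    using C[OF z] semi_inner_space.nrm_nonneg[OF component, of "T i (\<lambda>_. 0)" i]
    by (simp add: norm_zero_component)
  then show "st_eq (S i) (summand i (sum_op T (embed j h))) (summand i (\<lambda>x. c * embed j h x))"
    using eig by (auto simp: summand_embed st_eq_def)
qed

lemma embed_dirac:
  assumes "h \<in> st_space (S j)" "g \<in> st_space (S j)" "(h, g) \<in> st_dirac (S j)"
    "\<And>i. ((\<lambda>_. 0), (\<lambda>_. 0)) \<in> st_dirac (S i)"
  shows "(embed j h, embed j g) \<in> st_dirac Sum"
  using assms by (simp add: embed_mem summand_embed)

end

section \<open>The $L^2$ space of a curve\<close>

lemma curve_triple_sel [simp]:
  "st_space (curve_triple X l R) = L2_space l"
  "st_inner (curve_triple X l R) = L2_inner l"
  "st_norm (curve_triple X l R) = L2_norm l"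
  "st_dirac (curve_triple X l R) = D_curve l"
  by (simp_all add: curve_triple_def st_norm_def[abs_def] L2_norm_def[abs_def])

lemma space_L2_measure [simp]: "space (L2_measure l) = {-l..l}"
  by (simp add: L2_measure_def)

lemma measurable_L2_measure: "borel_measurable (L2_measure l) = borel_measurable (lebesgue_on {-l..l})"
  by (simp add: L2_measure_def measurable_def)

lemma emeasure_L2_measure:
  assumes "0 < l"
  shows "emeasure (L2_measure l) {-l..l} = 1"
proof -
  have "emeasure (L2_measure l) {-l..l} = (\<integral>\<^sup>+x. ennreal (1 / (2 * l)) * indicator {-l..l} x \<partial>lebesgue_on {-l..l})"
    unfolding L2_measure_def by (intro emeasure_density) (auto simp: sets_restrict_space)
  also have "\<dots> = ennreal (1 / (2 * l)) * emeasure (lebesgue_on {-l..l}) {-l..l}"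
    by (intro nn_integral_cmult_indicator) (auto simp: sets_restrict_space)
  also have "\<dots> = ennreal (1 / (2 * l)) * ennreal (2 * l)"
    using assms by (simp add: emeasure_restrict_space)
  also have "\<dots> = 1" using assms by (simp flip: ennreal_mult)
  finally show ?thesis .
qed

lemma finite_measure_L2: "0 < l \<Longrightarrow> finite_measure (L2_measure l)"
  by (rule finite_measureI) (simp add: emeasure_L2_measure)

lemma measure_L2: "0 < l \<Longrightarrow> measure (L2_measure l) {-l..l} = 1"
  by (simp add: measure_def emeasure_L2_measure)

lemma integrable_bounded_L2:
  fixes f :: "real \<Rightarrow> 'b::{banach, second_countable_topology}"
  assumes "0 < l" "f \<in> borel_measurable (L2_measure l)" "\<And>x. x \<in> {-l..l} \<Longrightarrow> norm (f x) \<le> B"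
  shows "integrable (L2_measure l) f"
  using assms(2,3) by (intro finite_measure.integrable_const_bound[OF finite_measure_L2[OF assms(1)], of _ B])
    (auto intro!: AE_I2)

lemma continuous_measurable_L2:
  fixes f :: "real \<Rightarrow> 'b::topological_space"
  assumes "continuous_on UNIV f"
  shows "f \<in> borel_measurable (L2_measure l)"
  unfolding measurable_L2_measure
  by (intro continuous_imp_measurable_on_sets_lebesgue continuous_on_subset[OF assms]) auto

lemma L2_space_integrable:
  assumes "g \<in> L2_space l" "h \<in> L2_space l"
  shows "integrable (L2_measure l) (\<lambda>x. g x * cnj (h x))"
proof (rule Bochner_Integration.integrable_bound)
  show "integrable (L2_measure l) (\<lambda>x. (cmod (g x))\<^sup>2 + (cmod (h x))\<^sup>2)"
    using assms by (simp add: L2_space_def)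
  have [measurable]: "g \<in> borel_measurable (L2_measure l)" "h \<in> borel_measurable (L2_measure l)"
    using assms by (simp_all add: L2_space_def)
  have [measurable]: "(\<lambda>x. cnj (h x)) \<in> borel_measurable (L2_measure l)"
    by (rule measurable_compose[OF _ borel_measurable_continuous_onI]) (auto intro: continuous_intros)
  show "(\<lambda>x. g x * cnj (h x)) \<in> borel_measurable (L2_measure l)" by measurable
  show "AE x in L2_measure l. norm (g x * cnj (h x)) \<le> norm ((cmod (g x))\<^sup>2 + (cmod (h x))\<^sup>2)"
  proof (intro AE_I2)
    fix x
    show "norm (g x * cnj (h x)) \<le> norm ((cmod (g x))\<^sup>2 + (cmod (h x))\<^sup>2)"
      using sum_squares_bound[of "cmod (g x)" "cmod (h x)"]
        mult_nonneg_nonneg[OF norm_ge_zero[of "g x"] norm_ge_zero[of "h x"]]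
      unfolding norm_mult complex_mod_cnj real_norm_def by linarith
  qed
qed

lemma L2_spaceI:
  assumes "f \<in> borel_measurable (L2_measure l)" "w \<in> borel_measurable (L2_measure l)"
    "integrable (L2_measure l) w" "\<And>x. x \<in> {-l..l} \<Longrightarrow> (cmod (f x))\<^sup>2 \<le> w x"
  shows "f \<in> L2_space l"
proof -
  note assms(1)[measurable]
  have "(\<lambda>x. (cmod (f x))\<^sup>2) \<in> borel_measurable (L2_measure l)" by measurable
  then have "integrable (L2_measure l) (\<lambda>x. (cmod (f x))\<^sup>2)"
    by (rule Bochner_Integration.integrable_bound[OF assms(3)])
       (auto intro!: AE_I2 order_trans[OF assms(4) abs_ge_self])
  then show ?thesis using assms(1) by (simp add: L2_space_def)
qed

lemma cmod_add_sq_le: "(cmod (a + b))\<^sup>2 \<le> 2 * (cmod a)\<^sup>2 + 2 * (cmod b)\<^sup>2"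
proof -
  have "(cmod (a + b))\<^sup>2 \<le> (cmod a + cmod b)\<^sup>2" by (intro power_mono norm_triangle_ineq) simp
  also have "\<dots> \<le> 2 * (cmod a)\<^sup>2 + 2 * (cmod b)\<^sup>2"
    using sum_squares_bound[of "cmod a" "cmod b"] by (simp add: power2_sum)
  finally show ?thesis .
qed

lemma L2_inner_self: "L2_inner l h h = of_real (LINT x|L2_measure l. (cmod (h x))\<^sup>2)"
  unfolding L2_inner_def complex_norm_square[symmetric] by (rule integral_complex_of_real)

lemma L2_norm_eq: "L2_norm l h = sqrt (LINT x|L2_measure l. (cmod (h x))\<^sup>2)"
  by (simp add: L2_norm_def L2_inner_self)

lemma L2_norm_sq: "(L2_norm l h)\<^sup>2 = (LINT x|L2_measure l. (cmod (h x))\<^sup>2)"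
  by (simp add: L2_norm_eq)

lemma L2_norm_minus_commute: "L2_norm l (\<lambda>x. g x - h x) = L2_norm l (\<lambda>x. h x - g x)"
  by (simp add: L2_norm_eq norm_minus_commute)

lemma semi_inner_space_curve: "semi_inner_space (curve_triple X l R)"
proof (unfold_locales, unfold curve_triple_sel)
  show "(\<lambda>_. 0) \<in> L2_space l" by (simp add: L2_space_def)
next
  fix g h assume gh: "g \<in> L2_space l" "h \<in> L2_space l"
  then have [measurable]: "g \<in> borel_measurable (L2_measure l)" "h \<in> borel_measurable (L2_measure l)"
    by (simp_all add: L2_space_def)
  show "(\<lambda>x. g x + h x) \<in> L2_space l"
    by (rule L2_spaceI[of _ _ "\<lambda>x. 2 * (cmod (g x))\<^sup>2 + 2 * (cmod (h x))\<^sup>2"])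
       (use gh in \<open>simp_all add: L2_space_def cmod_add_sq_le\<close>)
  show "L2_inner l h g = cnj (L2_inner l g h)"
    unfolding L2_inner_def Bochner_Integration.integral_cnj[symmetric] by (simp add: mult.commute)
next
  fix h and c :: complex assume h: "h \<in> L2_space l"
  then have "(\<lambda>x. c * h x) \<in> borel_measurable (L2_measure l)"
    by (intro borel_measurable_times borel_measurable_const) (simp add: L2_space_def)
  then show "(\<lambda>x. c * h x) \<in> L2_space l"
    using h by (simp add: L2_space_def norm_mult power_mult_distrib)
next
  fix g h k assume "g \<in> L2_space l" "h \<in> L2_space l" "k \<in> L2_space l"
  then show "L2_inner l (\<lambda>x. g x + h x) k = L2_inner l g k + L2_inner l h k"
    unfolding L2_inner_def by (simp add: distrib_right L2_space_integrable)
next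
  fix h k and c :: complex assume "h \<in> L2_space l" "k \<in> L2_space l"
  show "L2_inner l (\<lambda>x. c * h x) k = c * L2_inner l h k"
    unfolding L2_inner_def by (simp add: mult.assoc)
next
  fix h assume "h \<in> L2_space l"
  show "0 \<le> Re (L2_inner l h h)"
    by (simp add: L2_inner_self)
qed

text \<open>The measure has total mass 1, so the L2 norm is at most the supremum on the
  interval.\<close>

lemma L2_bounded:
  assumes "0 < l" "f \<in> borel_measurable (L2_measure l)" "\<And>x. x \<in> {-l..l} \<Longrightarrow> cmod (f x) \<le> B"
  shows "f \<in> L2_space l" "L2_norm l f \<le> B"
proof -
  note assms(2)[measurable]
  have B: "0 \<le> B" using assms(3)[of 0] assms(1) norm_ge_zero[of "f 0"] by (simp del: norm_ge_zero)
  have sq: "(cmod (f x))\<^sup>2 \<le> B\<^sup>2" if "x \<in> {-l..l}" for x using assms(3)[OF that] by (simp add: power_mono)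
  have int: "integrable (L2_measure l) (\<lambda>x. (cmod (f x))\<^sup>2)"
    by (rule integrable_bounded_L2[OF assms(1), of _ "B\<^sup>2"]) (use sq in auto)
  then show "f \<in> L2_space l" using assms(2) by (simp add: L2_space_def)
  have "(L2_norm l f)\<^sup>2 \<le> (LINT x|L2_measure l. B\<^sup>2)"
    unfolding L2_norm_sq
    by (rule integral_mono[OF int finite_measure.integrable_const[OF finite_measure_L2[OF assms(1)]]])
       (use sq in simp)
  also have "\<dots> = B\<^sup>2" using assms(1) by (simp add: measure_L2)
  finally show "L2_norm l f \<le> B" using B by (rule power2_le_imp_le)
qed

lemma L2_dominated:
  assumes "0 < l" "\<And>n. f n \<in> borel_measurable (L2_measure l)" "h \<in> borel_measurable (L2_measure l)"
    "integrable (L2_measure l) w" "\<And>n x. x \<in> {-l..l} \<Longrightarrow> (cmod (f n x - h x))\<^sup>2 \<le> w x"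
    "AE x in L2_measure l. (\<lambda>n. f n x) \<longlonglongrightarrow> h x"
  shows "(\<lambda>n. L2_norm l (\<lambda>x. f n x - h x)) \<longlonglongrightarrow> 0"
proof -
  note assms(2)[measurable] assms(3)[measurable]
  have "(\<lambda>n. LINT x|L2_measure l. (cmod (f n x - h x))\<^sup>2) \<longlonglongrightarrow> (LINT x|L2_measure l. (0::real))"
  proof (rule integral_dominated_convergence[OF _ _ assms(4)])
    show "AE x in L2_measure l. (\<lambda>n. (cmod (f n x - h x))\<^sup>2) \<longlonglongrightarrow> 0"
      using assms(6)
    proof eventually_elim
      case (elim x)
      then have "(\<lambda>n. (cmod (f n x - h x))\<^sup>2) \<longlonglongrightarrow> (cmod (h x - h x))\<^sup>2" by (intro tendsto_intros)
      then show ?case by simp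
    qed
  qed (auto intro!: AE_I2 assms(5))
  then show ?thesis
    unfolding L2_norm_eq using tendsto_real_sqrt by fastforce
qed

section \<open>Trigonometric polynomials\<close>

definition fourier :: "real \<Rightarrow> int \<Rightarrow> real \<Rightarrow> complex" where
  "fourier l k x = exp (\<i> * of_real (pi * of_int k * x / l))"

lemma norm_fourier [simp]: "cmod (fourier l k x) = 1"
  by (simp add: fourier_def)

lemma fourier_mult: "fourier l j x * fourier l k x = fourier l (j + k) x"
  by (simp add: fourier_def exp_add[symmetric] add_divide_distrib[symmetric] algebra_simps)

lemma cnj_fourier: "cnj (fourier l k x) = fourier l (- k) x"
  by (simp add: fourier_def exp_cnj)

lemma fourier_0: "fourier l 0 x = 1"
  by (simp add: fourier_def)

lemma continuous_on_fourier: "continuous_on S (fourier l k)"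
  unfolding fourier_def[abs_def] divide_inverse by (intro continuous_intros)

lemma trig_polys_eq: "trig_polys l = {(\<lambda>x. \<Sum>k\<in>K. c k * fourier l k x) | c K. finite K}"
  by (simp add: trig_polys_def fourier_def)

lemma trig_polys_scale_fourier: "(\<lambda>x. c * fourier l k x) \<in> trig_polys l"
  unfolding trig_polys_eq by (rule CollectI, rule exI[of _ "\<lambda>_. c"], rule exI[of _ "{k}"]) simp

lemma trig_polys_add:
  assumes "u \<in> trig_polys l" "v \<in> trig_polys l"
  shows "(\<lambda>x. u x + v x) \<in> trig_polys l"
proof -
  obtain c K where u: "finite K" "u = (\<lambda>x. \<Sum>k\<in>K. c k * fourier l k x)"
    using assms(1) unfolding trig_polys_eq by blast
  obtain d J where v: "finite J" "v = (\<lambda>x. \<Sum>k\<in>J. d k * fourier l k x)"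
    using assms(2) unfolding trig_polys_eq by blast
  define a where "a k = (if k \<in> K then c k else 0) + (if k \<in> J then d k else 0)" for k
  have "u x + v x = (\<Sum>k\<in>K \<union> J. a k * fourier l k x)" for x
  proof -
    have "u x = (\<Sum>k\<in>K \<union> J. (if k \<in> K then c k else 0) * fourier l k x)"
      unfolding u(2) using u(1) v(1) by (intro sum.mono_neutral_cong_left) auto
    moreover have "v x = (\<Sum>k\<in>K \<union> J. (if k \<in> J then d k else 0) * fourier l k x)"
      unfolding v(2) using u(1) v(1) by (intro sum.mono_neutral_cong_left) auto
    ultimately show ?thesis by (simp only: a_def distrib_right sum.distrib)
  qed
  then show ?thesis unfolding trig_polys_eq using u(1) v(1)
    by (intro CollectI exI[of _ a] exI[of _ "K \<union> J"]) auto
qed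

lemma trig_polys_zero: "(\<lambda>_. 0) \<in> trig_polys l"
  using trig_polys_scale_fourier[of 0 l 0] by simp

lemma trig_polys_sum:
  assumes "\<And>i. i \<in> I \<Longrightarrow> f i \<in> trig_polys l"
  shows "(\<lambda>x. \<Sum>i\<in>I. f i x) \<in> trig_polys l"
  using assms by (induction I rule: infinite_finite_induct) (simp_all add: trig_polys_zero trig_polys_add)

lemma trig_polys_mult:
  assumes "u \<in> trig_polys l" "v \<in> trig_polys l"
  shows "(\<lambda>x. u x * v x) \<in> trig_polys l"
proof -
  obtain c K where u: "finite K" "u = (\<lambda>x. \<Sum>k\<in>K. c k * fourier l k x)"
    using assms(1) unfolding trig_polys_eq by blast
  obtain d J where v: "finite J" "v = (\<lambda>x. \<Sum>k\<in>J. d k * fourier l k x)"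
    using assms(2) unfolding trig_polys_eq by blast
  have "u x * v x = (\<Sum>k\<in>K. \<Sum>j\<in>J. (c k * d j) * fourier l (k + j) x)" for x
    unfolding u(2) v(2) sum_product by (simp add: fourier_mult[symmetric] mult_ac)
  then show ?thesis
    by (simp only:) (intro trig_polys_sum trig_polys_scale_fourier)
qed

lemma continuous_on_trig_poly:
  assumes "u \<in> trig_polys l"
  shows "continuous_on S u"
  using assms unfolding trig_polys_eq by (auto intro!: continuous_intros continuous_on_fourier)

text \<open>Connects the real version of the Stone-Weierstrass theorem on the unit circle with
  trigonometric polynomials.\<close>

lemma trig_polys_real_polynomial:
  fixes p :: "complex \<Rightarrow> real"
  assumes "real_polynomial_function p"
  shows "(\<lambda>x. of_real (p (fourier l 1 x))) \<in> trig_polys l"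
  using assms
proof (induction p rule: real_polynomial_function.induct)
  case (linear p)
  \<comment> \<open>A real linear p is \<open>Re z * p 1 + Im z * p i\<close>, with i the imaginary
    unit; the coefficients come from writing Re and Im through z and its conjugate.\<close>
  have "of_real (p (fourier l 1 x)) = (p 1 / 2 - \<i> * p \<i> / 2) * fourier l 1 x +
      (p 1 / 2 + \<i> * p \<i> / 2) * fourier l (-1) x" for x
  proof -
    let ?z = "fourier l 1 x"
    have "p ?z = p (Re ?z *\<^sub>R 1 + Im ?z *\<^sub>R \<i>)"
      by (rule arg_cong[of _ _ p]) (simp add: complex_eq_iff)
    also have "\<dots> = Re ?z * p 1 + Im ?z * p \<i>"
      using linear by (simp add: linear_simps)
    finally have "p ?z = Re ?z * p 1 + Im ?z * p \<i>" .
    then show ?thesis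
      unfolding cnj_fourier[of l 1 x, symmetric] by (simp add: complex_eq_iff field_simps)
  qed
  then show ?case by (simp only:) (intro trig_polys_add trig_polys_scale_fourier)
next
  case (const c)
  show ?case using trig_polys_scale_fourier[of "of_real c" l 0] by (simp add: fourier_0)
next
  case (add p q)
  then show ?case using trig_polys_add by simp
next
  case (mult p q)
  then show ?case using trig_polys_mult by simp
qed

section \<open>Density of the trigonometric polynomials\<close>

lemma Arg_fourier:
  assumes "0 < l" "- l < x" "x \<le> l"
  shows "Arg (fourier l 1 x) = pi * x / l"
proof -
  have "pi * (- l) < pi * x" "pi * x \<le> pi * l" using assms by (auto simp only: mult_less_cancel_left_pos mult_le_cancel_left_pos pi_gt_zero)
  then have "- pi < pi * x / l" "pi * x / l \<le> pi" using assms(1) by (simp_all add: field_simps)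
  then show ?thesis
    unfolding fourier_def by (subst Arg_exp) simp_all
qed

lemma fourier_neg_end: "0 < l \<Longrightarrow> fourier l 1 (- l) = fourier l 1 l"
  by (simp add: fourier_def exp_minus)

text \<open>\<open>Arg\<close> jumps at -1, the image of both end points. There the function is
  squeezed: its modulus is at most \<open>G\<close>, which depends on
  \<open>|Arg z| = arccos (Re z)\<close> only, is continuous on the circle, and vanishes at -1
  because f vanishes at both ends.\<close>

lemma continuous_on_circle:
  fixes f :: "real \<Rightarrow> complex"
  assumes l: "0 < l" and f: "continuous_on UNIV f" and f0: "f (- l) = 0" "f l = 0"
  shows "continuous_on (sphere 0 1) (\<lambda>z. f (l * Arg z / pi))"
  unfolding continuous_on_eq_continuous_within
proof
  fix z :: complex assume z: "z \<in> sphere 0 1"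
  show "continuous (at z within sphere 0 1) (\<lambda>z. f (l * Arg z / pi))"
  proof (cases "z = -1")
    case False
    have "z \<notin> \<real>\<^sub>\<le>\<^sub>0"
    proof
      assume "z \<in> \<real>\<^sub>\<le>\<^sub>0"
      then obtain r where "z = of_real r" "r \<le> 0" by (auto simp: nonpos_Reals_def)
      then show False using z False by auto
    qed
    then have "continuous (at z within sphere 0 1) Arg"
      by (rule continuous_at_imp_continuous_at_within[OF continuous_at_Arg])
    then have "continuous (at z within sphere 0 1) (\<lambda>z. l * Arg z * (1 / pi))"
      by (intro continuous_mult continuous_const)
    then have "continuous (at z within sphere 0 1) (\<lambda>z. l * Arg z / pi)"
      by simp
    moreover have "isCont f (l * Arg z / pi)" using f by (simp add: continuous_on_eq_continuous_at)
    ultimately show ?thesis by (rule continuous_within_compose3[rotated])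
  next
    case True
    define a where "a x = cmod (f x) + cmod (f (- x))" for x
    define G where "G z = a (l * arccos (Re z) / pi)" for z
    have a: "continuous_on UNIV a" unfolding a_def
      by (intro continuous_intros f continuous_on_compose2[OF f]) auto
    have Re: "Re w \<in> {-1..1}" if "w \<in> sphere 0 1" for w
      using that abs_Re_le_cmod[of w] by auto
    have "continuous_on (sphere 0 1) (\<lambda>z. l * arccos (Re z) / pi)"
      by (intro continuous_intros continuous_on_compose2[OF continuous_on_arccos'] image_subsetI Re) auto
    then have "continuous_on (sphere 0 1) G" unfolding G_def
      by (rule continuous_on_compose2[OF a]) simp
    then have "(G \<longlongrightarrow> G z) (at z within sphere 0 1)" using z by (simp add: continuous_on_def)
    moreover have "G z = 0" using True f0 by (simp add: G_def a_def)
    ultimately have G: "(G \<longlongrightarrow> 0) (at z within sphere 0 1)" by simp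
    have bound: "cmod (f (l * Arg w / pi)) \<le> G w" if w: "w \<in> sphere 0 1" for w
    proof -
      have "w \<noteq> 0" using w by auto
      then have "w = exp (\<i> * of_real (Arg w))" using Arg_eq[of w] w by simp
      then have "Re w = Re (exp (\<i> * of_real (Arg w)))" by (rule arg_cong)
      also have "\<dots> = cos (Arg w)" by (simp add: Re_exp)
      finally have "Re w = cos (Arg w)" .
      then have "arccos (Re w) = \<bar>Arg w\<bar>"
        using Arg_le_pi[of w] mpi_less_Arg[of w] by (cases "0 \<le> Arg w") (simp_all add: arccos_cos arccos_cos2)
      then show ?thesis unfolding G_def a_def by (cases "0 \<le> Arg w") simp_all
    qed
    have "((\<lambda>z. f (l * Arg z / pi)) \<longlongrightarrow> 0) (at z within sphere 0 1)"
      by (rule Lim_null_comparison[OF _ G]) (auto simp: eventually_at_filter intro!: always_eventually bound)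
    moreover have "f (l * Arg z / pi) = 0"
      using True f0 Arg_of_real[of "-1"] by simp
    ultimately show ?thesis by (simp add: continuous_within)
  qed
qed

lemma trig_polys_uniform_approx:
  fixes f :: "real \<Rightarrow> complex"
  assumes l: "0 < l" and f: "continuous_on UNIV f" and f0: "f (- l) = 0" "f l = 0" and e: "0 < e"
  obtains u where "u \<in> trig_polys l" "\<And>x. x \<in> {-l..l} \<Longrightarrow> cmod (f x - u x) \<le> e"
proof -
  define F where "F z = f (l * Arg z / pi)" for z
  have F: "continuous_on (sphere 0 1) F" unfolding F_def by (rule continuous_on_circle[OF l f f0])
  obtain p where p: "real_polynomial_function p" "\<And>z. z \<in> sphere 0 1 \<Longrightarrow> \<bar>Re (F z) - p z\<bar> < e/2"
    using Stone_Weierstrass_real_polynomial_function[of "sphere 0 1" "\<lambda>z. Re (F z)" "e/2"] F e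
    by (auto intro: continuous_on_Re)
  obtain q where q: "real_polynomial_function q" "\<And>z. z \<in> sphere 0 1 \<Longrightarrow> \<bar>Im (F z) - q z\<bar> < e/2"
    using Stone_Weierstrass_real_polynomial_function[of "sphere 0 1" "\<lambda>z. Im (F z)" "e/2"] F e
    by (auto intro: continuous_on_Im)
  define u where "u x = of_real (p (fourier l 1 x)) + \<i> * of_real (q (fourier l 1 x))" for x
  have "(\<lambda>x. \<i> * of_real (q (fourier l 1 x))) \<in> trig_polys l"
    using trig_polys_mult[OF trig_polys_scale_fourier[of \<i> l 0] trig_polys_real_polynomial[OF q(1)]]
    by (simp add: fourier_0)
  then have "u \<in> trig_polys l" unfolding u_def
    by (intro trig_polys_add trig_polys_real_polynomial p(1))
  moreover have "cmod (f x - u x) \<le> e" if x: "x \<in> {-l..l}" for x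
  proof -
    have "F (fourier l 1 y) = f y" if "- l < y" "y \<le> l" for y
      using that l by (simp add: F_def Arg_fourier[OF l])
    moreover have "F (fourier l 1 (- l)) = f (- l)"
      using calculation[of l] l f0 by (simp add: fourier_neg_end)
    ultimately have Fx: "F (fourier l 1 x) = f x" using x by (cases "x = - l") auto
    have "\<bar>Re (f x - u x)\<bar> \<le> e/2" "\<bar>Im (f x - u x)\<bar> \<le> e/2"
      using p(2)[of "fourier l 1 x"] q(2)[of "fourier l 1 x"] by (simp_all add: Fx u_def)
    then show ?thesis using cmod_le[of "f x - u x"] by linarith
  qed
  ultimately show thesis by (rule that)
qed

text \<open>The parallelogram bound loses nothing when both parts are measured against e/2, since
  \<open>2 * (e/2)^2 + 2 * (e/2)^2 = e^2\<close>.\<close>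

lemma L2_norm_triangle_half:
  assumes "g \<in> L2_space l" "h \<in> L2_space l" "k \<in> L2_space l" "0 < e"
    "L2_norm l (\<lambda>x. g x - h x) < e/2" "L2_norm l (\<lambda>x. h x - k x) \<le> e/2"
  shows "L2_norm l (\<lambda>x. g x - k x) < e"
proof -
  interpret semi_inner_space "curve_triple (UNIV :: real set) l id" by (rule semi_inner_space_curve)
  let ?a = "L2_norm l (\<lambda>x. g x - h x)" and ?b = "L2_norm l (\<lambda>x. h x - k x)"
  have m: "(\<lambda>x. g x - h x) \<in> L2_space l" "(\<lambda>x. h x - k x) \<in> L2_space l"
    by (rule diff_mem[unfolded curve_triple_sel], rule assms, rule assms)+
  have "(L2_norm l (\<lambda>x. g x - k x))\<^sup>2 \<le> 2 * ?a\<^sup>2 + 2 * ?b\<^sup>2"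
    using nrm_add_sq_le[of "\<lambda>x. g x - h x" "\<lambda>x. h x - k x"] m by simp
  also have "\<dots> < 2 * (e/2)\<^sup>2 + 2 * (e/2)\<^sup>2"
  proof -
    have "?a\<^sup>2 < (e/2)\<^sup>2" using assms(5) by (intro power_strict_mono) (auto simp: L2_norm_eq)
    moreover have "?b\<^sup>2 \<le> (e/2)\<^sup>2" using assms(6) by (intro power_mono) (auto simp: L2_norm_eq)
    ultimately show ?thesis by linarith
  qed
  also have "\<dots> = e\<^sup>2" by (simp add: power2_eq_square)
  finally show ?thesis
    by (rule power_less_imp_less_base) (use assms(4) in simp)
qed

lemma AE_L2_measure:
  assumes "negligible N" "\<And>x. x \<in> {-l..l} \<Longrightarrow> x \<notin> N \<Longrightarrow> P x"
  shows "AE x in L2_measure l. P x"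
proof -
  have "N \<in> null_sets lebesgue" using assms(1) by (simp add: negligible_iff_null_sets)
  then have "AE x in lebesgue. x \<in> {-l..l} \<longrightarrow> P x"
    by (rule AE_I') (use assms(2) in auto)
  then have "AE x in lebesgue_on {-l..l}. P x"
    by (subst AE_restrict_space_iff) auto
  then show ?thesis unfolding L2_measure_def by (subst AE_density) auto
qed

lemma trig_polys_in_L2:
  assumes "0 < l" "u \<in> trig_polys l"
  shows "u \<in> L2_space l"
proof -
  have "compact (u ` {-l..l})"
    by (intro compact_continuous_image continuous_on_trig_poly[OF assms(2)] compact_Icc)
  then obtain B where "\<And>x. x \<in> {-l..l} \<Longrightarrow> cmod (u x) \<le> B"
    using compact_imp_bounded bounded_iff by (metis (no_types, lifting) imageI)
  then show ?thesis
    by (rule L2_bounded(1)[OF assms(1) continuous_measurable_L2[OF continuous_on_trig_poly[OF assms(2)]]])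
qed

lemma trig_polys_dense_bounded:
  assumes l: "0 < l" and h: "h \<in> borel_measurable (L2_measure l)"
    and B: "0 < B" "\<And>x. x \<in> {-l..l} \<Longrightarrow> cmod (h x) \<le> B" and e: "0 < e"
  obtains u where "u \<in> trig_polys l" "L2_norm l (\<lambda>x. h x - u x) < e"
proof -
  \<comment> \<open>This notion of measurability provides continuous functions on the line that
    converge to h outside a negligible set.\<close>
  have "h measurable_on {-l..l}"
    using h by (simp add: measurable_on_iff_borel_measurable measurable_L2_measure)
  then obtain N g where N: "negligible N" and g: "\<And>n. continuous_on UNIV (g n)"
    and lim: "\<And>x. x \<notin> N \<Longrightarrow> (\<lambda>n. g n x) \<longlonglongrightarrow> (if x \<in> {-l..l} then h x else 0)"
    unfolding measurable_on_def by blast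
  \<comment> \<open>\<open>\<rho>\<close> retracts radially onto the disc of radius B, giving a
    bound for dominated convergence; the cutoff \<open>\<psi> n\<close> vanishes at both end points,
    as needed to pass to the circle.\<close>
  define \<rho> :: "complex \<Rightarrow> complex" where "\<rho> z = (1 / max 1 (cmod z / B)) *\<^sub>R z" for z
  have \<rho>_cont: "continuous_on UNIV \<rho>" unfolding \<rho>_def using B(1) by (intro continuous_intros) (auto simp: max_def)
  have \<rho>_le: "cmod (\<rho> z) \<le> B" for z using B(1) by (auto simp: \<rho>_def max_def field_simps)
  have \<rho>_id: "\<rho> z = z" if "cmod z \<le> B" for z using that B(1) by (simp add: \<rho>_def max_def field_simps)
  define \<psi> :: "nat \<Rightarrow> real \<Rightarrow> real" where "\<psi> n x = min 1 (real n * (l - \<bar>x\<bar>))" for n x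
  define f where "f n x = \<psi> n x *\<^sub>R \<rho> (g n x)" for n x
  have \<psi>: "0 \<le> \<psi> n x \<and> \<psi> n x \<le> 1" if "x \<in> {-l..l}" for n x using that by (auto simp: \<psi>_def abs_le_iff)
  have f_cont: "continuous_on UNIV (f n)" for n
    unfolding f_def \<psi>_def
    by (intro continuous_intros continuous_on_compose2[OF \<rho>_cont g]) auto
  have f_le: "cmod (f n x) \<le> B" if "x \<in> {-l..l}" for n x
    using mult_mono[of "\<psi> n x" 1 "cmod (\<rho> (g n x))" B] \<psi>[OF that, of n] \<rho>_le[of "g n x"]
    by (simp add: f_def)
  have f_meas: "f n \<in> borel_measurable (L2_measure l)" for n by (rule continuous_measurable_L2[OF f_cont])
  have f_lim: "(\<lambda>n. f n x) \<longlonglongrightarrow> h x" if x: "x \<in> {-l..l}" "x \<notin> N \<union> {-l, l}" for x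
  proof -
    have "\<bar>x\<bar> < l" using x by auto
    obtain n0 :: nat where n0: "1 / (l - \<bar>x\<bar>) < real n0" using reals_Archimedean2 by blast
    have "\<psi> n x = 1" if "n0 \<le> n" for n
    proof -
      have "1 / (l - \<bar>x\<bar>) \<le> real n" using n0 that by linarith
      then have "1 \<le> real n * (l - \<bar>x\<bar>)" using \<open>\<bar>x\<bar> < l\<close> by (simp add: pos_divide_le_eq)
      then show ?thesis by (simp add: \<psi>_def)
    qed
    then have ev: "\<forall>\<^sub>F n in sequentially. \<rho> (g n x) = f n x"
      by (intro eventually_sequentiallyI[of n0]) (simp add: f_def)
    have "x \<notin> N" using x(2) by blast
    from lim[OF this] have "(\<lambda>n. g n x) \<longlonglongrightarrow> h x" unfolding if_P[OF x(1)] .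
    moreover have "isCont \<rho> (h x)" using \<rho>_cont continuous_on_eq_continuous_at[OF open_UNIV] by blast
    ultimately have \<rho>_lim: "(\<lambda>n. \<rho> (g n x)) \<longlonglongrightarrow> \<rho> (h x)"
      by (rule isCont_tendsto_compose[rotated])
    show ?thesis using Lim_transform_eventually[OF \<rho>_lim ev] unfolding \<rho>_id[OF B(2)[OF x(1)]] .
  qed
  have "(\<lambda>n. L2_norm l (\<lambda>x. f n x - h x)) \<longlonglongrightarrow> 0"
  proof (rule L2_dominated[OF l f_meas h])
    show "integrable (L2_measure l) (\<lambda>_. (2 * B)\<^sup>2)"
      by (rule finite_measure.integrable_const[OF finite_measure_L2[OF l]])
    show "(cmod (f n x - h x))\<^sup>2 \<le> (2 * B)\<^sup>2" if "x \<in> {-l..l}" for n x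
      using norm_triangle_ineq4[of "f n x" "h x"] f_le[OF that, of n] B(2)[OF that] by (intro power_mono) auto
    show "AE x in L2_measure l. (\<lambda>n. f n x) \<longlonglongrightarrow> h x"
    proof (rule AE_L2_measure[OF _ f_lim])
      show "negligible (N \<union> {-l, l})"
        by (rule negligible_Un[OF N negligible_finite]) simp
    qed
  qed
  then have "\<forall>\<^sub>F n in sequentially. L2_norm l (\<lambda>x. f n x - h x) < e/2"
    by (rule order_tendstoD) (use e in simp)
  then obtain n where n: "L2_norm l (\<lambda>x. f n x - h x) < e/2" by (auto simp: eventually_sequentially)
  have ends: "f n (- l) = 0" "f n l = 0" using l by (simp_all add: f_def \<psi>_def)
  obtain u where u: "u \<in> trig_polys l" "\<And>x. x \<in> {-l..l} \<Longrightarrow> cmod (f n x - u x) \<le> e/2"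
    using trig_polys_uniform_approx[OF l f_cont ends, of "e/2"] e by auto
  have "L2_norm l (\<lambda>x. h x - u x) < e"
  proof (rule L2_norm_triangle_half[OF _ _ _ e])
    show "h \<in> L2_space l" "f n \<in> L2_space l" "u \<in> L2_space l"
      using L2_bounded(1)[OF l h B(2)] L2_bounded(1)[OF l f_meas f_le] trig_polys_in_L2[OF l u(1)] by auto
    show "L2_norm l (\<lambda>x. h x - f n x) < e/2" using n by (subst L2_norm_minus_commute)
    show "L2_norm l (\<lambda>x. f n x - u x) \<le> e/2"
      by (rule L2_bounded(2)[OF l continuous_measurable_L2 u(2)])
         (intro continuous_on_diff f_cont continuous_on_trig_poly[OF u(1)])
  qed
  then show thesis using u(1) that by blast
qed

lemma trig_polys_dense:
  assumes l: "0 < l" and h: "h \<in> L2_space l" and e: "0 < e"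
  obtains u where "u \<in> trig_polys l" "L2_norm l (\<lambda>x. h x - u x) < e"
proof -
  have h_meas [measurable]: "h \<in> borel_measurable (L2_measure l)" using h by (simp add: L2_space_def)
  define f where "f n x = (if cmod (h x) \<le> real n then h x else 0)" for n x
  have f_meas: "f n \<in> borel_measurable (L2_measure l)" for n unfolding f_def by measurable
  have "(\<lambda>n. L2_norm l (\<lambda>x. f n x - h x)) \<longlonglongrightarrow> 0"
  proof (rule L2_dominated[OF l f_meas h_meas])
    show "integrable (L2_measure l) (\<lambda>x. (cmod (h x))\<^sup>2)" using h by (simp add: L2_space_def)
    show "(cmod (f n x - h x))\<^sup>2 \<le> (cmod (h x))\<^sup>2" for n x by (simp add: f_def)
    show "AE x in L2_measure l. (\<lambda>n. f n x) \<longlonglongrightarrow> h x"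
    proof (rule AE_I2)
      fix x
      obtain n0 :: nat where n0: "cmod (h x) < real n0" using reals_Archimedean2 by blast
      show "(\<lambda>n. f n x) \<longlonglongrightarrow> h x"
        by (rule tendsto_eventually, rule eventually_sequentiallyI[of n0]) (use n0 in \<open>simp add: f_def\<close>)
    qed
  qed
  then have "\<forall>\<^sub>F n in sequentially. L2_norm l (\<lambda>x. f n x - h x) < e/2"
    by (rule order_tendstoD) (use e in simp)
  then obtain n where n: "L2_norm l (\<lambda>x. f n x - h x) < e/2" by (auto simp: eventually_sequentially)
  \<comment> \<open>The bound must be positive, also for n = 0.\<close>
  have f_le: "cmod (f n x) \<le> real n + 1" for x by (simp add: f_def)
  obtain u where u: "u \<in> trig_polys l" "L2_norm l (\<lambda>x. f n x - u x) < e/2"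
    using trig_polys_dense_bounded[OF l f_meas _ f_le, of "e/2"] e by auto
  have "L2_norm l (\<lambda>x. h x - u x) < e"
  proof (rule L2_norm_triangle_half[OF h _ _ e])
    show "f n \<in> L2_space l" by (rule L2_bounded(1)[OF l f_meas f_le])
    show "u \<in> L2_space l" by (rule trig_polys_in_L2[OF l u(1)])
    show "L2_norm l (\<lambda>x. h x - f n x) < e/2" using n by (subst L2_norm_minus_commute)
    show "L2_norm l (\<lambda>x. f n x - u x) \<le> e/2" using u(2) by simp
  qed
  then show thesis using u(1) that by blast
qed

section \<open>The Dirac operator of a curve\<close>

lemma has_vector_derivative_fourier:
  "(fourier l k has_vector_derivative \<i> * of_real (pi * of_int k / l) * fourier l k x) (at x within A)"
proof -
  define c where "c = \<i> * complex_of_real (pi * of_int k / l)"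
  have "fourier l k = (\<lambda>x. exp (c * of_real x))"
    by (simp add: fun_eq_iff fourier_def c_def mult.assoc flip: of_real_mult)
  moreover have "((\<lambda>z. exp (c * z)) has_field_derivative c * exp (c * of_real x)) (at (of_real x))"
    by (auto intro!: derivative_eq_intros)
  then have "((\<lambda>x. exp (c * of_real x)) has_vector_derivative c * exp (c * of_real x)) (at x within A)"
    by (rule has_vector_derivative_real_field)
  ultimately show ?thesis by (simp add: c_def)
qed

lemma fourier_end_points:
  assumes "l \<noteq> 0"
  shows "fourier l k (- l) = fourier l k l"
proof -
  have "fourier l k l = cis (pi * of_int k)" "fourier l k (- l) = cis (- (pi * of_int k))"
    using assms by (simp_all add: fourier_def cis_conv_exp)
  then show ?thesis by (simp add: complex_eq_iff sin_npi_int)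
qed

lemma fourier_measurable: "fourier l k \<in> borel_measurable (L2_measure l)"
  by (rule continuous_measurable_L2[OF continuous_on_fourier])

lemma integral_fourier:
  assumes l: "0 < l"
  shows "(LINT x|L2_measure l. fourier l k x) = (if k = 0 then 1 else 0)"
proof (cases "k = 0")
  case True
  then show ?thesis using l by (simp add: fourier_0 measure_L2)
next
  case False
  have m: "fourier l k \<in> borel_measurable (lebesgue_on {-l..l})"
    using fourier_measurable[of l k] by (simp add: measurable_L2_measure)
  have "finite_measure (lebesgue_on {-l..l})"
    using l by (intro finite_measureI) (simp add: emeasure_restrict_space)
  then have int: "integrable (lebesgue_on {-l..l}) (fourier l k)"
    using m by (intro finite_measure.integrable_const_bound[of _ _ 1]) auto
  define c where "c = \<i> * complex_of_real (pi * of_int k / l)"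
  have c: "c \<noteq> 0" using False l by (simp add: c_def)
  have "(fourier l k has_integral fourier l k l / c - fourier l k (- l) / c) {-l..l}"
  proof (rule fundamental_theorem_of_calculus)
    fix x
    have "((\<lambda>x. fourier l k x / c) has_vector_derivative (c * fourier l k x) / c) (at x within {-l..l})"
      unfolding c_def by (intro has_vector_derivative_divide has_vector_derivative_fourier)
    then show "((\<lambda>x. fourier l k x / c) has_vector_derivative fourier l k x) (at x within {-l..l})"
      using c by simp
  qed (use l in simp)
  then have "integral {-l..l} (fourier l k) = 0"
    using l by (simp add: fourier_end_points integral_unique)
  then have "(LINT x|lebesgue_on {-l..l}. fourier l k x) = 0"
    using lebesgue_integral_eq_integral[OF int] by simp
  moreover have "(LINT x|L2_measure l. fourier l k x) =
      (LINT x|lebesgue_on {-l..l}. (1 / (2 * l)) *\<^sub>R fourier l k x)"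
    unfolding L2_measure_def using l m by (intro integral_density) auto
  ultimately show ?thesis using False by simp
qed

lemma L2_inner_fourier:
  assumes "0 < l"
  shows "L2_inner l (fourier l j) (fourier l k) = (if j = k then 1 else 0)"
  using integral_fourier[OF assms, of "j - k"] by (simp add: L2_inner_def cnj_fourier fourier_mult)

lemma fourier_in_L2: "0 < l \<Longrightarrow> fourier l k \<in> L2_space l"
  by (rule L2_bounded(1)[OF _ fourier_measurable, of _ _ 1]) simp_all

lemma L2_norm_fourier: "0 < l \<Longrightarrow> L2_norm l (fourier l k) = 1"
  by (simp add: L2_norm_def L2_inner_fourier)

text \<open>Take a trigonometric polynomial u close to h. Once the partial sums include all
  frequencies of u they reproduce u, so the remainder of h is the remainder of h - u, whose norm is
  at most that of h - u.\<close>

lemma st_onb_fourier: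
  assumes l: "0 < l"
  shows "st_onb (curve_triple X l R) (\<lambda>n. fourier l (int_decode n))"
proof -
  interpret semi_inner_space "curve_triple X l R" by (rule semi_inner_space_curve)
  let ?e = "\<lambda>n. fourier l (int_decode n)"
  have e: "orthonormal ?e"
    using l by (simp add: orthonormal_def fourier_in_L2 L2_inner_fourier int_decode_eq)
  have "(\<lambda>N. L2_norm l (\<lambda>x. h x - (\<Sum>n<N. L2_inner l h (?e n) * ?e n x))) \<longlonglongrightarrow> 0" if h: "h \<in> L2_space l" for h
  proof (rule tendstoI)
    fix \<epsilon> :: real assume \<epsilon>: "0 < \<epsilon>"
    obtain u where u: "u \<in> trig_polys l" "L2_norm l (\<lambda>x. h x - u x) < \<epsilon>"
      by (rule trig_polys_dense[OF l h \<epsilon>])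
    obtain c K where K: "finite K" "u = (\<lambda>x. \<Sum>k\<in>K. c k * fourier l k x)"
      using u(1) unfolding trig_polys_eq by blast
    define r where "r x = h x - u x" for x
    have um: "u \<in> L2_space l" by (rule trig_polys_in_L2[OF l u(1)])
    have r: "r \<in> L2_space l"
      unfolding r_def by (rule diff_mem[unfolded curve_triple_sel, OF h um])
    have ip_u: "L2_inner l u (fourier l k) = (if k \<in> K then c k else 0)" for k
    proof -
      have "L2_inner l u (fourier l k) = (\<Sum>j\<in>K. L2_inner l (\<lambda>x. c j * fourier l j x) (fourier l k))"
        unfolding K(2) using l
        by (intro inner_sum_left[unfolded curve_triple_sel] scale_mem[unfolded curve_triple_sel] fourier_in_L2)
      also have "\<dots> = (\<Sum>j\<in>K. c j * (if j = k then 1 else 0))"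
        using l by (intro sum.cong refl)
          (simp only: inner_scale_left[unfolded curve_triple_sel] fourier_in_L2 L2_inner_fourier)
      finally show ?thesis using K(1) by (simp add: sum.delta if_distrib cong: if_cong)
    qed
    obtain N0 where N0: "int_encode ` K \<subseteq> {..<N0}"
      using finite_nat_iff_bounded[of "int_encode ` K"] K(1) by auto
    have "L2_norm l (\<lambda>x. h x - (\<Sum>n<N. L2_inner l h (?e n) * ?e n x)) < \<epsilon>" if N: "N0 \<le> N" for N
    proof -
      have "(\<Sum>n<N. L2_inner l u (?e n) * ?e n x) = u x" for x
      proof -
        have "(\<Sum>n<N. L2_inner l u (?e n) * ?e n x) = (\<Sum>n\<in>int_encode ` K. L2_inner l u (?e n) * ?e n x)"
          using N N0 by (intro sum.mono_neutral_right) (force simp: ip_u)+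
        also have "\<dots> = u x"
          unfolding K(2) by (subst sum.reindex) (simp_all add: inj_on_def int_encode_eq ip_u[unfolded K(2)])
        finally show ?thesis .
      qed
      moreover have "L2_inner l r (?e n) = L2_inner l h (?e n) - L2_inner l u (?e n)" for n
        unfolding r_def by (rule inner_diff_left[unfolded curve_triple_sel, OF h um fourier_in_L2[OF l]])
      ultimately have eq: "(\<lambda>x. h x - (\<Sum>n<N. L2_inner l h (?e n) * ?e n x)) =
          (\<lambda>x. r x - (\<Sum>n<N. L2_inner l r (?e n) * ?e n x))"
        by (simp add: r_def left_diff_distrib sum_subtractf)
      have "(L2_norm l (\<lambda>x. r x - (\<Sum>n<N. L2_inner l r (?e n) * ?e n x)))\<^sup>2 \<le> (L2_norm l r)\<^sup>2"
        using orthonormal_expansion(2)[OF e, unfolded curve_triple_sel, OF r, of N]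
          sum_nonneg[of "{..<N}" "\<lambda>n. (cmod (L2_inner l r (?e n)))\<^sup>2"] by simp
      then have "L2_norm l (\<lambda>x. r x - (\<Sum>n<N. L2_inner l r (?e n) * ?e n x)) \<le> L2_norm l r"
        by (rule power2_le_imp_le) (simp add: L2_norm_eq)
      also have "L2_norm l r < \<epsilon>" using u(2) by (simp add: r_def[abs_def])
      finally show ?thesis unfolding eq .
    qed
    then show "\<forall>\<^sub>F N in sequentially. dist (L2_norm l (\<lambda>x. h x - (\<Sum>n<N. L2_inner l h (?e n) * ?e n x))) 0 < \<epsilon>"
      by (intro eventually_sequentiallyI[of N0]) (simp add: L2_norm_eq)
  qed
  then show ?thesis using e unfolding st_onb_def orthonormal_def by simp
qed

definition dirac_eigenvalue :: "real \<Rightarrow> int \<Rightarrow> real" where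
  "dirac_eigenvalue l k = (2 * of_int k + 1) * pi / (2 * l)"

lemma dirac_eigenvalue_eq: "dirac_eigenvalue l k = pi * of_int k / l + pi / (2 * l)"
  by (cases "l = 0") (simp_all add: dirac_eigenvalue_def field_simps)

lemma trig_poly_vector_derivative:
  assumes "finite K"
  shows "- \<i> * vector_derivative (\<lambda>x. \<Sum>k\<in>K. c k * fourier l k x) (at x) =
    (\<Sum>k\<in>K. (of_real (pi * of_int k / l) * c k) * fourier l k x)"
proof -
  have "((\<lambda>x. \<Sum>k\<in>K. c k * fourier l k x) has_vector_derivative
      (\<Sum>k\<in>K. c k * (\<i> * of_real (pi * of_int k / l) * fourier l k x))) (at x)"
    by (intro has_vector_derivative_sum has_vector_derivative_mult_right has_vector_derivative_fourier)
  then show ?thesis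
    by (simp add: vector_derivative_at sum_distrib_left mult_ac)
qed

lemma D_curveI:
  "(h, g) \<in> D_closure l \<Longrightarrow> (h, \<lambda>x. g x + of_real (pi / (2 * l)) * h x) \<in> D_curve l"
  unfolding D_curve_def by blast

text \<open>The free coefficient allows D to be applied a second time to its own output, and c = 0
  puts the zero pair into the graph. A constant approximating sequence witnesses membership in the
  closure.\<close>

lemma D_curve_fourier:
  assumes l: "0 < l"
  shows "((\<lambda>x. c * fourier l k x), (\<lambda>x. of_real (dirac_eigenvalue l k) * (c * fourier l k x))) \<in> D_curve l"
proof -
  interpret semi_inner_space "curve_triple (UNIV :: real set) l id" by (rule semi_inner_space_curve)
  let ?h = "\<lambda>x. c * fourier l k x" and ?g = "\<lambda>x. of_real (pi * of_int k / l) * (c * fourier l k x)"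
  have mem: "?h \<in> L2_space l" "?g \<in> L2_space l"
    using scale_mem[unfolded curve_triple_sel] fourier_in_L2[OF l] by blast+
  have "- \<i> * vector_derivative ?h (at x) = ?g x" for x
    using trig_poly_vector_derivative[of "{k}" "\<lambda>_. c" l x] by (simp add: mult.assoc)
  then have "(?h, ?g) \<in> D_closure l"
    unfolding D_closure_def using mem
    by (intro CollectI case_prodI conjI exI[of _ "\<lambda>_. ?h"])
       (simp_all add: trig_polys_scale_fourier L2_norm_eq)
  then have "(?h, \<lambda>x. ?g x + of_real (pi / (2 * l)) * ?h x) \<in> D_curve l"
    by (rule D_curveI)
  moreover have "(\<lambda>x. ?g x + of_real (pi / (2 * l)) * ?h x) =
      (\<lambda>x. of_real (dirac_eigenvalue l k) * (c * fourier l k x))"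
    by (simp add: dirac_eigenvalue_eq fun_eq_iff distrib_right)
  ultimately show ?thesis by simp
qed

text \<open>Symmetry of the operator against its own eigenvectors, for an arbitrary pair of the
  graph: it is checked on trigonometric polynomials and survives limits in both components. It gives
  access to eigenbases of unknown form.\<close>

lemma D_curve_inner_fourier:
  assumes l: "0 < l" and hg: "(h, g) \<in> D_curve l"
  shows "L2_inner l g (fourier l k) = of_real (dirac_eigenvalue l k) * L2_inner l h (fourier l k)"
proof -
  interpret semi_inner_space "curve_triple (UNIV :: real set) l id" by (rule semi_inner_space_curve)
  note F = fourier_in_L2[OF l]
  obtain g' where g: "g = (\<lambda>x. g' x + of_real (pi / (2 * l)) * h x)" and "(h, g') \<in> D_closure l"
    using hg unfolding D_curve_def by blast
  then obtain u where mem: "h \<in> L2_space l" "g' \<in> L2_space l" and u: "\<And>n. u n \<in> trig_polys l"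
    and uh: "(\<lambda>n. L2_norm l (\<lambda>x. u n x - h x)) \<longlonglongrightarrow> 0"
    and ug: "(\<lambda>n. L2_norm l (\<lambda>x. - \<i> * vector_derivative (u n) (at x) - g' x)) \<longlonglongrightarrow> 0"
    unfolding D_closure_def by auto
  have lim: "(\<lambda>n. L2_inner l (v n) (fourier l k)) \<longlonglongrightarrow> L2_inner l f (fourier l k)"
    if v: "\<And>n. v n \<in> L2_space l" and f: "f \<in> L2_space l"
      and vf: "(\<lambda>n. L2_norm l (\<lambda>x. v n x - f x)) \<longlonglongrightarrow> 0" for v f
  proof -
    have "cmod (L2_inner l (v n) (fourier l k) - L2_inner l f (fourier l k)) \<le> L2_norm l (\<lambda>x. v n x - f x)" for n
      using Cauchy_Schwarz[unfolded curve_triple_sel, OF diff_mem[unfolded curve_triple_sel, OF v f] F, of n k]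
        inner_diff_left[unfolded curve_triple_sel, OF v f F, of n k]
      by (simp add: L2_norm_fourier[OF l])
    then have "(\<lambda>n. L2_inner l (v n) (fourier l k) - L2_inner l f (fourier l k)) \<longlonglongrightarrow> 0"
      by (intro Lim_null_comparison[OF always_eventually[OF allI] vf])
    then show ?thesis by (simp only: LIM_zero_iff)
  qed
  have poly: "(\<lambda>x. - \<i> * vector_derivative (u n) (at x)) \<in> trig_polys l \<and>
      L2_inner l (\<lambda>x. - \<i> * vector_derivative (u n) (at x)) (fourier l k) =
        of_real (pi * of_int k / l) * L2_inner l (u n) (fourier l k)" for n
  proof -
    obtain c K where K: "finite K" "u n = (\<lambda>x. \<Sum>j\<in>K. c j * fourier l j x)"
      using u[of n] unfolding trig_polys_eq by blast
    have d: "(\<lambda>x. - \<i> * vector_derivative (u n) (at x)) =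
        (\<lambda>x. \<Sum>j\<in>K. (of_real (pi * of_int j / l) * c j) * fourier l j x)"
      unfolding K(2) trig_poly_vector_derivative[OF K(1)] ..
    have ip: "L2_inner l (\<lambda>x. \<Sum>j\<in>K. a j * fourier l j x) (fourier l k) = (if k \<in> K then a k else 0)" for a
    proof -
      have "L2_inner l (\<lambda>x. \<Sum>j\<in>K. a j * fourier l j x) (fourier l k) =
          (\<Sum>j\<in>K. L2_inner l (\<lambda>x. a j * fourier l j x) (fourier l k))"
        by (intro inner_sum_left[unfolded curve_triple_sel] scale_mem[unfolded curve_triple_sel] F)
      also have "\<dots> = (\<Sum>j\<in>K. a j * (if j = k then 1 else 0))"
        by (intro sum.cong refl) (simp only: inner_scale_left[unfolded curve_triple_sel] F L2_inner_fourier[OF l])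
      finally show ?thesis using K(1) by (simp add: sum.delta if_distrib cong: if_cong)
    qed
    have "(\<lambda>x. \<Sum>j\<in>K. (of_real (pi * of_int j / l) * c j) * fourier l j x) \<in> trig_polys l"
      by (intro trig_polys_sum trig_polys_scale_fourier)
    then show ?thesis unfolding d unfolding K(2) ip by simp
  qed
  have "(\<lambda>n. of_real (pi * of_int k / l) * L2_inner l (u n) (fourier l k)) \<longlonglongrightarrow> L2_inner l g' (fourier l k)"
    using lim[OF _ mem(2) ug] poly trig_polys_in_L2[OF l] by simp
  moreover have "(\<lambda>n. of_real (pi * of_int k / l) * L2_inner l (u n) (fourier l k)) \<longlonglongrightarrow>
      of_real (pi * of_int k / l) * L2_inner l h (fourier l k)"
    by (intro tendsto_mult tendsto_const lim mem uh trig_polys_in_L2[OF l u])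
  ultimately have "L2_inner l g' (fourier l k) = of_real (pi * of_int k / l) * L2_inner l h (fourier l k)"
    by (rule LIMSEQ_unique)
  moreover have "L2_inner l g (fourier l k) =
      L2_inner l g' (fourier l k) + of_real (pi / (2 * l)) * L2_inner l h (fourier l k)"
    unfolding g by (simp only: inner_add_left[unfolded curve_triple_sel] inner_scale_left[unfolded curve_triple_sel]
        scale_mem[unfolded curve_triple_sel] mem F)
  ultimately show ?thesis by (simp add: dirac_eigenvalue_eq distrib_right)
qed

text \<open>The exponentials have modulus 1 and the eigenvalues are summable, so the series for T h
  converges absolutely at every point. T is therefore a genuine function, exactly linear, and
  bounded by the sum of its eigenvalues.\<close>

lemma curve_operator_exists:
  fixes \<phi> :: "nat \<Rightarrow> real"
  assumes l: "0 < l" and sm: "summable \<phi>" and nonneg: "\<And>n. 0 \<le> \<phi> n"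
  shows "\<exists>T. st_bounded_linear (curve_triple X l R) T \<and>
    (\<forall>h\<in>L2_space l. L2_norm l (T h) \<le> (\<Sum>n. \<phi> n) * L2_norm l h) \<and>
    (\<forall>n. T (fourier l (int_decode n)) = (\<lambda>x. of_real (\<phi> n) * fourier l (int_decode n) x))"
proof -
  interpret semi_inner_space "curve_triple X l R" by (rule semi_inner_space_curve)
  let ?e = "\<lambda>n. fourier l (int_decode n)"
  note F = fourier_in_L2[OF l]
  define t where "t h x n = of_real (\<phi> n) * L2_inner l h (?e n) * ?e n x" for h x n
  define T where "T h x = (\<Sum>n. t h x n)" for h x
  have t_le: "norm (t h x n) \<le> \<phi> n * L2_norm l h" if h: "h \<in> L2_space l" for h x n
    using Cauchy_Schwarz[unfolded curve_triple_sel, OF h F, of "int_decode n"] nonneg[of n]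
    by (simp add: t_def norm_mult L2_norm_fourier[OF l] mult_left_mono)
  have t_sm: "summable (\<lambda>n. norm (t h x n))" if h: "h \<in> L2_space l" for h x
    by (rule summable_comparison_test'[OF summable_mult2[OF sm, of "L2_norm l h"], of 0])
       (simp add: t_le[OF h])
  have T_le: "cmod (T h x) \<le> (\<Sum>n. \<phi> n) * L2_norm l h" if h: "h \<in> L2_space l" for h x
  proof -
    have "cmod (T h x) \<le> (\<Sum>n. norm (t h x n))" unfolding T_def by (rule summable_norm[OF t_sm[OF h]])
    also have "\<dots> \<le> (\<Sum>n. \<phi> n * L2_norm l h)"
      by (intro suminf_le t_le h t_sm summable_mult2 sm)
    finally show ?thesis by (simp add: suminf_mult2[OF sm])
  qed
  have T_meas: "T h \<in> borel_measurable (L2_measure l)" for h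
    unfolding T_def t_def
    by (intro borel_measurable_suminf borel_measurable_times borel_measurable_const fourier_measurable)
  have T_mem: "T h \<in> L2_space l" and T_norm: "L2_norm l (T h) \<le> (\<Sum>n. \<phi> n) * L2_norm l h"
    if "h \<in> L2_space l" for h
    using L2_bounded[OF l T_meas T_le] that by blast+
  have T_add: "T (\<lambda>x. g x + h x) = (\<lambda>x. T g x + T h x)" if "g \<in> L2_space l" "h \<in> L2_space l" for g h
  proof
    fix x
    have "t (\<lambda>x. g x + h x) x = (\<lambda>n. t g x n + t h x n)"
      using inner_add_left[unfolded curve_triple_sel, OF that F] by (simp add: t_def fun_eq_iff algebra_simps)
    then show "T (\<lambda>x. g x + h x) x = T g x + T h x"
      unfolding T_def using suminf_add[OF summable_norm_cancel[OF t_sm] summable_norm_cancel[OF t_sm], OF that]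
      by simp
  qed
  have T_scale: "T (\<lambda>x. c * h x) = (\<lambda>x. c * T h x)" if "h \<in> L2_space l" for c h
  proof
    fix x
    have "t (\<lambda>x. c * h x) x = (\<lambda>n. c * t h x n)"
      using inner_scale_left[unfolded curve_triple_sel, OF that F] by (simp add: t_def fun_eq_iff mult_ac)
    then show "T (\<lambda>x. c * h x) x = c * T h x"
      unfolding T_def using suminf_mult[OF summable_norm_cancel[OF t_sm], OF that] by simp
  qed
  have T_e: "T (?e n) = (\<lambda>x. of_real (\<phi> n) * ?e n x)" for n
  proof
    fix x
    have "(\<Sum>m. t (?e n) x m) = (\<Sum>m\<in>{n}. t (?e n) x m)"
      by (rule suminf_finite) (auto simp: t_def L2_inner_fourier[OF l] int_decode_eq)
    then show "T (?e n) x = of_real (\<phi> n) * ?e n x"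
      by (simp add: T_def t_def L2_inner_fourier[OF l])
  qed
  have eq_refl: "st_eq (curve_triple X l R) f f" for f :: "real \<Rightarrow> complex"
    by (simp add: st_eq_def L2_norm_eq)
  have "st_bounded_linear (curve_triple X l R) T"
    unfolding st_bounded_linear_def using T_mem T_norm
    by (auto simp: T_add T_scale eq_refl intro!: exI[of _ "\<Sum>n. \<phi> n"])
  then show ?thesis using T_norm T_e by (intro exI[of _ T]) blast
qed

section \<open>Spectral dimension\<close>

text \<open>The enumeration of the integers is 0, -1, 1, -2, ..., for which the right-hand side
  takes the values 1, 1, 3, 3, and so on.\<close>

lemma abs_int_decode_ge: "(real n + 1) / 2 \<le> \<bar>2 * real_of_int (int_decode n) + 1\<bar>"
proof (cases "even n")
  case True
  then obtain m where "n = 2 * m" by blast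
  then show ?thesis by (simp add: int_decode_def sum_decode_def)
next
  case False
  then obtain m where "n = 2 * m + 1" using oddE by blast
  then show ?thesis by (simp add: int_decode_def sum_decode_def)
qed

text \<open>Dropping the summand 1 separates the dependence on the length from that on the
  frequency, so that the double sum factorises.\<close>

lemma dirac_power_le:
  assumes l: "0 < l" and p: "0 < p"
  shows "(1 + (dirac_eigenvalue l (int_decode n))\<^sup>2) powr (- p / 2)
    \<le> l powr p * ((real n + 1) * pi / 4) powr (- p)"
proof -
  define y where "y = ((real n + 1) * pi / 4) / l"
  have y: "0 < y" using l by (simp add: y_def)
  have "y = (real n + 1) / 2 * (pi / (2 * l))" by (simp add: y_def)
  also have "\<dots> \<le> \<bar>2 * real_of_int (int_decode n) + 1\<bar> * (pi / (2 * l))"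
    using l by (intro mult_right_mono abs_int_decode_ge) simp
  also have "\<dots> = \<bar>dirac_eigenvalue l (int_decode n)\<bar>"
    using l by (simp add: dirac_eigenvalue_def abs_mult)
  finally have "y\<^sup>2 \<le> \<bar>dirac_eigenvalue l (int_decode n)\<bar>\<^sup>2"
    using y by (intro power_mono) auto
  then have "y\<^sup>2 \<le> 1 + (dirac_eigenvalue l (int_decode n))\<^sup>2" by simp
  then have "(1 + (dirac_eigenvalue l (int_decode n))\<^sup>2) powr (- p / 2) \<le> (y\<^sup>2) powr (- p / 2)"
    using y p by (intro powr_mono2') auto
  also have "(y\<^sup>2) powr (- p / 2) = y powr (- p)"
    using y by (simp add: powr_powr flip: powr_numeral)
  also have "\<dots> = l powr p * ((real n + 1) * pi / 4) powr (- p)"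
  proof -
    have "y powr (- p) = ((real n + 1) * pi / 4) powr (- p) / l powr (- p)"
      unfolding y_def by (rule powr_divide)
    then show ?thesis by (simp add: powr_minus_divide[of l p] mult.commute)
  qed
  finally show ?thesis .
qed

lemma summable_Suc_powr_iff: "summable (\<lambda>n. (real n + 1) powr s) \<longleftrightarrow> s < -1"
  using summable_Suc_iff[of "\<lambda>n. real n powr s"] summable_real_powr_iff[of s] by (simp add: add.commute)

lemma summable_dirac_majorant:
  assumes "1 < p"
  shows "summable (\<lambda>n. ((real n + 1) * pi / 4) powr (- p))"
proof -
  have "((real n + 1) * pi / 4) powr (- p) = (pi / 4) powr (- p) * (real n + 1) powr (- p)" for n
    using powr_mult[of "pi / 4" "real n + 1" "- p"] by (simp add: mult.commute)
  then show ?thesis using assms by (simp add: summable_mult summable_Suc_powr_iff)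
qed

lemma dirac_power_not_summable:
  assumes l: "0 < l" and p: "0 < p" "p \<le> 1"
  shows "\<not> summable (\<lambda>k. (1 + (dirac_eigenvalue l (int k))\<^sup>2) powr (- p / 2))"
proof
  \<comment> \<open>D absorbs the summand 1 through \<open>1 <= (real k + 1)^2\<close>, leaving a
    constant multiple of \<open>(real k + 1) powr (- p)\<close>.\<close>
  define D where "D = 1 + (pi / l)\<^sup>2"
  have D: "0 < D" using zero_le_power2[of "pi / l"] unfolding D_def by linarith
  assume "summable (\<lambda>k. (1 + (dirac_eigenvalue l (int k))\<^sup>2) powr (- p / 2))"
  then have "summable (\<lambda>k. D powr (- p / 2) * (real k + 1) powr (- p))"
  proof (rule summable_comparison_test'[where N = 0])
    fix k :: nat
    have "(dirac_eigenvalue l (int k))\<^sup>2 = (2 * real k + 1)\<^sup>2 * (pi / (2 * l))\<^sup>2"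
      by (simp add: dirac_eigenvalue_def power_mult_distrib power_divide)
    also have "\<dots> \<le> (2 * (real k + 1))\<^sup>2 * (pi / (2 * l))\<^sup>2"
      by (intro mult_right_mono power_mono) auto
    also have "\<dots> = (real k + 1)\<^sup>2 * (pi / l)\<^sup>2"
      using l by (simp add: power2_eq_square field_simps)
    finally have "1 + (dirac_eigenvalue l (int k))\<^sup>2 \<le> (real k + 1)\<^sup>2 + (real k + 1)\<^sup>2 * (pi / l)\<^sup>2"
      by (intro add_mono one_le_power) simp
    then have "1 + (dirac_eigenvalue l (int k))\<^sup>2 \<le> D * (real k + 1)\<^sup>2"
      by (simp add: D_def algebra_simps)
    then have "(D * (real k + 1)\<^sup>2) powr (- p / 2) \<le> (1 + (dirac_eigenvalue l (int k))\<^sup>2) powr (- p / 2)"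
      using p by (intro powr_mono2') (auto simp: add_pos_nonneg)
    moreover have "(D * (real k + 1)\<^sup>2) powr (- p / 2) = D powr (- p / 2) * (real k + 1) powr (- p)"
      using D by (simp add: powr_mult powr_powr flip: powr_numeral)
    ultimately show "norm (D powr (- p / 2) * (real k + 1) powr (- p))
        \<le> (1 + (dirac_eigenvalue l (int k))\<^sup>2) powr (- p / 2)"
      by simp
  qed
  then have "summable (\<lambda>k. (real k + 1) powr (- p))" using D by (simp add: summable_cmult_iff)
  then show False using p by (simp add: summable_Suc_powr_iff)
qed

section \<open>Spectral dimension of a direct sum of curves\<close>

locale curve_family =
  fixes X :: "'x::topological_space set" and A :: "('x \<Rightarrow> complex) set"
    and len :: "nat \<Rightarrow> real" and c :: "nat \<Rightarrow> real \<Rightarrow> 'x"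
  assumes len_pos: "0 < len j"
begin

abbreviation C where "C \<equiv> \<lambda>j. curve_triple X (len j) (c j)"

sublocale semi_inner_family C A
  by (rule semi_inner_family.intro[OF semi_inner_space_curve])

lemma fourier_mem: "fourier (len j) k \<in> st_space (C j)"
  by (simp add: fourier_in_L2 len_pos)

lemma embed_fourier_eigenvector:
  "(embed j (fourier (len j) k),
    \<lambda>x. of_real (1 + (dirac_eigenvalue (len j) k)\<^sup>2) * embed j (fourier (len j) k) x)
    \<in> st_one_plus_dirac_sq Sum"
proof -
  let ?f = "fourier (len j) k" and ?m = "complex_of_real (dirac_eigenvalue (len j) k)"
  have scale: "(\<lambda>x. a * ?f x) \<in> st_space (C j)" for a
    by (rule semi_inner_space.scale_mem[OF component fourier_mem])
  have zero: "((\<lambda>_. 0), (\<lambda>_. 0)) \<in> st_dirac (C i)" for i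
    using D_curve_fourier[OF len_pos, of 0 i 0] by simp
  have "(embed j ?f, embed j (\<lambda>x. ?m * ?f x)) \<in> st_dirac Sum"
    using D_curve_fourier[OF len_pos, of 1 j k]
    by (intro embed_dirac fourier_mem scale zero) simp
  moreover have "(embed j (\<lambda>x. ?m * ?f x), embed j (\<lambda>x. ?m * (?m * ?f x))) \<in> st_dirac Sum"
    using D_curve_fourier[OF len_pos, of ?m j k] scale[of "?m * ?m"]
    by (intro embed_dirac scale zero) (simp_all add: mult.assoc)
  moreover have "(\<lambda>x. of_real (1 + (dirac_eigenvalue (len j) k)\<^sup>2) * embed j ?f x) =
      (\<lambda>x. embed j ?f x + embed j (\<lambda>x. ?m * (?m * ?f x)) x)"
    by (auto simp: embed_def fun_eq_iff power2_eq_square algebra_simps)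
  ultimately show ?thesis unfolding st_one_plus_dirac_sq_def by blast
qed

text \<open>Makes every eigenvector of the sum operator orthogonal to the exponentials with a
  different eigenvalue, which is the hypothesis of \<open>eigenvalue_sum_ge\<close>.\<close>

lemma st_one_plus_dirac_sq_inner:
  assumes "(h, g) \<in> st_one_plus_dirac_sq Sum"
  shows "st_inner Sum g (embed j (fourier (len j) k)) =
    of_real (1 + (dirac_eigenvalue (len j) k)\<^sup>2) * st_inner Sum h (embed j (fourier (len j) k))"
proof -
  let ?f = "fourier (len j) k" and ?m = "complex_of_real (dirac_eigenvalue (len j) k)"
  obtain d e where g: "g = (\<lambda>x. h x + e x)" and hd: "(h, d) \<in> st_dirac Sum" and de: "(d, e) \<in> st_dirac Sum"
    using assms unfolding st_one_plus_dirac_sq_def by blast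
  have mem: "h \<in> sum_space C" "d \<in> sum_space C" "e \<in> sum_space C" using hd de by simp_all
  have ip: "st_inner Sum v (embed j ?f) = L2_inner (len j) (summand j v) ?f" if "v \<in> sum_space C" for v
    unfolding inner_embed[OF that fourier_mem] by simp
  have "L2_inner (len j) (summand j e) ?f = ?m * L2_inner (len j) (summand j d) ?f"
    "L2_inner (len j) (summand j d) ?f = ?m * L2_inner (len j) (summand j h) ?f"
    using hd de by (auto intro!: D_curve_inner_fourier len_pos)
  then have "st_inner Sum e (embed j ?f) = ?m * (?m * st_inner Sum h (embed j ?f))"
    by (simp only: ip mem)
  moreover have "st_inner Sum g (embed j ?f) = st_inner Sum h (embed j ?f) + st_inner Sum e (embed j ?f)"
    unfolding g using mem embed_mem[OF fourier_mem] by (intro sum.inner_add_left) simp_all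
  ultimately show ?thesis by (simp add: power2_eq_square distrib_right mult.assoc del: sum_triple_sel)
qed

text \<open>The operator and its eigenbasis are arbitrary here. Comparing the trace with the
  eigenvalues of one curve at non-negative frequencies already excludes every exponent up to
  1.\<close>

lemma spectral_dimension_ge_1: "1 \<le> spectral_dimension Sum"
  unfolding spectral_dimension_def
proof (rule Inf_greatest)
  fix d assume "d \<in> ereal ` {p. p > 0 \<and> (\<exists>T. st_fun_calc Sum (\<lambda>t. t powr (- p / 2)) (st_one_plus_dirac_sq Sum) T \<and>
      st_trace Sum T < \<infinity>)}"
  then obtain p T where d: "d = ereal p" and p: "0 < p"
    and T: "st_fun_calc Sum (\<lambda>t. t powr (- p / 2)) (st_one_plus_dirac_sq Sum) T"
    and tr: "st_trace Sum T < \<infinity>" by blast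
  obtain e lam where lin: "st_bounded_linear Sum T" and e: "st_onb Sum e"
    and eig: "\<And>n. (e n, \<lambda>x. of_real (lam n) * e n x) \<in> st_one_plus_dirac_sq Sum"
    and Te: "\<And>n. st_eq Sum (T (e n)) (\<lambda>x. of_real (lam n powr (- p / 2)) * e n x)"
    using T unfolding st_fun_calc_def by blast
  define b where "b k = embed 0 (fourier (len 0) (int k))" for k :: nat
  define \<nu> where "\<nu> k = 1 + (dirac_eigenvalue (len 0) (int k))\<^sup>2" for k :: nat
  have em: "e n \<in> st_space Sum" for n using e unfolding st_onb_def by blast
  have bm: "b k \<in> st_space Sum" for k using embed_mem[OF fourier_mem] by (simp add: b_def)
  have "st_inner Sum (b k) (b m) = (if k = m then 1 else 0)" for k m
    unfolding b_def inner_embed[OF embed_mem[OF fourier_mem] fourier_mem]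
    by (simp add: summand_embed L2_inner_fourier len_pos)
  then have ortho: "sum.orthonormal b" using bm unfolding sum.orthonormal_def by blast
  \<comment> \<open>The eigenvalue equation of \<open>e n\<close>, paired with \<open>b k\<close>,
    is evaluated in two ways: by scaling, and by the symmetry of the operator.\<close>
  have "of_real (lam n) * st_inner Sum (e n) (b k) = of_real (\<nu> k) * st_inner Sum (e n) (b k)" for n k
    using st_one_plus_dirac_sq_inner[OF eig, of n 0 "int k"] sum.inner_scale_left[OF em bm, of "of_real (lam n)" n k]
    unfolding b_def \<nu>_def by (simp del: sum_triple_sel)
  then have "(\<Sum>k. ennreal (\<nu> k powr (- p / 2))) \<le> (\<Sum>n. ennreal (lam n powr (- p / 2)))"
    by (intro sum.eigenvalue_sum_ge[OF e ortho]) simp_all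
  also have "\<dots> = st_trace Sum T"
    by (rule sum.trace_eq[OF lin e Te, symmetric]) simp
  finally have "(\<Sum>k. ennreal (\<nu> k powr (- p / 2))) \<noteq> top" using tr by auto
  then have "summable (\<lambda>k. \<nu> k powr (- p / 2))" by (intro summable_suminf_not_top) simp_all
  then have "\<not> p \<le> 1" using dirac_power_not_summable[OF len_pos p] unfolding \<nu>_def by blast
  then show "1 \<le> d" by (simp add: d)
qed

text \<open>The operator is built from the summands. Its trace is at most K times the sum of the
  p-th powers of the lengths, where K is finite because p > 1.\<close>

lemma spectral_dimension_le:
  assumes p: "1 < p" and sm: "summable (\<lambda>j. len j powr p)"
  shows "spectral_dimension Sum \<le> ereal p"
proof -
  define \<phi> where "\<phi> j n = (1 + (dirac_eigenvalue (len j) (int_decode n))\<^sup>2) powr (- p / 2)" for j n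
  define K where "K = (\<Sum>n. ((real n + 1) * pi / 4) powr (- p))"
  have \<phi>_nonneg: "0 \<le> \<phi> j n" for j n by (simp add: \<phi>_def)
  have \<phi>_le: "\<phi> j n \<le> len j powr p * ((real n + 1) * pi / 4) powr (- p)" for j n
    unfolding \<phi>_def using p by (intro dirac_power_le len_pos) simp
  have maj: "summable (\<lambda>n. len j powr p * ((real n + 1) * pi / 4) powr (- p))" for j
    by (intro summable_mult summable_dirac_majorant p)
  have \<phi>_sm: "summable (\<phi> j)" for j
    by (rule summable_comparison_test'[OF maj, of 0]) (use \<phi>_nonneg \<phi>_le in simp)
  have row_le: "(\<Sum>n. \<phi> j n) \<le> len j powr p * K" for j
    unfolding K_def suminf_mult[OF summable_dirac_majorant[OF p], symmetric]
    by (rule suminf_le[OF \<phi>_le \<phi>_sm maj])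
  have row_nonneg: "0 \<le> (\<Sum>n. \<phi> j n)" for j by (rule suminf_nonneg[OF \<phi>_sm \<phi>_nonneg])
  have col: "summable (\<lambda>j. \<Sum>n. \<phi> j n)"
    by (rule summable_comparison_test'[OF summable_mult2[OF sm, of K], of 0])
      (use row_nonneg row_le in simp)
  \<comment> \<open>B will be the whole trace; it bounds the norms of all summands at once, as the
    direct sum of operators requires.\<close>
  define B where "B = (\<Sum>j. \<Sum>n. \<phi> j n)"
  have row_le_B: "(\<Sum>n. \<phi> j n) \<le> B" for j
    using sum_le_suminf[OF col, of "{j}"] row_nonneg by (simp add: B_def)
  have "\<forall>j. \<exists>T. st_bounded_linear (C j) T \<and>
      (\<forall>h\<in>L2_space (len j). L2_norm (len j) (T h) \<le> (\<Sum>n. \<phi> j n) * L2_norm (len j) h) \<and>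
      (\<forall>n. T (fourier (len j) (int_decode n)) = (\<lambda>x. of_real (\<phi> j n) * fourier (len j) (int_decode n) x))"
    by (intro allI curve_operator_exists len_pos \<phi>_sm \<phi>_nonneg)
  from choice[OF this] obtain T where lin: "\<And>j. st_bounded_linear (C j) (T j)"
    and T_le: "\<And>j h. h \<in> L2_space (len j) \<Longrightarrow> L2_norm (len j) (T j h) \<le> (\<Sum>n. \<phi> j n) * L2_norm (len j) h"
    and Te: "\<And>j n. T j (fourier (len j) (int_decode n)) = (\<lambda>x. of_real (\<phi> j n) * fourier (len j) (int_decode n) x)"
    by blast
  have bound: "st_norm (C j) (T j h) \<le> B * st_norm (C j) h" if "h \<in> st_space (C j)" for j h
    using T_le[of h j] that mult_right_mono[OF row_le_B[of j], of "L2_norm (len j) h"]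
    by (simp add: L2_norm_eq)
  define e where "e n = (case prod_decode n of (j, k) \<Rightarrow> embed j (fourier (len j) (int_decode k)))" for n
  define lam where "lam n = (case prod_decode n of (j, k) \<Rightarrow> 1 + (dirac_eigenvalue (len j) (int_decode k))\<^sup>2)" for n
  have onb: "st_onb Sum e"
    unfolding e_def by (rule onb_Sum[OF st_onb_fourier[OF len_pos]])
  have op: "st_bounded_linear Sum (sum_op T)" by (rule st_bounded_linear_sum_op[OF lin bound])
  have eig: "(e n, \<lambda>x. of_real (lam n) * e n x) \<in> st_one_plus_dirac_sq Sum" for n
    unfolding e_def lam_def
    by (cases "prod_decode n") (simp only: prod.case, rule embed_fourier_eigenvector)
  have Teq: "st_eq Sum (sum_op T (e n)) (\<lambda>x. of_real (lam n powr (- p / 2)) * e n x)" for n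
  proof -
    obtain j k where jk: "prod_decode n = (j, k)" by (cases "prod_decode n")
    have "st_eq (C j) (T j (fourier (len j) (int_decode k))) (\<lambda>x. of_real (\<phi> j k) * fourier (len j) (int_decode k) x)"
      by (simp add: Te st_eq_def L2_norm_eq)
    from sum_op_embed[OF lin bound fourier_mem this] show ?thesis
      by (simp only: e_def lam_def jk prod.case \<phi>_def)
  qed
  have calc: "st_fun_calc Sum (\<lambda>t. t powr (- p / 2)) (st_one_plus_dirac_sq Sum) (sum_op T)"
    unfolding st_fun_calc_def using op onb eig Teq by blast
  have "(\<lambda>(j, n). \<phi> j n) summable_on UNIV \<times> UNIV"
  proof (rule summable_on_SigmaI)
    show "((\<lambda>n. case (j, n) of (j, n) \<Rightarrow> \<phi> j n) has_sum (\<Sum>n. \<phi> j n)) UNIV" for j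
      unfolding prod.case by (rule sums_nonneg_imp_has_sum[OF summable_sums[OF \<phi>_sm] \<phi>_nonneg])
    show "(\<lambda>j. \<Sum>n. \<phi> j n) summable_on UNIV"
      by (rule summable_nonneg_imp_summable_on[OF col row_nonneg])
  qed (simp add: \<phi>_nonneg)
  then have "(\<lambda>n. (\<lambda>(j, n). \<phi> j n) (prod_decode n)) summable_on UNIV"
    using summable_on_reindex_bij_betw[OF bij_prod_decode, of "\<lambda>(j, n). \<phi> j n"] by simp
  then have "summable (\<lambda>n. (\<lambda>(j, n). \<phi> j n) (prod_decode n))" by (rule summable_on_imp_summable)
  moreover have "(\<lambda>(j, n). \<phi> j n) (prod_decode n) = lam n powr (- p / 2)" for n
    by (simp add: lam_def \<phi>_def split: prod.split)
  ultimately have "summable (\<lambda>n. lam n powr (- p / 2))" by simp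
  then have "(\<Sum>n. ennreal (lam n powr (- p / 2))) \<noteq> top" by (rule ennreal_suminf_neq_top) simp
  moreover have "st_trace Sum (sum_op T) = (\<Sum>n. ennreal (lam n powr (- p / 2)))"
    by (rule sum.trace_eq[OF op onb Teq]) simp
  ultimately have "st_trace Sum (sum_op T) < \<infinity>" by (simp add: less_top)
  with calc p show ?thesis
    unfolding spectral_dimension_def by (intro Inf_lower imageI CollectI conjI exI[of _ "sum_op T"]) auto
qed

end

theorem lemma4p1:
  fixes R :: "nat \<Rightarrow> (real^2) set"
  assumes "bij_betw R UNIV sg_edges"
  shows "(\<forall>s::real. s > ln 3 / (ln 5 - ln 3) \<longrightarrow> summable (\<lambda>j. edge_length (R j) powr s)) \<and>
         1 \<le> spectral_dimension (S_KH R) \<and>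
         spectral_dimension (S_KH R) \<le> ereal (ln 3 / (ln 5 - ln 3))"
proof -
  let ?d = "ln 3 / (ln 5 - ln 3) :: real"
  have sm: "summable (\<lambda>j. edge_length (R j) powr s)" if "?d < s" for s
    by (rule edge_length_summable[OF assms that])
  have "R j \<in> sg_edges" for j using assms by (auto simp: bij_betw_def)
  then interpret curve_family K_H "{f. continuous_on K_H f}" "\<lambda>j. edge_length (R j)"
      "\<lambda>j. arclength_param (edge_curve (R j))"
    by unfold_locales (rule edge_length_pos)
  have S: "S_KH R = Sum" by (simp add: S_KH_def)
  \<comment> \<open>The critical exponent exceeds 1 because 5 < 9, so exponents above it satisfy the
    hypothesis p > 1 of \<open>spectral_dimension_le\<close>.\<close>
  have "ln (5::real) < ln (3 * 3)" by simp
  then have "ln (5::real) < ln 3 + ln 3" by (subst (asm) ln_mult) simp_all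
  then have d: "1 < ?d" by (simp add: field_simps)
  have "spectral_dimension (S_KH R) \<le> ereal ?d"
  \<comment> \<open>The estimate is available only strictly above the critical exponent; all larger
    bounds together give the bound at it.\<close>
  proof (rule dense_ge)
    fix x assume x: "ereal ?d < x"
    show "spectral_dimension (S_KH R) \<le> x"
    proof (cases x)
      case (real s)
      then have "?d < s" using x by simp
      then have "1 < s" using d by (rule less_trans[rotated])
      then show ?thesis unfolding real S by (intro spectral_dimension_le sm \<open>?d < s\<close>)
    qed (use x in auto)
  qed
  then show ?thesis using sm spectral_dimension_ge_1 unfolding S by blast
qed

end
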